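(* Let $p$ be an odd prime and let $G=\langle g\rangle$ be the cyclic group of order $p$ generated by $g=\begin{pmatrix}1&1\\0&1\end{pmatrix}$ acting linearly on $V=\mathbb{F}_p^2$ with basis $v_1,v_2$ (so ${}^gv_1=v_1$ and ${}^gv_2=v_1+v_2$). There are exactly $p^{3p+1}$ Drinfeld orbifold algebras $\mathcal{H}_{\lambda,\kappa}$ (counted by their parameter pairs $(\lambda,\kappa)$), and each is given by the following procedure. Fix $b=\sum_{j=0}^{p-1}b_jg^j\in\mathbb{F}_pG$, let $k\in\{0,\dots,p\}$ be the unique integer such that $b=(g-1)^k\,\tilde b$ for some $\tilde b=\sum_i\tilde b_ig^i\in\mathbb{F}_pG$ with $\sum_i\tilde b_i\neq0$, and fix $\mathbf{d}=(d_1,\dots,d_k)\in\mathbb{F}_p^k$, an $\mathbb{F}_p$-linear function $f:V\to\mathbb{F}_pG$, $f(v)=\sum_{j=0}^{p-1}f_j(v)g^j$, and $\kappa^C\in\mathbb{F}_pG$. Set, for $0\le i\le p-1$, $$\lambda(g^i,v_1)=i\,b\,g^i,$$ $$\lambda(g^i,v_2)=\sum_{j=0}^{p-1}\left(\binom{i}{2}+i\,j^{p-2}\binom{j+1}{2}\right)b_j\,g^{i+j}+i\sum_{j=0}^{p-1}j^{p-2}\mu(\mathbf{d},j)\,g^{i+j}-i\left(\sum_{j=0}^{p-1}f_j(v_1)g^j\right)g^i,$$ and $$\kappa(v_1,v_2)=\big(d_1-d_2+\cdots+(-1)^{k+1}d_k\big)v_1+\sum_{j=0}^{p-1}j\,b_j\,v_2\,g^j+\kappa^C+\sum_{j=0}^{p-1}j\,f_j(v_1)\,v_1\,g^j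 .$$
   Context: All integer coefficients and binomial coefficients are read in $\mathbb{F}_p$. For $\mathbf{d}=(d_1,\dots,d_k)$ and $j\in\{0,\dots,p-1\}$, $$\mu(\mathbf{d},j)=(-1)^{p-j}\left(\binom{p-1}{p-j}d_1-\binom{p-2}{p-j}d_2+\cdots+(-1)^{k+1}\binom{p-k}{p-j}d_k\right)$$ (empty sums are $0$). The skew group algebra $S\rtimes G$ of an algebra $S$ with $G$ acting by automorphisms is $S\otimes\mathbb{F}_pG$ with $(a\otimes h)(a'\otimes h')=a({}^ha')\otimes hh'$; one writes $ah$ for $a\otimes h$. Given a bilinear map $\lambda:\mathbb{F}_pG\times V\to\mathbb{F}_pG$ and an alternating bilinear map $\kappa:V\times V\to\mathbb{F}_pG\oplus(V\otimes\mathbb{F}_pG)$, set $$\mathcal{H}_{\lambda,\kappa}=(T(V)\rtimes G)\big/\big(hv-{}^hv\,h-\lambda(h,v),\ vw-wv-\kappa(v,w)\ :\ h\in G,\ v,w\in V\big),$$ where $T(V)$ is the tensor algebra. It is filtered by giving each $v\in V$ degree $1$ and each $h\in G$ degree $0$. $\mathcal{H}_{\lambda,\kappa}$ is a Drinfeld orbifold algebra if it is a PBW deformation of $S(V)\rtimes G$ ($S(V)$ the symmetric algebra), i.e. $\operatorname{gr}(\mathcal{H}_{\lambda,\kappa})\cong S(V)\rtimes G$ as graded algebras. Different choices of $f$ with the same value $f(v_1)$ give the same pair $(\lambda,\kappa)$.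
   Formalization: H_{λ,κ} is the quotient of the algebra generated freely by V and F_pG (not of T(V)⋊G, where hv = ^hv h already holds and the relations would force λ(h,v) = 0) by the relations hv − ^hv h − λ(h,v) and vw − wv − κ(v,w). *)

theory Defs
  imports
    "HOL-Analysis.Analysis"
    "HOL-Library.Poly_Mapping"
    "HOL-Algebra.QuotRing"
    "Berlekamp_Zassenhaus.Finite_Field"
begin

section \<open>Free algebras, symmetric algebras, skew group algebras\<close>

datatype 'x free_mon = Letters (letters: "'x list")

text \<open>The free monoid, written additively so that \<^typ>\<open>'x free_mon \<Rightarrow>\<^sub>0 'k\<close> with its convolution
  product is the free associative unital algebra on \<^typ>\<open>'x\<close>.\<close>

instantiation free_mon :: (type) monoid_add
begin
definition zero_free_mon :: "'x free_mon" where "zero_free_mon = Letters []"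
definition plus_free_mon :: "'x free_mon \<Rightarrow> 'x free_mon \<Rightarrow> 'x free_mon"
  where "plus_free_mon u w = Letters (letters u @ letters w)"
instance by standard (auto simp: zero_free_mon_def plus_free_mon_def)
end

definition type_ring :: "'a::ring_1 ring"
  where "type_ring = \<lparr>carrier = UNIV, mult = (*), one = 1, zero = 0, add = (+)\<rparr>"

text \<open>The symmetric algebra of \<^typ>\<open>'k ^ 'n\<close> is the polynomial algebra on the standard basis.\<close>

type_synonym ('k, 'n) sym_alg = "('n \<Rightarrow>\<^sub>0 nat) \<Rightarrow>\<^sub>0 'k"

definition sym_vec :: "'k::comm_ring_1 ^ 'n::finite \<Rightarrow> ('k, 'n) sym_alg"
  where "sym_vec v = (\<Sum>i\<in>UNIV. Poly_Mapping.single (Poly_Mapping.single i 1) (v $ i))"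

text \<open>The algebra endomorphism of the symmetric algebra that extends the linear map
  \<open>v \<mapsto> A v\<close>.\<close>

definition sym_action :: "'k::comm_ring_1 ^ 'n ^ 'n::finite \<Rightarrow> ('k, 'n) sym_alg \<Rightarrow> ('k, 'n) sym_alg"
  where "sym_action A s = (\<Sum>m\<in>Poly_Mapping.keys s. Poly_Mapping.single 0 (Poly_Mapping.lookup s m) *
    (\<Prod>i\<in>UNIV. sym_vec (A *v axis i 1) ^ Poly_Mapping.lookup m i))"

text \<open>An element of \<open>A \<rtimes> G\<close> is stored as the family of its coefficients in \<open>A\<close>: \<open>x $ h\<close> is the
  coefficient of \<open>h\<close>.\<close>

definition skew_group_algebra :: "('g::{finite,monoid_mult} \<Rightarrow> 'a \<Rightarrow> 'a) \<Rightarrow> ('a::ring_1, 'g) vec ring"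
  where "skew_group_algebra act =
    \<lparr>carrier = UNIV,
     mult = (\<lambda>x y. \<chi> k. \<Sum>(h, h')\<in>{(h, h'). h * h' = k}. x $ h * act h (y $ h')),
     one = axis 1 1, zero = 0, add = (+)\<rparr>"

text \<open>In the group algebra \<open>'k ^ 'g\<close> the group element \<open>h\<close> is \<open>axis h 1\<close>.\<close>

abbreviation group_algebra :: "('k::ring_1, 'g::{finite,monoid_mult}) vec ring"
  where "group_algebra \<equiv> skew_group_algebra (\<lambda>h a. a)"

section \<open>Graded algebras and associated graded algebras\<close>

text \<open>A graded algebra is given by the family of its homogeneous components, with the products of
  the components of degrees \<open>m\<close> and \<open>n\<close> landing in that of degree \<open>m + n\<close>.\<close>

record ('k, 'a) graded_algebra =
  component :: "nat \<Rightarrow> 'a set"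
  gadd :: "nat \<Rightarrow> 'a \<Rightarrow> 'a \<Rightarrow> 'a"
  gscale :: "nat \<Rightarrow> 'k \<Rightarrow> 'a \<Rightarrow> 'a"
  gmult :: "nat \<Rightarrow> nat \<Rightarrow> 'a \<Rightarrow> 'a \<Rightarrow> 'a"
  gone :: "'a"

definition graded_algebra_iso ::
  "('k, 'a) graded_algebra \<Rightarrow> ('k, 'b) graded_algebra \<Rightarrow> (nat \<Rightarrow> 'a \<Rightarrow> 'b) \<Rightarrow> bool"
  where "graded_algebra_iso A B \<phi> \<longleftrightarrow>
    (\<forall>n. bij_betw (\<phi> n) (component A n) (component B n)) \<and>
    (\<forall>n. \<forall>x\<in>component A n. \<forall>y\<in>component A n. \<phi> n (gadd A n x y) = gadd B n (\<phi> n x) (\<phi> n y)) \<and>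
    (\<forall>n c. \<forall>x\<in>component A n. \<phi> n (gscale A n c x) = gscale B n c (\<phi> n x)) \<and>
    (\<forall>m n. \<forall>x\<in>component A m. \<forall>y\<in>component A n.
       \<phi> (m + n) (gmult A m n x y) = gmult B m n (\<phi> m x) (\<phi> n y)) \<and>
    \<phi> 0 (gone A) = gone B"

definition graded_algebra_isomorphic ::
  "('k, 'a) graded_algebra \<Rightarrow> ('k, 'b) graded_algebra \<Rightarrow> bool"
  where "graded_algebra_isomorphic A B \<longleftrightarrow> (\<exists>\<phi>. graded_algebra_iso A B \<phi>)"

text \<open>The associated graded algebra \<open>\<Oplus>\<^sub>n F n / F (n - 1)\<close>, with \<open>F (-1) = 0\<close>, of a ring \<open>R\<close> with an
  exhaustive filtration \<open>F\<close>; the map \<open>scal\<close> from the ground field to \<open>R\<close> is the algebra structure.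
  Elements of the components are cosets, and operations on cosets are defined as for
  \<^const>\<open>FactRing\<close>.\<close>

definition filtration_below :: "('a, 'm) ring_scheme \<Rightarrow> (nat \<Rightarrow> 'a set) \<Rightarrow> nat \<Rightarrow> 'a set"
  where "filtration_below R F n = (case n of 0 \<Rightarrow> {\<zero>\<^bsub>R\<^esub>} | Suc m \<Rightarrow> F m)"

definition assoc_graded ::
  "('a, 'm) ring_scheme \<Rightarrow> ('k \<Rightarrow> 'a) \<Rightarrow> (nat \<Rightarrow> 'a set) \<Rightarrow> ('k, 'a set) graded_algebra"
  where "assoc_graded R scal F =
    \<lparr>component = (\<lambda>n. {filtration_below R F n +>\<^bsub>R\<^esub> x | x. x \<in> F n}),
     gadd = (\<lambda>n. set_add R),
     gscale = (\<lambda>n c X. \<Union>x\<in>X. filtration_below R F n +>\<^bsub>R\<^esub> (scal c \<otimes>\<^bsub>R\<^esub> x)),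
     gmult = (\<lambda>m n X Y. \<Union>x\<in>X. \<Union>y\<in>Y. filtration_below R F (m + n) +>\<^bsub>R\<^esub> (x \<otimes>\<^bsub>R\<^esub> y)),
     gone = filtration_below R F 0 +>\<^bsub>R\<^esub> \<one>\<^bsub>R\<^esub>\<rparr>"

text \<open>\<open>S(V) \<rtimes> G\<close> for \<open>V =\<close> \<^typ>\<open>'k ^ 'n\<close> and \<open>G\<close> acting through \<open>\<rho>\<close>, graded with \<open>V\<close> in degree 1 and
  \<open>G\<close> in degree 0.\<close>

definition sym_skew_graded ::
  "('g::{finite,monoid_mult} \<Rightarrow> 'k::comm_ring_1 ^ 'n ^ 'n::finite) \<Rightarrow>
   ('k, (('k, 'n) sym_alg, 'g) vec) graded_algebra"
  where "sym_skew_graded \<rho> =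
    (let R = skew_group_algebra (\<lambda>h. sym_action (\<rho> h)) in
    \<lparr>component = (\<lambda>n. {x. \<forall>h. \<forall>m\<in>Poly_Mapping.keys (x $ h). (\<Sum>i\<in>UNIV. Poly_Mapping.lookup m i) = n}),
     gadd = (\<lambda>n. add R),
     gscale = (\<lambda>n c x. \<chi> h. Poly_Mapping.single 0 c * x $ h),
     gmult = (\<lambda>m n. mult R),
     gone = one R\<rparr>)"

section \<open>The algebras \<open>H\<^bsub>\<lambda>,\<kappa>\<^esub>\<close>\<close>

text \<open>The relations \<open>h v - (h.v) h - \<lambda>(h, v)\<close> deform the defining relations of a skew group
  algebra. Imposing them in \<open>T(V) \<rtimes> G\<close> with its skew product, where \<open>h v = (h.v) h\<close> already holds,
  would force \<open>\<lambda>(h, v) = 0\<close> in the quotient. The algebra they are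
  imposed on is therefore the one generated by \<open>T(V)\<close> and the group algebra without any relation
  between group elements and vectors (their free product). It is presented as the free algebra on the basis of \<open>V\<close> and the elements of \<open>G\<close>, with
  the multiplication table of \<open>G\<close> (and \<open>1\<^sub>G = 1\<close>) among the relations.\<close>

type_synonym ('k, 'n, 'g) free_alg = "('n + 'g) free_mon \<Rightarrow>\<^sub>0 'k"

definition free_vec :: "'k::comm_ring_1 ^ 'n::finite \<Rightarrow> ('k, 'n, 'g) free_alg"
  where "free_vec v = (\<Sum>i\<in>UNIV. Poly_Mapping.single (Letters [Inl i]) (v $ i))"

definition free_grp :: "'g \<Rightarrow> ('k::comm_ring_1, 'n, 'g) free_alg"
  where "free_grp h = Poly_Mapping.single (Letters [Inr h]) 1"

definition free_group_algebra :: "'k::comm_ring_1 ^ 'g::finite \<Rightarrow> ('k, 'n, 'g) free_alg"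
  where "free_group_algebra a = (\<Sum>h\<in>UNIV. Poly_Mapping.single 0 (a $ h) * free_grp h)"

text \<open>\<open>FG \<oplus> (V \<otimes> FG)\<close> is the type \<open>kappa_val\<close>, where \<open>l :: ('k ^ 'n) ^ 'g\<close> stands for
  \<open>\<Sum>\<^sub>h (l $ h) \<otimes> h\<close>.\<close>

type_synonym ('k, 'n, 'g) kappa_val = "('k, 'g) vec \<times> (('k, 'n) vec, 'g) vec"
type_synonym ('k, 'n, 'g) lambda_map = "('k, 'g) vec \<Rightarrow> ('k, 'n) vec \<Rightarrow> ('k, 'g) vec"
type_synonym ('k, 'n, 'g) kappa_map = "('k, 'n) vec \<Rightarrow> ('k, 'n) vec \<Rightarrow> ('k, 'n, 'g) kappa_val"

definition vec_tensor :: "'k::comm_ring_1 ^ 'n \<Rightarrow> 'g::finite \<Rightarrow> ('k ^ 'n) ^ 'g"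
  where "vec_tensor v h = (\<chi> h'. if h' = h then v else 0)"

definition free_kappa_value ::
  "('k::comm_ring_1, 'n::finite, 'g::finite) kappa_val \<Rightarrow> ('k, 'n, 'g) free_alg"
  where "free_kappa_value z =
    free_group_algebra (fst z) + (\<Sum>h\<in>UNIV. free_vec (snd z $ h) * free_grp h)"

definition H_relators ::
  "('g::{finite,monoid_mult} \<Rightarrow> 'k::comm_ring_1 ^ 'n ^ 'n::finite) \<Rightarrow>
   ('k, 'n, 'g) lambda_map \<Rightarrow> ('k, 'n, 'g) kappa_map \<Rightarrow> ('k, 'n, 'g) free_alg set"
  where "H_relators \<rho> lam \<kappa> =
    {free_grp h * free_grp h' - free_grp (h * h') | h h'. True} \<union> {free_grp 1 - 1} \<union>
    {free_grp h * free_vec v - free_vec (\<rho> h *v v) * free_grp h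
       - free_group_algebra (lam (axis h 1) v) | h v. True} \<union>
    {free_vec v * free_vec w - free_vec w * free_vec v - free_kappa_value (\<kappa> v w) | v w. True}"

definition H_ideal ::
  "('g::{finite,monoid_mult} \<Rightarrow> 'k::comm_ring_1 ^ 'n ^ 'n::finite) \<Rightarrow>
   ('k, 'n, 'g) lambda_map \<Rightarrow> ('k, 'n, 'g) kappa_map \<Rightarrow> ('k, 'n, 'g) free_alg set"
  where "H_ideal \<rho> lam \<kappa> = Idl\<^bsub>type_ring\<^esub> (H_relators \<rho> lam \<kappa>)"

definition H_algebra ::
  "('g::{finite,monoid_mult} \<Rightarrow> 'k::comm_ring_1 ^ 'n ^ 'n::finite) \<Rightarrow>
   ('k, 'n, 'g) lambda_map \<Rightarrow> ('k, 'n, 'g) kappa_map \<Rightarrow> ('k, 'n, 'g) free_alg set ring"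
  where "H_algebra \<rho> lam \<kappa> = type_ring Quot (H_ideal \<rho> lam \<kappa>)"

definition H_class ::
  "('g::{finite,monoid_mult} \<Rightarrow> 'k::comm_ring_1 ^ 'n ^ 'n::finite) \<Rightarrow>
   ('k, 'n, 'g) lambda_map \<Rightarrow> ('k, 'n, 'g) kappa_map \<Rightarrow>
   ('k, 'n, 'g) free_alg \<Rightarrow> ('k, 'n, 'g) free_alg set"
  where "H_class \<rho> lam \<kappa> t = H_ideal \<rho> lam \<kappa> +>\<^bsub>type_ring\<^esub> t"

text \<open>Vectors have degree 1, group elements degree 0.\<close>

definition mon_degree :: "('n + 'g) free_mon \<Rightarrow> nat"
  where "mon_degree u = length (filter isl (letters u))"

definition H_filtration ::
  "('g::{finite,monoid_mult} \<Rightarrow> 'k::comm_ring_1 ^ 'n ^ 'n::finite) \<Rightarrow>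
   ('k, 'n, 'g) lambda_map \<Rightarrow> ('k, 'n, 'g) kappa_map \<Rightarrow>
   nat \<Rightarrow> ('k, 'n, 'g) free_alg set set"
  where "H_filtration \<rho> lam \<kappa> n =
    H_class \<rho> lam \<kappa> ` {t. \<forall>u\<in>Poly_Mapping.keys t. mon_degree u \<le> n}"

definition bilinear_map ::
  "('k::field \<Rightarrow> 'a \<Rightarrow> 'a) \<Rightarrow> ('k \<Rightarrow> 'b \<Rightarrow> 'b) \<Rightarrow> ('k \<Rightarrow> 'c \<Rightarrow> 'c) \<Rightarrow>
   ('a::ab_group_add \<Rightarrow> 'b::ab_group_add \<Rightarrow> 'c::ab_group_add) \<Rightarrow> bool"
  where "bilinear_map sa sb sc B \<longleftrightarrow>
    (\<forall>x. Vector_Spaces.linear sb sc (B x)) \<and> (\<forall>y. Vector_Spaces.linear sa sc (\<lambda>x. B x y))"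

definition kappa_scale ::
  "'k::field \<Rightarrow> ('k, 'n::finite, 'g::finite) kappa_val \<Rightarrow> ('k, 'n, 'g) kappa_val"
  where "kappa_scale c z = (c *s fst z, \<chi> h. c *s (snd z $ h))"

definition parameter_pair ::
  "('k::field, 'n::finite, 'g::finite) lambda_map \<Rightarrow> ('k, 'n, 'g) kappa_map \<Rightarrow> bool"
  where "parameter_pair lam \<kappa> \<longleftrightarrow>
    bilinear_map (*s) (*s) (*s) lam \<and>
    bilinear_map (*s) (*s) kappa_scale \<kappa> \<and> (\<forall>v. \<kappa> v v = 0)"

definition drinfeld_orbifold_algebra ::
  "('g::{finite,monoid_mult} \<Rightarrow> 'k::field ^ 'n ^ 'n::finite) \<Rightarrow>
   ('k, 'n, 'g) lambda_map \<Rightarrow> ('k, 'n, 'g) kappa_map \<Rightarrow> bool"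
  where "drinfeld_orbifold_algebra \<rho> lam \<kappa> \<longleftrightarrow>
    parameter_pair lam \<kappa> \<and>
    graded_algebra_isomorphic
      (assoc_graded (H_algebra \<rho> lam \<kappa>) (\<lambda>c. H_class \<rho> lam \<kappa> (Poly_Mapping.single 0 c))
        (H_filtration \<rho> lam \<kappa>))
      (sym_skew_graded \<rho>)"

section \<open>The cyclic transvection group\<close>

definition transvection :: "'k::field ^ 2 ^ 2"
  where "transvection = vector [vector [1, 1], vector [0, 1]]"

text \<open>The field with \<open>p\<close> elements is \<^typ>\<open>'p mod_ring\<close> with \<open>p =\<close> \<^term>\<open>CARD('p)\<close>. As the
  transvection has order \<open>p\<close>, its powers with exponents in \<^typ>\<open>nat\<close> form the group it generates.\<close>

typedef (overloaded) 'p transvection_group =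
    "{A :: 'p::prime_card mod_ring ^ 2 ^ 2. \<exists>n. A = (((**) transvection) ^^ n) (mat 1)}"
  morphisms matrix_of Abs_transvection_group
  by blast

setup_lifting type_definition_transvection_group

lemma transvection_funpow_mult:
  "((((**) A) ^^ m) (mat 1)) ** ((((**) A) ^^ n) (mat 1)) = (((**) A) ^^ (m + n)) (mat 1 :: 'k::comm_ring_1 ^ 'n ^ 'n::finite)"
  by (induction m) (simp_all add: matrix_mul_lid flip: matrix_mul_assoc)

instantiation transvection_group :: (prime_card) monoid_mult
begin
lift_definition one_transvection_group :: "'p::prime_card transvection_group" is "mat 1"
  by (rule exI[of _ 0]) simp
lift_definition times_transvection_group ::
  "'p::prime_card transvection_group \<Rightarrow> 'p transvection_group \<Rightarrow> 'p transvection_group" is "(**)"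
  using transvection_funpow_mult by blast
instance
  by standard (transfer; simp add: matrix_mul_assoc matrix_mul_lid matrix_mul_rid)+
end

instance transvection_group :: (prime_card) finite
proof
  have "inj (matrix_of :: 'a transvection_group \<Rightarrow> 'a mod_ring ^ 2 ^ 2)"
    by (rule injI) (simp add: matrix_of_inject)
  then show "finite (UNIV :: 'a transvection_group set)"
    by (rule finite_imageD[rotated]) (rule finite_subset[OF subset_UNIV], simp)
qed

lift_definition gen :: "'p::prime_card transvection_group" is transvection
  by (rule exI[of _ 1]) (simp add: matrix_mul_rid)

lemma matrix_of_gen_power:
  "matrix_of (gen ^ n) = (vector [vector [1, of_nat n], vector [0, 1]] :: 'p::prime_card mod_ring ^ 2 ^ 2)"
  by (induction n)
     (simp_all add: one_transvection_group.rep_eq times_transvection_group.rep_eq gen.rep_eq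
       transvection_def mat_def matrix_matrix_mult_def vec_eq_iff forall_2 sum_2 algebra_simps)

lemma gen_power_CARD: "gen ^ CARD('p) = (1 :: 'p::prime_card transvection_group)"
  by (simp add: matrix_of_gen_power one_transvection_group.rep_eq mat_def vec_eq_iff forall_2
      of_nat_card_eq_0 flip: matrix_of_inject)

section \<open>The classification data\<close>

abbreviation v1 :: "'k::field ^ 2" where "v1 \<equiv> vector [1, 0]"
abbreviation v2 :: "'k::field ^ 2" where "v2 \<equiv> vector [0, 1]"

definition has_aug_order :: "'p::prime_card mod_ring ^ 'p transvection_group \<Rightarrow> nat \<Rightarrow> bool"
  where "has_aug_order b k \<longleftrightarrow> k \<le> CARD('p) \<and>
    (\<exists>b'. b = (axis gen 1 - axis 1 1) [^]\<^bsub>group_algebra\<^esub> k \<otimes>\<^bsub>group_algebra\<^esub> b' \<and>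
          (\<Sum>h\<in>UNIV. b' $ h) \<noteq> 0)"

definition aug_order :: "'p::prime_card mod_ring ^ 'p transvection_group \<Rightarrow> nat"
  where "aug_order b = (THE k. has_aug_order b k)"

text \<open>The tuple \<open>(d\<^sub>1, \<dots>, d\<^sub>k)\<close> is a list, so \<open>d\<^sub>m\<close> is \<open>d ! (m - 1)\<close>.\<close>

definition mu :: "'p::prime_card mod_ring list \<Rightarrow> nat \<Rightarrow> 'p mod_ring"
  where "mu d j = (-1) ^ (CARD('p) - j) *
    (\<Sum>m = 1..length d. (-1) ^ (m + 1) * of_nat ((CARD('p) - m) choose (CARD('p) - j)) * d ! (m - 1))"

definition given_by_data ::
  "'p::prime_card mod_ring ^ 'p transvection_group \<Rightarrow> 'p mod_ring list \<Rightarrow>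
   ('p mod_ring ^ 2 \<Rightarrow> 'p mod_ring ^ 'p transvection_group) \<Rightarrow>
   'p mod_ring ^ 'p transvection_group \<Rightarrow>
   ('p mod_ring, 2, 'p transvection_group) lambda_map \<Rightarrow>
   ('p mod_ring, 2, 'p transvection_group) kappa_map \<Rightarrow> bool"
  where "given_by_data b d f \<kappa>C lam \<kappa> \<longleftrightarrow>
    (\<forall>i<CARD('p).
      lam (axis (gen ^ i) 1) v1 = of_nat i *s (b \<otimes>\<^bsub>group_algebra\<^esub> axis (gen ^ i) 1) \<and>
      lam (axis (gen ^ i) 1) v2 =
        (\<Sum>j<CARD('p). ((of_nat (i choose 2) + of_nat i * of_nat j ^ (CARD('p) - 2) * of_nat ((j + 1) choose 2))
            * b $ (gen ^ j)) *s axis (gen ^ (i + j)) 1)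
        + of_nat i *s (\<Sum>j<CARD('p). (of_nat j ^ (CARD('p) - 2) * mu d j) *s axis (gen ^ (i + j)) 1)
        - of_nat i *s ((\<Sum>j<CARD('p). (f v1 $ (gen ^ j)) *s axis (gen ^ j) 1)
            \<otimes>\<^bsub>group_algebra\<^esub> axis (gen ^ i) 1)) \<and>
    \<kappa> v1 v2 =
      (\<kappa>C,
       vec_tensor ((\<Sum>m = 1..length d. (-1) ^ (m + 1) * d ! (m - 1)) *s v1) 1
       + (\<Sum>j<CARD('p). vec_tensor ((of_nat j * b $ (gen ^ j)) *s v2) (gen ^ j))
       + (\<Sum>j<CARD('p). vec_tensor ((of_nat j * f v1 $ (gen ^ j)) *s v1) (gen ^ j)))"

end

theory Submission
  imports Defs
begin

text \<open>
  Let \<open>A\<close> be the group algebra of \<open>G\<close>, with the derivation \<open>D(g\<^sup>j) = j g\<^sup>j\<close> and the map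
  \<open>E(g\<^sup>j) = (j choose 2) g\<^sup>j\<close>, so that \<open>E = (D\<^sup>2 - D) / 2\<close>.

  The relations between group elements and vectors say that conjugation by \<open>g\<close> sends \<open>v\<^sub>1\<close> to
  \<open>v\<^sub>1 + b\<close> and \<open>v\<^sub>2\<close> to \<open>v\<^sub>1 + v\<^sub>2 + c\<close> for some \<open>b\<close>, \<open>c\<close> in \<open>A\<close>. Compatibility with the
  multiplication of \<open>G\<close> then forces \<open>\<lambda>(x, v\<^sub>1) = b D x\<close> and \<open>\<lambda>(x, v\<^sub>2) = c D x + b E x\<close> for all \<open>x\<close>
  in \<open>A\<close>; the relation \<open>g\<^sup>p = 1\<close> imposes nothing more because \<open>p\<close> is odd. Write
  \<open>\<kappa>(v\<^sub>1, v\<^sub>2) = k + v\<^sub>1 a + v\<^sub>2 w\<close>. Conjugating the commutator of \<open>v\<^sub>1\<close> and \<open>v\<^sub>2\<close> by \<open>g\<close> and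
  comparing coefficients gives \<open>w = D b\<close> and \<open>b (a + D c - D b - E b) = 0\<close>. As \<open>V\<close> has dimension
  two, there is no Jacobi identity among three vectors, and these are all the conditions
  (\<open>drinfeld_orbifold_algebra_iff\<close>).

  Comparing coefficients is legitimate in a PBW deformation. The monomials \<open>v\<^sub>1\<^sup>i v\<^sub>2\<^sup>j h\<close> of degree \<open>n\<close>
  always span the degree \<open>n\<close> part of the associated graded algebra, and everything is finite, so any
  isomorphism with \<open>S(V) \<rtimes> G\<close>, canonical or not, makes these spanning sets linearly independent
  (\<open>graded_iso_imp_pbw_independent\<close>). Only the degrees 0 and 1 are needed.

  Conversely, if the conditions hold, the algebra acts from the right on the polynomial ring
  \<open>A[v\<^sub>1, v\<^sub>2]\<close>, where \<open>v\<^sub>1\<^sup>i v\<^sub>2\<^sup>j h\<close> sends 1 to a polynomial with that leading monomial; hence the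
  monomials are independent (\<open>pbw_independent\<close>). The condition on \<open>b\<close> is what makes
  the two vector operators satisfy the commutator relation (\<open>commutator_relation\<close>).

  It remains to solve \<open>b z = 0\<close> for \<open>z = a + D c - D b - E b\<close>. The algebra \<open>A\<close> is local with maximal
  ideal generated by \<open>x = g - 1\<close>, and \<open>x\<^sup>p = 0\<close>. If \<open>b\<close> is a unit times \<open>x\<^sup>k\<close>, its annihilator is
  the ideal of \<open>x\<^sup>p\<^sup>-\<^sup>k\<close>, which has the basis of all \<open>(1 - g\<^sup>-\<^sup>1)\<^sup>p\<^sup>-\<^sup>m\<close> with \<open>1 \<le> m \<le> k\<close>. The
  coordinates of \<open>z\<close> are the \<open>d\<^sub>m\<close> up to sign, and the coefficients of these powers are the binomial
  coefficients in \<open>\<mu>(d, j)\<close> (\<open>lookup_ann_comb\<close>). Given \<open>z\<close>, the equation determines \<open>a\<close> from \<open>c\<close>,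
  and \<open>f(v\<^sub>1)\<close> is the freedom in the choice of \<open>c\<close>. There are \<open>p\<^sup>p\<^sup>+\<^sup>1\<close> pairs \<open>(b, z)\<close> with
  \<open>b z = 0\<close> (\<open>card_zero_products\<close>), and \<open>p\<^sup>p\<close> choices for each of \<open>c\<close> and \<open>k\<close>.
\<close>

section \<open>Linear extension from a basis\<close>

abbreviation (input) lookup :: "('u \<Rightarrow>\<^sub>0 'k::zero) \<Rightarrow> 'u \<Rightarrow> 'k"
  where "lookup \<equiv> Poly_Mapping.lookup"

abbreviation (input) single :: "'u \<Rightarrow> 'k::zero \<Rightarrow> 'u \<Rightarrow>\<^sub>0 'k"
  where "single \<equiv> Poly_Mapping.single"

abbreviation (input) keys :: "('u \<Rightarrow>\<^sub>0 'k::zero) \<Rightarrow> 'u set"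
  where "keys \<equiv> Poly_Mapping.keys"

lemma sum_single_lookup:
  "(\<Sum>u\<in>keys t. single u (lookup t u)) = t"
proof (rule poly_mapping_eqI)
  fix v
  have "lookup (\<Sum>u\<in>keys t. single u (lookup t u)) v =
      (\<Sum>u\<in>keys t. if u = v then lookup t v else 0)"
    unfolding lookup_sum by (intro sum.cong refl) (auto simp: lookup_single when_def)
  then show "lookup (\<Sum>u\<in>keys t. single u (lookup t u)) v =
      lookup t v"
    by (simp add: in_keys_iff)
qed

lemma poly_mapping_single_induct [case_names single add]:
  fixes t :: "'u \<Rightarrow>\<^sub>0 'k::comm_monoid_add"
  assumes single: "\<And>u c. P (single u c)"
    and add: "\<And>s t. P s \<Longrightarrow> P t \<Longrightarrow> P (s + t)"
  shows "P t"
proof -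
  have "P (\<Sum>u\<in>U. single u (lookup t u))" if "finite U" for U
    using that
  proof (induction U)
    case empty
    then show ?case using single[of undefined 0] by simp
  qed (auto intro: single add)
  from this[OF finite_keys[of t]] show ?thesis
    by (simp only: sum_single_lookup)
qed

text \<open>The values \<open>F u c\<close> are meant to be additive in the coefficient \<open>c\<close>. Keeping the coefficient
  inside \<open>F\<close> allows target modules whose scalar multiplication is not a type class operation.\<close>

definition lin_ext :: "('u \<Rightarrow> 'k \<Rightarrow> 'm) \<Rightarrow> ('u \<Rightarrow>\<^sub>0 'k::zero) \<Rightarrow> 'm::comm_monoid_add"
  where "lin_ext F t = (\<Sum>u\<in>keys t. F u (lookup t u))"

lemma lin_ext_single: "F u 0 = 0 \<Longrightarrow> lin_ext F (single u c) = F u c"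
  by (auto simp: lin_ext_def)

lemma lin_ext_superset:
  assumes "\<And>u. F u 0 = 0" "finite U" "keys t \<subseteq> U"
  shows "lin_ext F t = (\<Sum>u\<in>U. F u (lookup t u))"
  unfolding lin_ext_def using assms by (intro sum.mono_neutral_left) (auto simp: in_keys_iff)

lemma lin_ext_add:
  assumes "\<And>u. F u 0 = 0" "\<And>u c d. F u (c + d) = F u c + F u d"
  shows "lin_ext F (s + t) = lin_ext F s + lin_ext F t"
proof -
  let ?U = "keys s \<union> keys t"
  have "lin_ext F r = (\<Sum>u\<in>?U. F u (lookup r u))" if "keys r \<subseteq> ?U" for r
    using assms(1) that by (intro lin_ext_superset) auto
  moreover have "keys (s + t) \<subseteq> ?U" by (rule keys_add)
  ultimately show ?thesis by (simp add: lookup_add assms(2) sum.distrib)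
qed

lemma additive_facts:
  fixes f :: "'a::ab_group_add \<Rightarrow> 'b::ab_group_add"
  assumes "\<And>x y. f (x + y) = f x + f y"
  shows "f 0 = 0" "f (- x) = - f x" "f (x - y) = f x - f y" "f (sum h I) = (\<Sum>i\<in>I. f (h i))"
proof -
  have "Modules.additive f" using assms by (simp add: Modules.additive_def)
  then show "f 0 = 0" "f (- x) = - f x" "f (x - y) = f x - f y" "f (sum h I) = (\<Sum>i\<in>I. f (h i))"
    by (auto simp: Modules.additive.zero Modules.additive.minus Modules.additive.diff Modules.additive.sum)
qed

lemma additive_poly_mapping_eqI:
  fixes f g :: "('u \<Rightarrow>\<^sub>0 'k::comm_monoid_add) \<Rightarrow> 'm::ab_semigroup_add"
  assumes "\<And>s t. f (s + t) = f s + f t" "\<And>s t. g (s + t) = g s + g t"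
    and "\<And>u c. f (single u c) = g (single u c)"
  shows "f t = g t"
  by (induction t rule: poly_mapping_single_induct) (simp_all add: assms)

section \<open>Representations of the free algebra\<close>

text \<open>A right action: the first letter of a word acts first. In the normal form \<open>v\<^sub>1\<^sup>i v\<^sub>2\<^sup>j h\<close> the
  group element stands on the right, so that the group algebra acts by plain multiplication.\<close>

definition free_act ::
  "('k \<Rightarrow> 'm \<Rightarrow> 'm) \<Rightarrow> ('x \<Rightarrow> 'm \<Rightarrow> 'm) \<Rightarrow> ('x free_mon \<Rightarrow>\<^sub>0 'k::zero) \<Rightarrow> 'm \<Rightarrow> 'm::comm_monoid_add"
  where "free_act sc st t m = lin_ext (\<lambda>u c. sc c (fold st (letters u) m)) t"

locale free_right_module = Modules.module sc for sc :: "'k::comm_ring_1 \<Rightarrow> 'm \<Rightarrow> 'm::ab_group_add" +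
  fixes st :: "'x \<Rightarrow> 'm \<Rightarrow> 'm"
  assumes st_add: "st x (m + m') = st x m + st x m'"
    and st_scale: "st x (sc c m) = sc c (st x m)"
begin

lemma fold_st_add: "fold st xs (m + m') = fold st xs m + fold st xs m'"
  by (induction xs arbitrary: m m') (simp_all add: st_add)

lemma fold_st_scale: "fold st xs (sc c m) = sc c (fold st xs m)"
  by (induction xs arbitrary: m) (simp_all add: st_scale)

lemma free_act_single: "free_act sc st (single u c) m = sc c (fold st (letters u) m)"
  unfolding free_act_def by (rule lin_ext_single) simp

lemma free_act_add: "free_act sc st (s + t) m = free_act sc st s m + free_act sc st t m"
  unfolding free_act_def by (rule lin_ext_add) (simp_all add: scale_left_distrib)

lemmas free_act_additive = additive_facts[where f = "\<lambda>t. free_act sc st t m" for m, OF free_act_add]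

lemma free_act_add_right: "free_act sc st t (m + m') = free_act sc st t m + free_act sc st t m'"
  by (simp add: free_act_def lin_ext_def fold_st_add scale_right_distrib sum.distrib)

lemma free_act_scale: "free_act sc st t (sc c m) = sc c (free_act sc st t m)"
  by (simp add: free_act_def lin_ext_def fold_st_scale scale_sum_right mult.commute)

lemma free_act_const: "free_act sc st (single 0 c) m = sc c m"
  by (simp add: free_act_single zero_free_mon_def)

lemma free_act_one: "free_act sc st 1 m = m"
  using free_act_const[of 1 m] by simp

lemma free_act_mult: "free_act sc st (s * t) m = free_act sc st t (free_act sc st s m)"
proof (induction s rule: poly_mapping_single_induct)
  case (single u c)
  show ?case
    by (induction t rule: poly_mapping_single_induct)
      (simp_all add: mult_single free_act_single plus_free_mon_def fold_st_scale free_act_add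
        distrib_left mult.commute)
qed (simp add: distrib_right free_act_add free_act_add_right)

end

section \<open>Substitution in the symmetric algebra\<close>

text \<open>The symmetric algebra is the free commutative algebra on its variables; this is the algebra
  homomorphism given by a homomorphism \<open>\<kappa>\<close> on constants and images \<open>x i\<close> of the variables.\<close>

definition sym_subst :: "('k::comm_ring_1 \<Rightarrow> 'r) \<Rightarrow> ('n::finite \<Rightarrow> 'r) \<Rightarrow> ('k, 'n) sym_alg \<Rightarrow> 'r::comm_ring_1"
  where "sym_subst \<kappa> x = lin_ext (\<lambda>m c. \<kappa> c * (\<Prod>i\<in>UNIV. x i ^ lookup m i))"

abbreviation sym_var :: "'n \<Rightarrow> ('k::comm_ring_1, 'n) sym_alg"
  where "sym_var i \<equiv> single (single i 1) 1"

lemma single_sym_monomial: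
  "single (m :: 'n::finite \<Rightarrow>\<^sub>0 nat) (c :: 'k::comm_ring_1) =
    single 0 c * (\<Prod>i\<in>UNIV. sym_var i ^ lookup m i)"
proof -
  have pow: "sym_var i ^ n = (single (single i n) 1 :: ('k, 'n) sym_alg)" for i n
    by (induction n) (simp_all add: mult_single flip: single_add)
  have prod: "(\<Prod>i\<in>I. single (f i) 1) = (single (\<Sum>i\<in>I. f i) 1 :: ('k, 'n) sym_alg)"
    if "finite I" for f :: "'n \<Rightarrow> 'n \<Rightarrow>\<^sub>0 nat" and I
    using that by (induction I) (simp_all add: mult_single)
  have "(\<Sum>i\<in>UNIV. single i (lookup m i)) = m"
    by (rule poly_mapping_eqI) (simp add: lookup_sum lookup_single when_def)
  then show ?thesis by (simp only: pow prod[OF finite] mult_single add_0 mult_1_right)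
qed

context
  fixes \<kappa> :: "'k::comm_ring_1 \<Rightarrow> 'r::comm_ring_1" and x :: "'n::finite \<Rightarrow> 'r"
  assumes hom: "comm_ring_hom \<kappa>"
begin

interpretation comm_ring_hom \<kappa> by (rule hom)

lemma sym_subst_single:
  "sym_subst \<kappa> x (single m c) = \<kappa> c * (\<Prod>i\<in>UNIV. x i ^ lookup m i)"
  unfolding sym_subst_def by (rule lin_ext_single) simp

lemma sym_subst_add: "sym_subst \<kappa> x (s + t) = sym_subst \<kappa> x s + sym_subst \<kappa> x t"
  unfolding sym_subst_def by (rule lin_ext_add) (simp_all add: hom_distribs distrib_right)

lemma sym_subst_hom: "comm_ring_hom (sym_subst \<kappa> x)"
proof
  fix s t :: "('k, 'n) sym_alg"
  show "sym_subst \<kappa> x (s * t) = sym_subst \<kappa> x s * sym_subst \<kappa> x t"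
  proof (induction s rule: poly_mapping_single_induct)
    case (single m c)
    show ?case
      by (induction t rule: poly_mapping_single_induct)
        (simp_all add: mult_single sym_subst_single hom_distribs lookup_add power_add prod.distrib
          sym_subst_add algebra_simps)
  qed (simp add: distrib_right sym_subst_add)
  show "sym_subst \<kappa> x 1 = 1"
    using sym_subst_single[of 0 1] by simp
  show "sym_subst \<kappa> x 0 = 0"
    by (simp add: sym_subst_def lin_ext_def)
qed (rule sym_subst_add)

lemma sym_subst_const: "sym_subst \<kappa> x (single 0 c) = \<kappa> c"
  by (simp add: sym_subst_single)

lemma sym_subst_var: "sym_subst \<kappa> x (sym_var i) = x i"
proof -
  have "(\<Prod>j\<in>UNIV. x j ^ lookup (single i 1) j) = (\<Prod>j\<in>UNIV. if j = i then x j else 1)"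
    by (intro prod.cong) (auto simp: lookup_single when_def)
  then show ?thesis by (simp add: sym_subst_single)
qed

end

lemma sym_hom_eqI:
  fixes f g :: "('k::comm_ring_1, 'n::finite) sym_alg \<Rightarrow> 'r::comm_ring_1"
  assumes f: "comm_ring_hom f" and g: "comm_ring_hom g"
    and "\<And>c. f (single 0 c) = g (single 0 c)"
    and "\<And>i. f (sym_var i) = g (sym_var i)"
  shows "f s = g s"
proof -
  interpret f: comm_ring_hom f by (rule f)
  interpret g: comm_ring_hom g by (rule g)
  show ?thesis
  proof (rule additive_poly_mapping_eqI)
    fix m c
    show "f (single m c) = g (single m c)"
      unfolding single_sym_monomial[of m c]
      by (simp only: f.hom_mult g.hom_mult f.hom_prod g.hom_prod f.hom_power g.hom_power assms(3,4))
  qed (simp_all add: f.hom_add g.hom_add)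
qed

lemma single_zero_hom: "comm_ring_hom (single 0 :: 'k::comm_ring_1 \<Rightarrow> 'm::comm_monoid_add \<Rightarrow>\<^sub>0 'k)"
  by standard (simp_all add: single_add mult_single)

lemma sym_action_eq_subst:
  "sym_action A = sym_subst (single 0) (\<lambda>i. sym_vec (A *v axis i 1))"
  by (simp add: fun_eq_iff sym_action_def sym_subst_def lin_ext_def)

lemma sym_action_hom: "comm_ring_hom (sym_action A)"
  unfolding sym_action_eq_subst by (rule sym_subst_hom[OF single_zero_hom])

lemma sym_action_const: "sym_action A (single 0 c) = single 0 c"
  unfolding sym_action_eq_subst by (rule sym_subst_const[OF single_zero_hom])

lemma sym_vec_axis: "sym_vec (axis i 1 :: ('k::comm_ring_1, 'n::finite) vec) = sym_var i"
proof -
  have "sym_vec (axis i 1) = (\<Sum>j\<in>UNIV. if j = i then (sym_var i :: ('k, 'n) sym_alg) else 0)"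
    unfolding sym_vec_def by (intro sum.cong) (auto simp: axis_def)
  then show ?thesis by simp
qed

lemma sym_vec_expand: "sym_vec v = (\<Sum>i\<in>UNIV. single 0 (v $ i) * sym_var i)"
  by (simp add: sym_vec_def mult_single)

lemma sym_action_vec: "sym_action A (sym_vec v) = sym_vec (A *v v)"
proof -
  interpret comm_ring_hom "sym_action A" by (rule sym_action_hom)
  have var: "sym_action A (sym_var i) = sym_vec (A *v axis i 1)" for i
    unfolding sym_action_eq_subst by (rule sym_subst_var[OF single_zero_hom])
  have "sym_action A (sym_vec v) = (\<Sum>i\<in>UNIV. single 0 (v $ i) * sym_vec (A *v axis i 1))"
    unfolding sym_vec_expand[of v] by (simp only: hom_sum hom_mult sym_action_const var)
  also have "\<dots> = (\<Sum>i\<in>UNIV. \<Sum>j\<in>UNIV. single (single j 1) (v $ i * A $ j $ i))"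
    by (simp add: sym_vec_def sum_distrib_left mult_single matrix_vector_mult_def axis_def if_distrib cong: if_cong)
  also have "\<dots> = (\<Sum>j\<in>UNIV. single (single j 1) (\<Sum>i\<in>UNIV. A $ j $ i * v $ i))"
    unfolding additive_facts(4)[where f = "single _", OF single_add]
    by (subst sum.swap) (simp add: mult.commute)
  finally show ?thesis by (simp add: sym_vec_def matrix_vector_mult_def)
qed

text \<open>Both sides are algebra homomorphisms, so it suffices to compare them on the variables.
  This is what makes the skew product associative.\<close>

lemma sym_action_mult: "sym_action (A ** B) s = sym_action A (sym_action B s)"
proof (rule sym_hom_eqI[where g = "\<lambda>s. sym_action A (sym_action B s)"])
  interpret A: comm_ring_hom "sym_action A" by (rule sym_action_hom)
  interpret B: comm_ring_hom "sym_action B" by (rule sym_action_hom)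
  show "comm_ring_hom (\<lambda>s. sym_action A (sym_action B s))"
    by standard (simp_all add: A.hom_add B.hom_add A.hom_mult B.hom_mult)
  show "sym_action (A ** B) (sym_var i) = sym_action A (sym_action B (sym_var i))" for i
    unfolding sym_vec_axis[symmetric] sym_action_vec by (simp add: matrix_vector_mul_assoc)
qed (simp_all add: sym_action_const sym_action_hom)

lemma sym_action_mat_1: "sym_action (mat 1) s = (s :: ('a::comm_ring_1, 'b::finite) sym_alg)"
proof (rule sym_hom_eqI[where g = "\<lambda>s. s"])
  show "comm_ring_hom (\<lambda>s :: ('a, 'b) sym_alg. s)" by standard simp_all
  show "sym_action (mat 1) (sym_var i) = sym_var i" for i
    unfolding sym_vec_axis[symmetric] sym_action_vec by simp
qed (simp_all add: sym_action_const sym_action_hom)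

section \<open>Skew group algebras\<close>

lemma vec_sum_axis: "(\<Sum>h\<in>UNIV. axis h (x $ h)) = (x :: 'a::comm_monoid_add ^ 'g::finite)"
  by (simp add: vec_eq_iff axis_def)

locale skew_action =
  fixes act :: "'g::{finite,monoid_mult} \<Rightarrow> 'a \<Rightarrow> 'a::ring_1"
  assumes act_add: "act h (a + b) = act h a + act h b"
    and act_mult: "act h (a * b) = act h a * act h b"
    and act_one: "act h 1 = 1"
    and act_times: "act (h * h') a = act h (act h' a)"
    and act_unit: "act 1 a = a"
begin

abbreviation skew_mult :: "('a, 'g) vec \<Rightarrow> ('a, 'g) vec \<Rightarrow> ('a, 'g) vec" (infixl \<open>\<star>\<close> 70)
  where "x \<star> y \<equiv> x \<otimes>\<^bsub>skew_group_algebra act\<^esub> y"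

lemma skew_mult_nth: "(x \<star> y) $ k = (\<Sum>(h, h')\<in>{(h, h'). h * h' = k}. x $ h * act h (y $ h'))"
  by (simp add: skew_group_algebra_def)

lemma skew_add_left: "(x + x') \<star> y = x \<star> y + x' \<star> y"
  by (simp add: vec_eq_iff skew_mult_nth distrib_right sum.distrib split_beta)

lemma skew_add_right: "x \<star> (y + y') = x \<star> y + x \<star> y'"
  by (simp add: vec_eq_iff skew_mult_nth distrib_left sum.distrib split_beta act_add)

lemmas skew_additive_left = additive_facts[where f = "\<lambda>x. x \<star> y" for y, OF skew_add_left]
lemmas skew_additive_right = additive_facts[where f = "\<lambda>y. x \<star> y" for x, OF skew_add_right]

lemma skew_axis: "axis h a \<star> axis h' a' = axis (h * h') (a * act h a')"
proof -
  have "(axis h a \<star> axis h' a') $ k = axis (h * h') (a * act h a') $ k" for k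
  proof -
    have act0: "act u 0 = 0" for u
      using act_add[of u 0 0] by simp
    have "(axis h a \<star> axis h' a') $ k =
        (\<Sum>q\<in>{(u, u'). u * u' = k}. if q = (h, h') then a * act h a' else 0)"
      unfolding skew_mult_nth
    proof (intro sum.cong refl)
      fix q assume "q \<in> {(u, u'). u * u' = k}"
      obtain u u' where q: "q = (u, u')" by (cases q)
      show "(case q of (u, u') \<Rightarrow> axis h a $ u * act u (axis h' a' $ u')) =
          (if q = (h, h') then a * act h a' else 0)"
        unfolding q by (cases "u = h"; cases "u' = h'") (simp_all add: axis_def act0)
    qed
    then show ?thesis by (simp add: axis_def)
  qed
  then show ?thesis by (simp add: vec_eq_iff)
qed

text \<open>Both sides are additive in every argument, so only elements \<open>a h\<close> have to be checked.\<close>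

lemma skew_assoc: "(x \<star> y) \<star> z = x \<star> (y \<star> z)"
proof -
  have "(\<Sum>h\<in>UNIV. axis h (x $ h)) \<star> (\<Sum>h\<in>UNIV. axis h (y $ h)) \<star> (\<Sum>h\<in>UNIV. axis h (z $ h)) =
     (\<Sum>h\<in>UNIV. axis h (x $ h)) \<star> ((\<Sum>h\<in>UNIV. axis h (y $ h)) \<star> (\<Sum>h\<in>UNIV. axis h (z $ h)))"
    unfolding skew_additive_left(4) skew_additive_right(4) skew_axis
    by (simp add: act_mult act_times mult.assoc)
  then show ?thesis by (simp only: vec_sum_axis)
qed

lemma skew_one: "axis 1 1 \<star> x = x" "x \<star> axis 1 1 = x"
proof -
  have "axis 1 1 \<star> (\<Sum>h\<in>UNIV. axis h (x $ h)) = (\<Sum>h\<in>UNIV. axis h (x $ h))"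
    "(\<Sum>h\<in>UNIV. axis h (x $ h)) \<star> axis 1 1 = (\<Sum>h\<in>UNIV. axis h (x $ h))"
    unfolding skew_additive_left(4) skew_additive_right(4) skew_axis
    by (simp_all add: act_one act_unit)
  then show "axis 1 1 \<star> x = x" "x \<star> axis 1 1 = x"
    by (simp_all only: vec_sum_axis)
qed

end

section \<open>The filtered algebra defined by the relations\<close>

lemma ring_type_ring: "ring (type_ring :: 'a::ring_1 ring)"
proof (intro ringI abelian_groupI monoidI)
  fix x :: 'a
  show "\<exists>y\<in>carrier type_ring. y \<oplus>\<^bsub>type_ring\<^esub> x = \<zero>\<^bsub>type_ring\<^esub>"
    by (intro bexI[of _ "- x"]) (simp_all add: type_ring_def)
qed (simp_all add: type_ring_def algebra_simps)

lemma type_ring_simps [simp]: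
  "carrier type_ring = UNIV" "x \<oplus>\<^bsub>type_ring\<^esub> y = x + y" "x \<otimes>\<^bsub>type_ring\<^esub> y = x * y"
  "\<zero>\<^bsub>type_ring\<^esub> = 0" "\<one>\<^bsub>type_ring\<^esub> = 1"
  by (simp_all add: type_ring_def)

lemma type_ring_idealI:
  fixes I :: "'a::ring_1 set"
  assumes "0 \<in> I" "\<And>x y. x \<in> I \<Longrightarrow> y \<in> I \<Longrightarrow> x + y \<in> I"
    and "\<And>x y. x \<in> I \<Longrightarrow> y * x \<in> I" "\<And>x y. x \<in> I \<Longrightarrow> x * y \<in> I"
  shows "ideal I type_ring"
proof (rule idealI[OF ring_type_ring])
  interpret ring "type_ring :: 'a ring" by (rule ring_type_ring)
  have neg: "- x \<in> I" if "x \<in> I" for x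
    using assms(3)[OF that, of "- 1"] by simp
  have "\<ominus>\<^bsub>type_ring\<^esub> x = - x" for x :: 'a
    by (rule minus_equality) simp_all
  then have inv: "inv\<^bsub>add_monoid type_ring\<^esub> x = - x" for x :: 'a
    by (simp add: a_inv_def)
  show "subgroup I (add_monoid (type_ring :: 'a ring))"
    by (rule subgroup.intro) (use assms inv neg in auto)
qed (use assms in auto)

locale orbifold_presentation =
  fixes \<rho> :: "'g::{finite,monoid_mult} \<Rightarrow> 'k::field ^ 2 ^ 2"
    and lam :: "('k, 2, 'g) lambda_map" and \<kappa> :: "('k, 2, 'g) kappa_map"
  assumes rho_one: "\<rho> 1 = mat 1" and rho_mult: "\<rho> (h * h') = \<rho> h ** \<rho> h'"
begin

abbreviation II :: "('k, 2, 'g) free_alg set" where "II \<equiv> H_ideal \<rho> lam \<kappa>"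
abbreviation HH :: "('k, 2, 'g) free_alg set ring" where "HH \<equiv> H_algebra \<rho> lam \<kappa>"
abbreviation cls :: "('k, 2, 'g) free_alg \<Rightarrow> ('k, 2, 'g) free_alg set" where "cls \<equiv> H_class \<rho> lam \<kappa>"

lemma ideal_II: "ideal II type_ring"
  unfolding H_ideal_def by (rule ring.genideal_ideal[OF ring_type_ring]) simp

lemma relator_II: "r \<in> H_relators \<rho> lam \<kappa> \<Longrightarrow> r \<in> II"
  unfolding H_ideal_def using ring.genideal_self[OF ring_type_ring, of "H_relators \<rho> lam \<kappa>"] by auto

lemma II_minimal:
  assumes "ideal J type_ring" "H_relators \<rho> lam \<kappa> \<subseteq> J"
  shows "II \<subseteq> J"
  unfolding H_ideal_def by (rule ring.genideal_minimal[OF ring_type_ring assms])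

lemma II_mult: "x \<in> II \<Longrightarrow> y * x \<in> II" "x \<in> II \<Longrightarrow> x * y \<in> II"
  using ideal.I_l_closed[OF ideal_II, of x y] ideal.I_r_closed[OF ideal_II, of x y] by simp_all

lemma II_zero: "0 \<in> II"
  using additive_subgroup.zero_closed[OF ideal.axioms(1)[OF ideal_II]] by simp

lemma II_add: "x \<in> II \<Longrightarrow> y \<in> II \<Longrightarrow> x + y \<in> II"
  using additive_subgroup.a_closed[OF ideal.axioms(1)[OF ideal_II], of x y] by simp

lemma II_minus: "x \<in> II \<Longrightarrow> - x \<in> II"
  using II_mult(1)[of x "- 1"] by simp

lemma II_diff: "x \<in> II \<Longrightarrow> y \<in> II \<Longrightarrow> x - y \<in> II"
  using II_add[of x "- y"] II_minus[of y] by simp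

lemma relators:
  "free_grp h * free_grp h' - free_grp (h * h') \<in> II"
  "free_grp 1 - 1 \<in> II"
  "free_grp h * free_vec v - free_vec (\<rho> h *v v) * free_grp h - free_group_algebra (lam (axis h 1) v) \<in> II"
  "free_vec v * free_vec w - free_vec w * free_vec v - free_kappa_value (\<kappa> v w) \<in> II"
  by (rule relator_II, unfold H_relators_def, blast)+

subsection \<open>Classes and cosets\<close>

text \<open>Elements of the quotient are cosets, that is, sets; this and \<open>cls_hom\<close> reduce all
  computations with them to congruences modulo the ideal.\<close>

lemma cls_eq_iff: "cls t = cls t' \<longleftrightarrow> t - t' \<in> II"
proof -
  interpret I: ideal II type_ring by (rule ideal_II)
  have cls: "cls t = {i + t | i. i \<in> II}" for t
    by (auto simp: H_class_def a_r_coset_def')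
  show ?thesis
  proof
    assume "cls t = cls t'"
    moreover have "t \<in> cls t" unfolding cls using II_zero by force
    ultimately show "t - t' \<in> II" unfolding cls by auto
  next
    assume *: "t - t' \<in> II"
    have "i + t = (i + (t - t')) + t'" "i + t' = (i - (t - t')) + t" for i by simp_all
    then show "cls t = cls t'" unfolding cls using II_add[OF _ *] II_diff[OF _ *] by blast
  qed
qed

lemma cls_hom:
  "cls s \<oplus>\<^bsub>HH\<^esub> cls t = cls (s + t)" "cls s \<otimes>\<^bsub>HH\<^esub> cls t = cls (s * t)" "\<one>\<^bsub>HH\<^esub> = cls 1" "\<zero>\<^bsub>HH\<^esub> = cls 0"
proof -
  have hom: "cls \<in> Ring.ring_hom type_ring HH"
    using ideal.rcos_ring_hom[OF ideal_II] by (simp add: H_class_def[abs_def] H_algebra_def)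
  show "cls s \<oplus>\<^bsub>HH\<^esub> cls t = cls (s + t)" "cls s \<otimes>\<^bsub>HH\<^esub> cls t = cls (s * t)" "\<one>\<^bsub>HH\<^esub> = cls 1"
    using ring_hom_add[OF hom, of s t] ring_hom_mult[OF hom, of s t] ring_hom_one[OF hom] by simp_all
  have "ring HH"
    unfolding H_algebra_def by (rule ideal.quotient_is_ring[OF ideal_II])
  from ring_hom_zero[OF hom ring_type_ring this] show "\<zero>\<^bsub>HH\<^esub> = cls 0" by simp
qed

definition fle :: "nat \<Rightarrow> ('k, 2, 'g) free_alg set"
  where "fle n = {t. \<forall>u\<in>keys t. mon_degree u \<le> n}"

definition fless :: "nat \<Rightarrow> ('k, 2, 'g) free_alg set"
  where "fless n = {t. \<forall>u\<in>keys t. mon_degree u < n}"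

lemma fless_Suc: "fless (Suc n) = fle n"
  by (auto simp: fle_def fless_def less_Suc_eq_le)

lemma fless_0: "fless 0 = {0}"
  by (auto simp: fless_def)

lemma fless_add: "s \<in> fless n \<Longrightarrow> t \<in> fless n \<Longrightarrow> s + t \<in> fless n"
  using keys_add[of s t] by (auto simp: fless_def)

lemma fless_zero: "0 \<in> fless n"
  by (simp add: fless_def)

lemma fless_minus: "s \<in> fless n \<Longrightarrow> - s \<in> fless n"
  by (auto simp: fless_def in_keys_iff)

lemma fless_sum: "(\<And>i. i \<in> A \<Longrightarrow> f i \<in> fless n) \<Longrightarrow> sum f A \<in> fless n"
  by (induction A rule: infinite_finite_induct) (auto intro: fless_zero fless_add)

lemma fless_mono: "s \<in> fless m \<Longrightarrow> m \<le> n \<Longrightarrow> s \<in> fless n"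
  by (auto simp: fless_def)

lemma mon_degree_add: "mon_degree (u + w) = mon_degree u + mon_degree w"
  by (simp add: mon_degree_def plus_free_mon_def)

lemma fless_mult: "s \<in> fless n \<Longrightarrow> t \<in> fle m \<Longrightarrow> s * t \<in> fless (n + m)"
  and mult_fless: "s \<in> fless n \<Longrightarrow> t \<in> fle m \<Longrightarrow> t * s \<in> fless (n + m)"
  using keys_mult[of s t] keys_mult[of t s] by (fastforce simp: fless_def fle_def mon_degree_add)+

lemma fle_mult: "s \<in> fle n \<Longrightarrow> t \<in> fle m \<Longrightarrow> s * t \<in> fle (n + m)"
  using fless_mult[of s "Suc n" t m] by (simp add: fless_Suc)

lemmas fle_add = fless_add[of _ "Suc n" for n, unfolded fless_Suc]
lemmas fle_sum = fless_sum[of _ _ "Suc n" for n, unfolded fless_Suc]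
lemmas fle_mono = fless_mono[of _ "Suc m" "Suc n" for m n, unfolded fless_Suc, simplified]

lemma fle_single: "mon_degree u \<le> n \<Longrightarrow> single u c \<in> fle n"
  by (simp add: fle_def)

lemma fle_const: "single 0 c \<in> fle 0"
  by (rule fle_single) (simp add: mon_degree_def zero_free_mon_def)

lemma fle_grp: "free_grp h \<in> fle 0"
  unfolding free_grp_def by (rule fle_single) (simp add: mon_degree_def)

lemma fle_group_algebra: "free_group_algebra a \<in> fle 0"
  unfolding free_group_algebra_def using fle_mult[OF fle_const fle_grp] by (intro fle_sum) simp

lemma fle_vec: "free_vec v \<in> fle 1"
  unfolding free_vec_def by (intro fle_sum fle_single) (simp add: mon_degree_def)

lemma fle_kappa_value: "free_kappa_value z \<in> fle 1"
  unfolding free_kappa_value_def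
  by (intro fle_add fle_sum fle_mono[OF fle_group_algebra]) (use fle_mult[OF fle_vec fle_grp] in simp_all)

text \<open>Two elements of degree at most \<open>n\<close> have the same class in degree \<open>n\<close> of the associated graded
  algebra iff their difference lies in \<open>JJ n\<close>.\<close>

definition JJ :: "nat \<Rightarrow> ('k, 2, 'g) free_alg set"
  where "JJ n = {i + r | i r. i \<in> II \<and> r \<in> fless n}"

lemma JJ_I: "i \<in> II \<Longrightarrow> r \<in> fless n \<Longrightarrow> x = i + r \<Longrightarrow> x \<in> JJ n"
  by (auto simp: JJ_def)

lemma JJ_E:
  assumes "x \<in> JJ n"
  obtains i r where "i \<in> II" "r \<in> fless n" "x = i + r"
  using assms by (auto simp: JJ_def)

lemma II_JJ: "x \<in> II \<Longrightarrow> x \<in> JJ n"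
  and fless_JJ: "x \<in> fless n \<Longrightarrow> x \<in> JJ n"
  using JJ_I[of x 0 n x] JJ_I[of 0 x n x] II_zero fless_zero by simp_all

lemma JJ_add: "x \<in> JJ n \<Longrightarrow> y \<in> JJ n \<Longrightarrow> x + y \<in> JJ n"
proof -
  assume "x \<in> JJ n" "y \<in> JJ n"
  then obtain i r i' r' where "i \<in> II" "r \<in> fless n" "x = i + r" "i' \<in> II" "r' \<in> fless n" "y = i' + r'"
    by (elim JJ_E)
  then show ?thesis by (intro JJ_I[of "i + i'" "r + r'"] II_add fless_add) simp_all
qed

lemma JJ_minus: "x \<in> JJ n \<Longrightarrow> - x \<in> JJ n"
proof -
  assume "x \<in> JJ n"
  then obtain i r where "i \<in> II" "r \<in> fless n" "x = i + r" by (elim JJ_E)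
  then show ?thesis by (intro JJ_I[of "- i" "- r"] II_minus fless_minus) simp_all
qed

lemma JJ_diff: "x \<in> JJ n \<Longrightarrow> y \<in> JJ n \<Longrightarrow> x - y \<in> JJ n"
  using JJ_add[of x n "- y"] JJ_minus[of y n] by simp

lemma JJ_zero: "0 \<in> JJ n"
  using II_JJ II_zero by blast

lemma JJ_sum: "(\<And>i. i \<in> A \<Longrightarrow> f i \<in> JJ n) \<Longrightarrow> sum f A \<in> JJ n"
  by (induction A rule: infinite_finite_induct) (auto intro: JJ_zero JJ_add)

lemma JJ_mult: "x \<in> JJ n \<Longrightarrow> t \<in> fle m \<Longrightarrow> x * t \<in> JJ (n + m)"
  and mult_JJ: "x \<in> JJ n \<Longrightarrow> t \<in> fle m \<Longrightarrow> t * x \<in> JJ (n + m)"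
proof -
  assume x: "x \<in> JJ n" and t: "t \<in> fle m"
  from x obtain i r where "i \<in> II" "r \<in> fless n" "x = i + r" by (elim JJ_E)
  with t show "x * t \<in> JJ (n + m)" "t * x \<in> JJ (n + m)"
    by (simp_all add: JJ_I[OF II_mult(2) fless_mult] JJ_I[OF II_mult(1) mult_fless] distrib_left distrib_right)
qed

text \<open>The coset that represents \<open>t\<close> in the component of degree \<open>n\<close> of the associated graded algebra.\<close>

definition gcos :: "nat \<Rightarrow> ('k, 2, 'g) free_alg \<Rightarrow> ('k, 2, 'g) free_alg set set"
  where "gcos n t = cls ` {r + t | r. r \<in> fless n}"

lemma below_coset:
  "filtration_below HH (H_filtration \<rho> lam \<kappa>) n +>\<^bsub>HH\<^esub> cls t = gcos n t"
proof -
  have "filtration_below HH (H_filtration \<rho> lam \<kappa>) n = cls ` fless n"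
    by (cases n) (simp_all add: filtration_below_def H_filtration_def fless_0 cls_hom fless_Suc fle_def)
  then show ?thesis by (auto simp: a_r_coset_def' gcos_def cls_hom)
qed

lemma gcos_eq_iff: "gcos n t = gcos n t' \<longleftrightarrow> t - t' \<in> JJ n"
proof
  assume "gcos n t = gcos n t'"
  moreover have "cls t \<in> gcos n t" unfolding gcos_def using fless_zero by force
  ultimately obtain r where r: "r \<in> fless n" "cls t = cls (r + t')" unfolding gcos_def by auto
  then have "t - (r + t') \<in> II" by (simp add: cls_eq_iff)
  then have "t - (r + t') + r \<in> JJ n" using r by (intro JJ_add II_JJ fless_JJ)
  then show "t - t' \<in> JJ n" by simp
next
  have sub: "gcos n t \<subseteq> gcos n t'" if "t - t' \<in> JJ n" for t t'
  proof
    fix X assume "X \<in> gcos n t"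
    then obtain r where r: "r \<in> fless n" "X = cls (r + t)" by (auto simp: gcos_def)
    from that obtain i s where s: "t - t' = i + s" "i \<in> II" "s \<in> fless n" by (auto simp: JJ_def)
    have "(r + t) - ((r + s) + t') = i" using s(1) by (simp add: algebra_simps)
    then have "X = cls ((r + s) + t')" using r s by (simp add: cls_eq_iff)
    moreover have "r + s \<in> fless n" using r s by (intro fless_add)
    ultimately show "X \<in> gcos n t'" unfolding gcos_def by blast
  qed
  assume "t - t' \<in> JJ n"
  moreover from this have "t' - t \<in> JJ n" using JJ_minus by fastforce
  ultimately show "gcos n t = gcos n t'" using sub by blast
qed

abbreviation GR :: "('k, ('k, 2, 'g) free_alg set set) graded_algebra"
  where "GR \<equiv> assoc_graded HH (\<lambda>c. cls (single 0 c)) (H_filtration \<rho> lam \<kappa>)"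

lemma GR_component: "component GR n = gcos n ` fle n"
proof -
  have "component GR n = (\<lambda>x. filtration_below HH (H_filtration \<rho> lam \<kappa>) n +>\<^bsub>HH\<^esub> x) ` cls ` fle n"
    unfolding assoc_graded_def by (auto simp: H_filtration_def fle_def)
  then show ?thesis by (simp add: image_image below_coset)
qed

lemma gcos_nonempty: "gcos n t \<noteq> {}"
  unfolding gcos_def using fless_zero by blast

lemma GR_add: "gadd GR n (gcos n s) (gcos n t) = gcos n (s + t)"
proof -
  have "set_add HH (gcos n s) (gcos n t) = gcos n (s + t)"
  proof (intro equalityI subsetI)
    fix X assume "X \<in> set_add HH (gcos n s) (gcos n t)"
    then obtain r r' where r: "r \<in> fless n" "r' \<in> fless n" "X = cls (r + s) \<oplus>\<^bsub>HH\<^esub> cls (r' + t)"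
      unfolding set_add_def' gcos_def by blast
    have "(r + s) + (r' + t) = (r + r') + (s + t)" by (simp add: algebra_simps)
    with r have "X = cls ((r + r') + (s + t))" by (simp only: cls_hom)
    then show "X \<in> gcos n (s + t)" using fless_add[OF r(1,2)] unfolding gcos_def by blast
  next
    fix X assume "X \<in> gcos n (s + t)"
    then obtain r where r: "r \<in> fless n" "X = cls (r + (s + t))" unfolding gcos_def by blast
    have "r + (s + t) = (r + s) + (0 + t)" by (simp add: algebra_simps)
    with r have "X = cls (r + s) \<oplus>\<^bsub>HH\<^esub> cls (0 + t)" by (simp only: cls_hom)
    then show "X \<in> set_add HH (gcos n s) (gcos n t)"
      unfolding set_add_def' gcos_def using r(1) fless_zero by blast
  qed
  then show ?thesis by (simp add: assoc_graded_def)
qed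

lemma GR_scale: "gscale GR n c (gcos n t) = gcos n (single 0 c * t)"
proof -
  have "gcos n (single 0 c * (r + t)) = gcos n (single 0 c * t)" if "r \<in> fless n" for r
    using mult_fless[OF that fle_const[of c]] by (simp add: gcos_eq_iff distrib_left fless_JJ)
  then have "filtration_below HH (H_filtration \<rho> lam \<kappa>) n +>\<^bsub>HH\<^esub> (cls (single 0 c) \<otimes>\<^bsub>HH\<^esub> X)
      = gcos n (single 0 c * t)" if "X \<in> gcos n t" for X
    using that by (auto simp: gcos_def[of n t] cls_hom below_coset)
  then show ?thesis
    unfolding assoc_graded_def by (simp add: gcos_nonempty)
qed

lemma GR_mult:
  assumes s: "s \<in> fle m" and t: "t \<in> fle n"
  shows "gmult GR m n (gcos m s) (gcos n t) = gcos (m + n) (s * t)"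
proof -
  have "gcos (m + n) ((r + s) * (r' + t)) = gcos (m + n) (s * t)" if "r \<in> fless m" "r' \<in> fless n" for r r'
  proof -
    have "r' \<in> fle n" using that(2) by (auto simp: fless_def fle_def intro: less_imp_le)
    then have "r * (r' + t) + s * r' \<in> fless (m + n)"
      using fless_mult[OF that(1) fle_add[OF _ t]] mult_fless[OF that(2) s]
      by (intro fless_add) (simp_all add: add.commute)
    then show ?thesis by (simp add: gcos_eq_iff algebra_simps fless_JJ)
  qed
  then have "filtration_below HH (H_filtration \<rho> lam \<kappa>) (m + n) +>\<^bsub>HH\<^esub> (X \<otimes>\<^bsub>HH\<^esub> Y) = gcos (m + n) (s * t)"
    if "X \<in> gcos m s" "Y \<in> gcos n t" for X Y
    using that by (auto simp: gcos_def[of m s] gcos_def[of n t] cls_hom below_coset)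
  then show ?thesis
    unfolding assoc_graded_def by (simp add: gcos_nonempty)
qed

lemma GR_one: "gone GR = gcos 0 1"
  by (simp add: assoc_graded_def cls_hom below_coset)

end

definition homog :: "nat \<Rightarrow> ('k::comm_ring_1, 'n::finite) sym_alg \<Rightarrow> bool"
  where "homog n s \<longleftrightarrow> (\<forall>m\<in>keys s. (\<Sum>i\<in>UNIV. lookup m i) = n)"

lemma homog_zero: "homog n 0"
  by (simp add: homog_def)

lemma homog_add: "homog n s \<Longrightarrow> homog n t \<Longrightarrow> homog n (s + t)"
  using keys_add[of s t] by (auto simp: homog_def)

lemma homog_sum: "(\<And>i. i \<in> A \<Longrightarrow> homog n (f i)) \<Longrightarrow> homog n (sum f A)"
  by (induction A rule: infinite_finite_induct) (auto intro: homog_zero homog_add)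

lemma homog_mult: "homog m s \<Longrightarrow> homog n t \<Longrightarrow> homog (m + n) (s * t)"
  unfolding homog_def
proof
  assume s: "\<forall>m'\<in>keys s. (\<Sum>i\<in>UNIV. lookup m' i) = m"
    and t: "\<forall>m\<in>keys t. (\<Sum>i\<in>UNIV. lookup m i) = n"
  fix l assume "l \<in> keys (s * t)"
  with keys_mult[of s t] obtain a b where "l = a + b" "a \<in> keys s" "b \<in> keys t"
    by blast
  with s t show "(\<Sum>i\<in>UNIV. lookup l i) = m + n" by (simp add: lookup_add sum.distrib)
qed

lemma homog_vec: "homog 1 (sym_vec v)"
  unfolding sym_vec_def by (rule homog_sum) (auto simp: homog_def lookup_single when_def)

text \<open>Finiteness of the homogeneous components replaces dimension counts later on.\<close>

lemma homog_finite:
  assumes fin: "finite (UNIV :: 'k::comm_ring_1 set)"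
  shows "finite {s :: ('k, 'n::finite) sym_alg. homog n s}"
proof -
  let ?M = "{m :: 'n \<Rightarrow>\<^sub>0 nat. (\<Sum>i\<in>UNIV. lookup m i) = n}"
  have inj: "inj_on lookup A" for A :: "('i \<Rightarrow>\<^sub>0 'j::zero) set"
    by (rule inj_onI) simp
  have "lookup m i \<le> n" if "m \<in> ?M" for m i
    using that member_le_sum[of i UNIV "lookup m"] by simp
  then have "lookup ` ?M \<subseteq> {f. \<forall>x. (x \<in> UNIV \<longrightarrow> f x \<in> {..n}) \<and> (x \<notin> UNIV \<longrightarrow> f x = 0)}"
    by (simp add: image_subset_iff)
  then have "finite (lookup ` ?M)"
    by (rule finite_subset) (rule finite_set_of_finite_funs, simp_all)
  then have M: "finite ?M" using inj by (rule finite_imageD)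
  have "lookup s m = 0" if "homog n s" "m \<notin> ?M" for s :: "('k, 'n) sym_alg" and m
    using that by (auto simp: homog_def in_keys_iff)
  then have "lookup ` {s :: ('k, 'n) sym_alg. homog n s} \<subseteq>
      {f. \<forall>x. (x \<in> ?M \<longrightarrow> f x \<in> UNIV) \<and> (x \<notin> ?M \<longrightarrow> f x = 0)}"
    by (simp add: image_subset_iff)
  then have "finite (lookup ` {s :: ('k, 'n) sym_alg. homog n s})"
    by (rule finite_subset) (rule finite_set_of_finite_funs[OF M fin])
  then show ?thesis using inj by (rule finite_imageD)
qed

context orbifold_presentation
begin

sublocale skew_action "\<lambda>h. sym_action (\<rho> h)"
proof
  fix h h' :: 'g and a b :: "('k, 2) sym_alg"
  interpret comm_ring_hom "sym_action (\<rho> h)" by (rule sym_action_hom)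
  show "sym_action (\<rho> h) (a + b) = sym_action (\<rho> h) a + sym_action (\<rho> h) b"
    "sym_action (\<rho> h) (a * b) = sym_action (\<rho> h) a * sym_action (\<rho> h) b"
    "sym_action (\<rho> h) 1 = 1"
    by (simp_all add: hom_add hom_mult)
  show "sym_action (\<rho> (h * h')) a = sym_action (\<rho> h) (sym_action (\<rho> h') a)"
    by (simp add: rho_mult sym_action_mult)
  show "sym_action (\<rho> 1) a = a"
    by (simp add: rho_one sym_action_mat_1)
qed

abbreviation skew_prod :: "(('k, 2) sym_alg, 'g) vec \<Rightarrow> (('k, 2) sym_alg, 'g) vec \<Rightarrow> (('k, 2) sym_alg, 'g) vec"
    (infixl \<open>\<star>\<close> 70)
  where "x \<star> y \<equiv> x \<otimes>\<^bsub>skew_group_algebra (\<lambda>h. sym_action (\<rho> h))\<^esub> y"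

abbreviation SG :: "('k, (('k, 2) sym_alg, 'g) vec) graded_algebra" where "SG \<equiv> sym_skew_graded \<rho>"

definition scomp :: "nat \<Rightarrow> (('k, 2) sym_alg, 'g) vec set"
  where "scomp n = {y. \<forall>h. homog n (y $ h)}"

definition sscale :: "'k \<Rightarrow> (('k, 2) sym_alg, 'g) vec \<Rightarrow> (('k, 2) sym_alg, 'g) vec"
  where "sscale c y = (\<chi> h. single 0 c * y $ h)"

lemma SG_simps:
  "component SG n = scomp n" "gadd SG n x y = x + y" "gscale SG n c x = sscale c x"
  "gmult SG m n x y = x \<star> y" "gone SG = axis 1 1"
  by (simp_all add: sym_skew_graded_def scomp_def homog_def sscale_def Let_def)
    (simp_all add: skew_group_algebra_def)

lemma sscale_axis: "sscale c (axis h s) = axis h (single 0 c * s)"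
  by (simp add: sscale_def vec_eq_iff axis_def)

definition sgen :: "2 + 'g \<Rightarrow> (('k, 2) sym_alg, 'g) vec"
  where "sgen x = (case x of Inl i \<Rightarrow> axis 1 (sym_var i) | Inr h \<Rightarrow> axis h 1)"

sublocale symbol: free_right_module sscale "\<lambda>x y. y \<star> sgen x"
proof
  fix c d :: 'k and x y :: "(('k, 2) sym_alg, 'g) vec" and l
  show "sscale c (x + y) = sscale c x + sscale c y" "sscale (c + d) x = sscale c x + sscale d x"
    "sscale c (sscale d x) = sscale (c * d) x" "sscale 1 x = x"
    by (simp_all add: sscale_def vec_eq_iff distrib_left single_add distrib_right mult_single flip: mult.assoc)
  show "(x + y) \<star> sgen l = x \<star> sgen l + y \<star> sgen l" by (rule skew_add_left)
  show "sscale c x \<star> sgen l = sscale c (x \<star> sgen l)"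
    by (simp add: vec_eq_iff skew_mult_nth sscale_def sum_distrib_left split_beta mult.assoc)
qed

text \<open>The algebra homomorphism from the free algebra to \<open>S(V) \<rtimes> G\<close>, that is, the quotient map for
  \<open>\<lambda> = 0\<close> and \<open>\<kappa> = 0\<close>, obtained from the right regular representation.\<close>

definition symb :: "('k, 2, 'g) free_alg \<Rightarrow> (('k, 2) sym_alg, 'g) vec"
  where "symb t = free_act sscale (\<lambda>x y. y \<star> sgen x) t (axis 1 1)"

lemma symb_add: "symb (s + t) = symb s + symb t"
  by (simp add: symb_def symbol.free_act_add)

lemmas symb_additive = additive_facts[where f = symb, OF symb_add]

lemma symb_one: "symb 1 = axis 1 1"
  by (simp add: symb_def symbol.free_act_one)

lemma skew_sscale_right: "x \<star> sscale c y = sscale c (x \<star> y)"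
proof -
  have "sym_action (\<rho> h) (single 0 c * s) = single 0 c * sym_action (\<rho> h) s" for h s
    by (simp add: act_mult sym_action_const)
  then show ?thesis
    by (simp add: vec_eq_iff skew_mult_nth sscale_def sum_distrib_left split_beta mult.left_commute)
qed

text \<open>Associativity lets the letters of a word be multiplied among themselves first. Multiplicativity
  of \<open>symb\<close> follows.\<close>

lemma free_act_skew: "free_act sscale (\<lambda>x y. y \<star> sgen x) t y = y \<star> symb t"
proof (induction t rule: poly_mapping_single_induct)
  case (single u c)
  have "fold (\<lambda>x y. y \<star> sgen x) w (x \<star> z) = x \<star> fold (\<lambda>x y. y \<star> sgen x) w z" for w x z
    by (induction w arbitrary: z) (simp_all only: fold_simps skew_assoc)
  from this[of "letters u" y "axis 1 1"] show ?case
    unfolding symb_def symbol.free_act_single skew_sscale_right by (simp only: skew_one)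
qed (simp only: symb_add symbol.free_act_add skew_add_right)

lemma symb_mult: "symb (s * t) = symb s \<star> symb t"
  by (simp only: symb_def[of "s * t"] symbol.free_act_mult) (simp only: free_act_skew skew_one)

lemma symb_const: "symb (single 0 c) = axis 1 (single 0 c)"
  by (simp add: symb_def symbol.free_act_const sscale_axis)

abbreviation fvar :: "2 \<Rightarrow> ('k, 2, 'g) free_alg"
  where "fvar i \<equiv> single (Letters [Inl i]) 1"

lemma symb_var: "symb (fvar i) = axis 1 (sym_var i)"
  and symb_grp: "symb (free_grp h) = axis h 1"
proof -
  have "symb (single (Letters [x]) 1) = sgen x" for x
    by (simp add: symb_def symbol.free_act_single skew_one)
  then show "symb (fvar i) = axis 1 (sym_var i)" "symb (free_grp h) = axis h 1"
    by (simp_all add: free_grp_def sgen_def)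
qed

lemma scomp_zero: "0 \<in> scomp n"
  and scomp_add: "x \<in> scomp n \<Longrightarrow> y \<in> scomp n \<Longrightarrow> x + y \<in> scomp n"
  by (auto simp: scomp_def homog_zero homog_add)

lemma scomp_sum: "(\<And>i. i \<in> A \<Longrightarrow> f i \<in> scomp n) \<Longrightarrow> sum f A \<in> scomp n"
  by (induction A rule: infinite_finite_induct) (auto intro: scomp_zero scomp_add)

lemma scomp_axis: "homog n s \<Longrightarrow> axis h s \<in> scomp n"
  by (auto simp: scomp_def axis_def homog_zero)

lemma sym_action_var: "sym_action (\<rho> h) (sym_var i) = sym_vec (\<rho> h *v axis i 1)"
  by (metis sym_vec_axis sym_action_vec)

lemma homog_one: "homog 0 1"
  by (simp add: homog_def)

lemma scomp_step:
  assumes y: "y \<in> scomp n"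
  shows "y \<star> sgen (Inl i) \<in> scomp (n + 1)" "y \<star> sgen (Inr h) \<in> scomp n"
proof -
  have h: "homog n (y $ k)" for k using y by (simp add: scomp_def)
  have "(\<Sum>k\<in>UNIV. axis k (y $ k)) \<star> sgen (Inl i) \<in> scomp (n + 1)"
    unfolding skew_additive_left(4) sgen_def sum.case skew_axis sym_action_var
    by (intro scomp_sum scomp_axis homog_mult h homog_vec)
  moreover have "(\<Sum>k\<in>UNIV. axis k (y $ k)) \<star> sgen (Inr h) \<in> scomp n" for h
    unfolding skew_additive_left(4) sgen_def sum.case skew_axis act_one mult_1_right
    by (intro scomp_sum scomp_axis h)
  ultimately show "y \<star> sgen (Inl i) \<in> scomp (n + 1)" "y \<star> sgen (Inr h) \<in> scomp n"
    by (simp_all only: vec_sum_axis)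
qed

lemma scomp_word: "sscale c (fold (\<lambda>x y. y \<star> sgen x) w y) \<in> scomp (n + length (filter isl w))" if "y \<in> scomp n"
  using that
proof (induction w arbitrary: y n)
  case Nil
  have "homog 0 (single 0 c)" by (simp add: homog_def)
  then have "homog n (single 0 c * s)" if "homog n s" for s :: "('k, 2) sym_alg"
    using homog_mult[OF _ that] by fastforce
  with Nil show ?case by (simp add: sscale_def scomp_def)
next
  case (Cons x w)
  show ?case
  proof (cases x)
    case (Inl i)
    from Cons.IH[OF scomp_step(1)[OF Cons.prems, of i]] Inl show ?thesis by simp
  next
    case (Inr h)
    from Cons.IH[OF scomp_step(2)[OF Cons.prems, of h]] Inr show ?thesis by simp
  qed
qed

text \<open>The part of degree \<open>n\<close>; on elements of degree at most \<open>n\<close> it is the leading part.\<close>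

definition htop :: "nat \<Rightarrow> ('k, 2, 'g) free_alg \<Rightarrow> ('k, 2, 'g) free_alg"
  where "htop n t = lin_ext (\<lambda>u c. if mon_degree u = n then single u c else 0) t"

lemma htop_single: "htop n (single u c) = (if mon_degree u = n then single u c else 0)"
  unfolding htop_def by (rule lin_ext_single) simp

lemma htop_add: "htop n (s + t) = htop n s + htop n t"
  unfolding htop_def by (rule lin_ext_add) (simp_all add: single_add)

lemmas htop_additive = additive_facts[where f = "htop n" for n, OF htop_add]

lemma lookup_top: "lookup (htop n t) u = (if mon_degree u = n then lookup t u else 0)"
  by (induction t rule: poly_mapping_single_induct)
    (auto simp: htop_single htop_add lookup_add lookup_single when_def)

lemma htop_less: "t \<in> fle n \<Longrightarrow> t - htop n t \<in> fless n"
  by (force simp: fle_def fless_def in_keys_iff lookup_minus lookup_top order.order_iff_strict split: if_splits)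

lemma htop_mult:
  assumes "s \<in> fle m" "t \<in> fle n"
  shows "htop (m + n) (s * t) = htop m s * htop n t"
proof -
  have single: "htop (m + n) (single u c * single w d) =
      htop m (single u c) * htop n (single w d)"
    if "mon_degree u \<le> m" "mon_degree w \<le> n" for u w c d
    using that by (auto simp: mult_single htop_single mon_degree_add)
  have "htop (m + n) ((\<Sum>u\<in>keys s. single u (lookup s u)) *
        (\<Sum>u\<in>keys t. single u (lookup t u))) =
      htop m (\<Sum>u\<in>keys s. single u (lookup s u)) *
        htop n (\<Sum>u\<in>keys t. single u (lookup t u))"
    unfolding sum_product htop_additive(4) using assms
    by (intro sum.cong refl single) (auto simp: fle_def)
  then show ?thesis by (simp only: sum_single_lookup)
qed

lemma symb_htop_mem: "symb (htop n t) \<in> scomp n"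
proof (induction t rule: poly_mapping_single_induct)
  case (single u c)
  have "axis 1 1 \<in> scomp 0" by (rule scomp_axis) (rule homog_one)
  from scomp_word[OF this, of c "letters u"] have "symb (single u c) \<in> scomp (mon_degree u)"
    by (simp add: symb_def symbol.free_act_single mon_degree_def)
  then show ?case by (auto simp: htop_single symb_additive scomp_zero)
qed (simp add: htop_add symb_add scomp_add)

definition smono :: "(2 \<Rightarrow>\<^sub>0 nat) \<Rightarrow> ('k, 2, 'g) free_alg"
  where "smono m = fvar 1 ^ lookup m 1 * fvar 2 ^ lookup m 2"

text \<open>The normally ordered representative of an element of \<open>S(V) \<rtimes> G\<close>, linear but not multiplicative;
  it is a section of \<open>symb\<close>.\<close>

definition slift :: "(('k, 2) sym_alg, 'g) vec \<Rightarrow> ('k, 2, 'g) free_alg"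
  where "slift y = (\<Sum>h\<in>UNIV. lin_ext (\<lambda>m c. single 0 c * smono m) (y $ h) * free_grp h)"

lemma slift_add: "slift (x + y) = slift x + slift y"
proof -
  have "lin_ext (\<lambda>m c. single 0 c * smono m) (s + t) =
      lin_ext (\<lambda>m c. single 0 c * smono m) s + lin_ext (\<lambda>m c. single 0 c * smono m) t" for s t
    by (rule lin_ext_add) (simp_all add: single_add distrib_right)
  then show ?thesis by (simp add: slift_def distrib_right sum.distrib)
qed

lemmas slift_additive = additive_facts[where f = slift, OF slift_add]

lemma slift_axis: "slift (axis h (single m c)) = single 0 c * smono m * free_grp h"
proof -
  let ?L = "lin_ext (\<lambda>m c. single 0 c * smono m)"
  have "slift (axis h (single m c)) = (\<Sum>k\<in>UNIV. if k = h then ?L (single m c) * free_grp h else 0)"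
    unfolding slift_def by (intro sum.cong) (auto simp: axis_def lin_ext_def)
  then show ?thesis by (simp add: lin_ext_single)
qed

lemma scomp_induct [consumes 1, case_names axis add zero]:
  assumes y: "y \<in> scomp n"
    and axis: "\<And>h m c. (\<Sum>i\<in>UNIV. lookup m i) = n \<Longrightarrow> P (axis h (single m c))"
    and add: "\<And>x y. P x \<Longrightarrow> P y \<Longrightarrow> P (x + y)" and zero: "P 0"
  shows "P y"
proof -
  have sum: "P (sum f A)" if "\<And>i. i \<in> A \<Longrightarrow> P (f i)" for f :: "'i \<Rightarrow> _" and A
    using that by (induction A rule: infinite_finite_induct) (auto intro: zero add)
  have sum': "P (sum f A)" if "\<And>i. i \<in> A \<Longrightarrow> P (f i)" for f :: "'j \<Rightarrow> _" and A
    using that by (induction A rule: infinite_finite_induct) (auto intro: zero add)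
  have axis_sum: "axis h (sum f A) = (\<Sum>i\<in>A. axis h (f i))" for h and f :: "(2 \<Rightarrow>\<^sub>0 nat) \<Rightarrow> ('k, 2) sym_alg" and A
    by (simp add: vec_eq_iff axis_def)
  have "P (axis h (y $ h))" for h
  proof -
    have "P (\<Sum>m\<in>keys (y $ h). axis h (single m (lookup (y $ h) m)))"
      using y by (intro sum axis) (auto simp: scomp_def homog_def)
    then show ?thesis by (simp only: axis_sum[symmetric] sum_single_lookup)
  qed
  then have "P (\<Sum>h\<in>UNIV. axis h (y $ h))" by (intro sum')
  then show ?thesis by (simp only: vec_sum_axis)
qed

subsection \<open>Normal forms\<close>

lemma UNIV_2: "(UNIV :: 2 set) = {1, 2}"
  using exhaust_2 by auto

lemma fvar_vec: "fvar i = free_vec (axis i 1)"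
proof -
  have "free_vec (axis i 1) = (\<Sum>j\<in>UNIV. if j = i then fvar i else 0)"
    unfolding free_vec_def by (intro sum.cong) (auto simp: axis_def)
  then show ?thesis by simp
qed

lemma fle_var: "fvar i \<in> fle 1"
  unfolding fvar_vec by (rule fle_vec)

lemma fle_pow: "s \<in> fle d \<Longrightarrow> s ^ n \<in> fle (d * n)"
proof (induction n)
  case 0
  show ?case using fle_const[of 1] by simp
qed (auto dest: fle_mult simp: add.commute)

lemma fle_smono: "smono m \<in> fle (lookup m 1 + lookup m 2)"
  unfolding smono_def using fle_pow[OF fle_var] by (intro fle_mult) force+

lemma const_commute: "single 0 c * t = t * single 0 (c :: 'k)"
  for t :: "('k, 2, 'g) free_alg"
  by (induction t rule: poly_mapping_single_induct) (simp_all add: mult_single mult.commute distrib_left distrib_right)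

lemma sum_lookup_2: "(\<Sum>i\<in>UNIV. lookup m i) = lookup m 1 + lookup m (2::2)"
  by (simp add: UNIV_2)

lemma slift_fle: "y \<in> scomp n \<Longrightarrow> slift y \<in> fle n"
proof (induction rule: scomp_induct)
  case (axis h m c)
  then show ?case
    unfolding slift_axis sum_lookup_2
    using fle_mult[OF fle_mult[OF fle_const fle_smono] fle_grp] by fastforce
next
  case zero
  show ?case by (simp add: slift_additive(1) fle_def)
qed (simp add: slift_add fle_add)

lemma symb_slift: "y \<in> scomp n \<Longrightarrow> symb (slift y) = y"
proof (induction rule: scomp_induct)
  case (axis h m c)
  have pow: "symb (fvar i ^ n) = axis 1 (sym_var i ^ n)" for i n
    by (induction n) (simp_all only: power_0 power_Suc symb_one symb_mult symb_var skew_axis act_unit mult_1_left)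
  have "symb (slift (axis h (single m c))) =
      axis h (single 0 c * (sym_var 1 ^ lookup m 1 * sym_var 2 ^ lookup m 2))"
    unfolding slift_axis smono_def symb_mult symb_const pow symb_grp skew_axis
    by (simp only: act_unit act_one mult_1_left mult_1_right)
  also have "\<dots> = axis h (single m c)"
    by (subst (3) single_sym_monomial) (simp add: UNIV_2)
  finally show ?case .
qed (simp_all add: symb_additive slift_additive slift_add symb_add)

lemma htop_fvar: "htop 1 (fvar i) = fvar i" and htop_grp: "htop 0 (free_grp h) = free_grp h"
  and htop_const: "htop 0 (single 0 c) = single 0 c"
  by (simp_all add: free_grp_def htop_single mon_degree_def zero_free_mon_def)

lemma htop_slift: "y \<in> scomp n \<Longrightarrow> htop n (slift y) = slift y"
proof (induction rule: scomp_induct)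
  case (axis h m c)
  have pow: "htop n (fvar i ^ n) = fvar i ^ n" for i n
  proof (induction n)
    case 0
    show ?case using htop_const[of 1] by simp
  next
    case (Suc n)
    have "htop (1 + 1 * n) (fvar i * fvar i ^ n) = htop 1 (fvar i) * htop (1 * n) (fvar i ^ n)"
      by (rule htop_mult[OF fle_var fle_pow[OF fle_var]])
    then show ?case using Suc by (simp add: htop_fvar[unfolded One_nat_def])
  qed
  let ?p = "lookup m 1" and ?q = "lookup m 2"
  have "htop (?p + ?q) (smono m) = smono m"
  proof -
    have "htop (1 * ?p + 1 * ?q) (fvar 1 ^ ?p * fvar 2 ^ ?q) = htop (1 * ?p) (fvar 1 ^ ?p) * htop (1 * ?q) (fvar 2 ^ ?q)"
      by (intro htop_mult fle_pow fle_var)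
    then show ?thesis by (simp add: smono_def pow)
  qed
  moreover have "htop (0 + (?p + ?q) + 0) (single 0 c * smono m * free_grp h) =
      htop 0 (single 0 c) * htop (?p + ?q) (smono m) * htop 0 (free_grp h)"
    using htop_mult[OF fle_mult[OF fle_const fle_smono] fle_grp] htop_mult[OF fle_const fle_smono] by metis
  ultimately have "htop (0 + (?p + ?q) + 0) (single 0 c * smono m * free_grp h) =
      single 0 c * smono m * free_grp h"
    by (simp only: htop_grp htop_const)
  then show ?case using axis unfolding slift_axis sum_lookup_2 by simp
qed (simp_all add: htop_additive slift_additive slift_add htop_add)

text \<open>Moving \<open>v\<^sub>1\<close> to the left past a power of \<open>v\<^sub>2\<close> costs commutators, which are equal modulo the
  ideal to elements of degree at most 1 in place of 2.\<close>

lemma smono_times_vec: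
  "smono m * fvar i - smono (m + single i 1) \<in> JJ (lookup m 1 + lookup m 2 + 1)"
proof -
  have comm: "fvar 2 * fvar 1 - fvar 1 * fvar 2 \<in> JJ 2"
  proof -
    have "fvar 2 * fvar 1 - fvar 1 * fvar 2 - free_kappa_value (\<kappa> (axis 2 1) (axis 1 1)) \<in> JJ 2"
      unfolding fvar_vec by (rule II_JJ) (rule relators)
    moreover have "free_kappa_value (\<kappa> (axis 2 1) (axis 1 1)) \<in> JJ 2"
      using fle_kappa_value by (intro fless_JJ) (simp add: numeral_2_eq_2 fless_Suc)
    ultimately show ?thesis using JJ_add by fastforce
  qed
  have swap: "fvar 2 ^ q * fvar 1 - fvar 1 * fvar 2 ^ q \<in> JJ (q + 1)" for q
  proof (induction q)
    case 0
    show ?case by (simp add: JJ_zero)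
  next
    case (Suc q)
    have "fvar 2 * (fvar 2 ^ q * fvar 1 - fvar 1 * fvar 2 ^ q) \<in> JJ ((q + 1) + 1)"
      by (rule mult_JJ[OF Suc fle_var])
    moreover have "(fvar 2 * fvar 1 - fvar 1 * fvar 2) * fvar 2 ^ q \<in> JJ (2 + 1 * q)"
      by (rule JJ_mult[OF comm fle_pow[OF fle_var]])
    ultimately have "fvar 2 * (fvar 2 ^ q * fvar 1 - fvar 1 * fvar 2 ^ q) + (fvar 2 * fvar 1 - fvar 1 * fvar 2) * fvar 2 ^ q
        \<in> JJ (Suc q + 1)"
      by (intro JJ_add) simp_all
    then show ?case by (simp add: right_diff_distrib left_diff_distrib mult.assoc)
  qed
  let ?p = "lookup m 1" and ?q = "lookup m 2"
  show ?thesis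
  proof (cases "i = 1")
    case True
    have "fvar 1 ^ ?p * (fvar 2 ^ ?q * fvar 1 - fvar 1 * fvar 2 ^ ?q) \<in> JJ ((?q + 1) + 1 * ?p)"
      by (rule mult_JJ[OF swap fle_pow[OF fle_var]])
    then show ?thesis
      by (simp add: True smono_def lookup_add lookup_single when_def right_diff_distrib mult.assoc power_Suc2
          add_ac del: power_Suc)
  next
    case False
    then have "i = 2" using exhaust_2 by blast
    then have "smono (m + single i 1) = smono m * fvar i"
      by (simp add: smono_def lookup_add lookup_single when_def mult.assoc power_Suc2 del: power_Suc)
    then show ?thesis by (simp add: JJ_zero)
  qed
qed

text \<open>Moving a vector to the left past a group element produces values of \<open>\<lambda>\<close>, which have degree 0,
  and sorting the vectors is \<open>smono_times_vec\<close>. So right multiplication by a letter commutes with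
  normal ordering up to lower degree.\<close>

lemma slift_step:
  assumes "y \<in> scomp n"
  shows "slift y * free_grp h' - slift (y \<star> sgen (Inr h')) \<in> JJ n"
    and "slift y * fvar i - slift (y \<star> sgen (Inl i)) \<in> JJ (n + 1)"
  using assms
proof (induction rule: scomp_induct)
  case (axis h m c)
  let ?W = "single 0 c * smono m"
  have n: "lookup m 1 + lookup m 2 = n" using axis by (simp add: sum_lookup_2)
  have W: "?W \<in> fle n" using fle_mult[OF fle_const fle_smono, of c m] n by simp
  {
    case 1
    have "?W * (free_grp h * free_grp h' - free_grp (h * h')) \<in> II"
      by (intro II_mult(1) relators)
    then show ?case
      by (simp add: sgen_def skew_axis act_one slift_axis right_diff_distrib mult.assoc II_JJ)
  next
    case 2
    let ?v = "\<rho> h *v axis i 1"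
    have "?W * (free_grp h * free_vec (axis i 1) - free_vec ?v * free_grp h - free_group_algebra (lam (axis h 1) (axis i 1))) \<in> JJ (n + 1)"
      by (intro II_JJ II_mult(1) relators)
    moreover have "?W * free_group_algebra (lam (axis h 1) (axis i 1)) \<in> JJ (n + 1)"
      using fle_mult[OF W fle_group_algebra] by (intro fless_JJ) (simp add: fless_Suc)
    ultimately have "?W * (free_grp h * free_vec (axis i 1) - free_vec ?v * free_grp h - free_group_algebra (lam (axis h 1) (axis i 1)))
        + ?W * free_group_algebra (lam (axis h 1) (axis i 1)) \<in> JJ (n + 1)"
      by (rule JJ_add)
    then have 1: "?W * free_grp h * fvar i - ?W * free_vec ?v * free_grp h \<in> JJ (n + 1)"
      by (simp add: fvar_vec algebra_simps)
    have "single 0 (c * ?v $ j) * (smono m * fvar j - smono (m + single j 1)) * free_grp h \<in> JJ (n + 1)" for j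
    proof -
      have "single 0 (c * ?v $ j) * (smono m * fvar j - smono (m + single j 1)) * free_grp h
          \<in> JJ (lookup m 1 + lookup m 2 + 1 + 0 + 0)"
        by (intro JJ_mult mult_JJ smono_times_vec fle_const fle_grp)
      then show ?thesis using n by simp
    qed
    then have "(\<Sum>j\<in>UNIV. single 0 (c * ?v $ j) * (smono m * fvar j - smono (m + single j 1)) * free_grp h) \<in> JJ (n + 1)"
      by (rule JJ_sum)
    moreover have "?W * free_vec ?v * free_grp h = (\<Sum>j\<in>UNIV. single 0 (c * ?v $ j) * (smono m * fvar j) * free_grp h)"
    proof -
      have "free_vec ?v = (\<Sum>j\<in>UNIV. single 0 (?v $ j) * fvar j)"
        by (simp add: free_vec_def mult_single)
      moreover have "single 0 c * smono m * (single 0 (?v $ j) * fvar j) =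
          single 0 (c * ?v $ j) * (smono m * fvar j)" for j
      proof -
        have comm: "smono m * single 0 (?v $ j) = single 0 (?v $ j) * smono m"
          by (rule const_commute[symmetric])
        have "C * M * (V * X) = (C * V) * (M * X)" if "M * V = V * M" for C M V X :: "('k, 2, 'g) free_alg"
          using that by (metis mult.assoc)
        moreover have "single 0 c * single 0 (?v $ j) =
            (single 0 (c * ?v $ j) :: ('k, 2, 'g) free_alg)"
          by (simp add: mult_single)
        ultimately show ?thesis using comm by metis
      qed
      ultimately show ?thesis by (simp only: sum_distrib_left sum_distrib_right)
    qed
    moreover have "slift (axis h (single m c) \<star> sgen (Inl i)) =
        (\<Sum>j\<in>UNIV. single 0 (c * ?v $ j) * smono (m + single j 1) * free_grp h)"
    proof -
      have "axis h (\<Sum>j\<in>UNIV. f j) = (\<Sum>j\<in>UNIV. axis h (f j))" for f :: "2 \<Rightarrow> ('k, 2) sym_alg"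
        by (simp add: vec_eq_iff axis_def)
      then have "axis h (single m c) \<star> sgen (Inl i) =
          (\<Sum>j\<in>UNIV. axis h (single (m + single j 1) (c * ?v $ j)))"
        by (simp add: sgen_def skew_axis sym_action_var[unfolded One_nat_def] sym_vec_def sum_distrib_left mult_single)
      then show ?thesis by (simp only: slift_additive(4) slift_axis)
    qed
    ultimately have 2: "?W * free_vec ?v * free_grp h - slift (axis h (single m c) \<star> sgen (Inl i)) \<in> JJ (n + 1)"
      by (simp only: right_diff_distrib left_diff_distrib sum_subtractf)
    from JJ_add[OF 1 2] show ?case by (simp add: slift_axis)
  }
next
  case (add x y)
  {
    case 1
    from JJ_add[OF add(1) add(3)] show ?case
      by (simp add: slift_add skew_add_left distrib_right algebra_simps)
  next
    case 2
    from JJ_add[OF add(2) add(4)] show ?case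
      by (simp add: slift_add skew_add_left distrib_right algebra_simps)
  }
next
  case zero
  {
    case 1
    show ?case by (simp add: slift_additive skew_additive_left JJ_zero)
  next
    case 2
    show ?case by (simp add: slift_additive skew_additive_left JJ_zero)
  }
qed

lemma symb_snoc: "symb (t * fvar i) = symb t \<star> sgen (Inl i)" "symb (t * free_grp h) = symb t \<star> sgen (Inr h)"
  by (simp_all only: symb_mult symb_var symb_grp sgen_def sum.case)

lemma normal_form_word:
  "single (Letters w) 1 - slift (symb (single (Letters w) 1)) \<in> JJ (mon_degree (Letters w))"
proof (induction w rule: rev_induct)
  case Nil
  have one: "single (Letters []) 1 = (1 :: ('k, 2, 'g) free_alg)"
    by (simp flip: zero_free_mon_def)
  have "slift (axis 1 (single 0 1)) = free_grp 1"
    by (simp only: slift_axis smono_def) simp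
  then have "1 - slift (axis 1 1) = - (free_grp 1 - 1)" by simp
  then show ?case unfolding one symb_one by (simp only:) (intro II_JJ II_minus relators)
next
  case (snoc x w)
  let ?t = "single (Letters w) 1 :: ('k, 2, 'g) free_alg"
  let ?n = "mon_degree (Letters w)"
  have mem: "symb ?t \<in> scomp ?n"
    using symb_htop_mem[of ?n ?t] by (simp add: htop_single)
  have app: "single (Letters (w @ [x])) 1 = ?t * single (Letters [x]) 1"
    by (simp add: mult_single plus_free_mon_def)
  show ?case
  proof (cases x)
    case (Inl i)
    have "(?t - slift (symb ?t)) * fvar i \<in> JJ (?n + 1)" by (rule JJ_mult[OF snoc fle_var])
    from JJ_add[OF this slift_step(2)[OF mem, of i]] show ?thesis
      unfolding app by (simp add: Inl symb_snoc left_diff_distrib mon_degree_def)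
  next
    case (Inr h)
    have "(?t - slift (symb ?t)) * free_grp h \<in> JJ (?n + 0)" by (rule JJ_mult[OF snoc fle_grp])
    from JJ_add[OF this[simplified] slift_step(1)[OF mem, of h]] show ?thesis
      unfolding app by (simp add: Inr symb_snoc left_diff_distrib mon_degree_def flip: free_grp_def)
  qed
qed

lemma slift_sscale: "slift (sscale c y) = single 0 c * slift y"
proof -
  have L: "lin_ext (\<lambda>m c. single 0 c * smono m) (single 0 c * s) =
      single 0 c * lin_ext (\<lambda>m c. single 0 c * smono m) s" (is "?L (_ * s) = _") for s
  proof (induction s rule: poly_mapping_single_induct)
    case (single m d)
    have s: "?L (single m e) = single 0 e * smono m" for m e
      by (rule lin_ext_single) simp
    show ?case by (simp add: mult_single s flip: mult.assoc)
  next
    case (add s t)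
    have a: "?L (s + t) = ?L s + ?L t" for s t
      by (rule lin_ext_add) (simp_all add: single_add distrib_right)
    from add show ?case by (simp add: distrib_left a)
  qed
  show ?thesis by (simp add: slift_def sscale_def L sum_distrib_left mult.assoc)
qed

lemma normal_form: "htop n t - slift (symb (htop n t)) \<in> JJ n"
proof (induction t rule: poly_mapping_single_induct)
  case (single u c)
  show ?case
  proof (cases "mon_degree u = n")
    case True
    let ?t = "single u 1 :: ('k, 2, 'g) free_alg"
    have u: "single u c = single 0 c * ?t" by (simp add: mult_single)
    have "symb (single u c) = sscale c (symb ?t)"
      by (simp add: symb_def symbol.free_act_single)
    moreover have "?t - slift (symb ?t) \<in> JJ n"
      using normal_form_word[of "letters u"] True by simp
    from mult_JJ[OF this fle_const[of c]] have "single 0 c * (?t - slift (symb ?t)) \<in> JJ n" by simp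
    ultimately show ?thesis
      by (simp add: htop_single True slift_sscale right_diff_distrib mult_single)
  next
    case False
    then show ?thesis by (simp add: htop_single symb_additive slift_additive JJ_zero)
  qed
next
  case (add s t)
  from JJ_add[OF add] show ?case by (simp add: htop_add symb_add slift_add algebra_simps)
qed

text \<open>Normally ordered monomials span the associated graded algebra, whatever \<open>\<lambda>\<close> and \<open>\<kappa>\<close> are.\<close>

lemma reduction:
  assumes "t \<in> fle n"
  shows "t - slift (symb (htop n t)) \<in> JJ n"
  using JJ_add[OF fless_JJ[OF htop_less[OF assms]] normal_form[of n t]] by simp

subsection \<open>The PBW criterion\<close>

lemma skew_sscale_left: "sscale c x \<star> y = sscale c (x \<star> y)"
  by (simp add: vec_eq_iff skew_mult_nth sscale_def sum_distrib_left split_beta mult.assoc)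

text \<open>By \<open>reduction\<close> normal ordering always induces a surjection from \<open>S(V) \<rtimes> G\<close> to the associated
  graded algebra; this says that it is injective.\<close>

definition pbw_independent :: bool
  where "pbw_independent \<longleftrightarrow> (\<forall>n. \<forall>y\<in>scomp n. slift y \<in> JJ n \<longrightarrow> y = 0)"

text \<open>The isomorphism sends the class of \<open>t\<close> in degree \<open>n\<close> to the image of the leading part of \<open>t\<close>
  in \<open>S(V) \<rtimes> G\<close>. It is well defined because an element of degree at most \<open>n\<close> that vanishes in degree \<open>n\<close> has a
  normally ordered leading part which vanishes as well.\<close>

lemma pbw_independent_imp_graded_iso:
  assumes pbw_independent
  shows "graded_algebra_isomorphic GR SG"
proof -
  define \<phi> where "\<phi> n X = symb (htop n (SOME t. t \<in> fle n \<and> gcos n t = X))" for n X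
  have kernel: "symb (htop n t) = 0" if t: "t \<in> fle n" "t \<in> JJ n" for n t
  proof -
    \<comment> \<open>The normally ordered leading part is congruent to \<open>t\<close>, hence to 0.\<close>
    from JJ_diff[OF t(2) reduction[OF t(1)]] have "slift (symb (htop n t)) \<in> JJ n" by simp
    with assms symb_htop_mem show ?thesis unfolding pbw_independent_def by blast
  qed
  have \<phi>: "\<phi> n (gcos n t) = symb (htop n t)" if t: "t \<in> fle n" for n t
  proof -
    define t' where "t' = (SOME t'. t' \<in> fle n \<and> gcos n t' = gcos n t)"
    have t': "t' \<in> fle n" "gcos n t' = gcos n t"
      unfolding t'_def using someI[of "\<lambda>t'. t' \<in> fle n \<and> gcos n t' = gcos n t" t] t by blast+
    have "- t \<in> fle n" using t fless_minus[of t "Suc n"] by (simp add: fless_Suc)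
    from fle_add[OF t'(1) this] have "symb (htop n (t' - t)) = 0"
      using t'(2) by (intro kernel) (simp_all add: gcos_eq_iff)
    then show ?thesis by (simp add: \<phi>_def t'_def[symmetric] htop_additive symb_additive)
  qed
  have "graded_algebra_iso GR SG \<phi>"
    unfolding graded_algebra_iso_def SG_simps
  proof (intro conjI allI ballI)
    fix n
    show "bij_betw (\<phi> n) (component GR n) (scomp n)"
      unfolding bij_betw_def
    proof (intro conjI inj_onI)
      fix X Y assume "X \<in> component GR n" "Y \<in> component GR n" and eq: "\<phi> n X = \<phi> n Y"
      then obtain s t where st: "s \<in> fle n" "X = gcos n s" "t \<in> fle n" "Y = gcos n t"
        unfolding GR_component by blast
      with eq have "symb (htop n s) = symb (htop n t)" by (simp add: \<phi>)
      then have "s - t \<in> JJ n"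
        using JJ_diff[OF reduction[OF st(1)] reduction[OF st(3)]] by simp
      then show "X = Y" by (simp add: st gcos_eq_iff)
    next
      show "\<phi> n ` component GR n = scomp n"
      proof (intro equalityI subsetI)
        fix y assume y: "y \<in> scomp n"
        have "y = \<phi> n (gcos n (slift y))"
          by (simp add: \<phi>[OF slift_fle[OF y]] htop_slift[OF y] symb_slift[OF y])
        then show "y \<in> \<phi> n ` component GR n"
          unfolding GR_component using slift_fle[OF y] by blast
      qed (auto simp: GR_component \<phi> symb_htop_mem)
    qed
  next
    fix n X Y assume "X \<in> component GR n" "Y \<in> component GR n"
    then obtain s t where st: "s \<in> fle n" "X = gcos n s" "t \<in> fle n" "Y = gcos n t"
      unfolding GR_component by blast
    then show "\<phi> n (gadd GR n X Y) = \<phi> n X + \<phi> n Y"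
      by (simp only: GR_add \<phi> fle_add htop_add symb_add)
  next
    fix n c X assume "X \<in> component GR n"
    then obtain t where t: "t \<in> fle n" "X = gcos n t" unfolding GR_component by blast
    have "htop (0 + n) (single 0 c * t) = htop 0 (single 0 c) * htop n t"
      by (rule htop_mult[OF fle_const t(1)])
    moreover have "single 0 c * t \<in> fle n" using fle_mult[OF fle_const t(1)] by simp
    moreover have "symb (single 0 c * t') = sscale c (symb t')" for t'
      using skew_sscale_left[of c "axis 1 1" "symb t'"]
      by (simp add: symb_mult symb_const sscale_axis skew_one)
    ultimately show "\<phi> n (gscale GR n c X) = sscale c (\<phi> n X)"
      by (simp add: t GR_scale \<phi> htop_const)
  next
    fix m n X Y assume "X \<in> component GR m" "Y \<in> component GR n"
    then obtain s t where st: "s \<in> fle m" "X = gcos m s" "t \<in> fle n" "Y = gcos n t"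
      unfolding GR_component by blast
    then show "\<phi> (m + n) (gmult GR m n X Y) = \<phi> m X \<star> \<phi> n Y"
      by (simp only: GR_mult \<phi> fle_mult htop_mult symb_mult)
  next
    have "(1 :: ('k, 2, 'g) free_alg) \<in> fle 0" "htop 0 1 = (1 :: ('k, 2, 'g) free_alg)"
      using fle_const[of 1] htop_const[of 1] by simp_all
    then show "\<phi> 0 (gone GR) = axis 1 1" by (simp add: GR_one \<phi> symb_one)
  qed
  then show ?thesis unfolding graded_algebra_isomorphic_def by blast
qed

text \<open>The given isomorphism need not be the canonical one. Composed with normal ordering it is a
  surjection of a homogeneous component of \<open>S(V) \<rtimes> G\<close> onto itself; as this component is finite,
  the surjection is injective.\<close>

lemma graded_iso_imp_pbw_independent:
  assumes iso: "graded_algebra_isomorphic GR SG" and fin: "finite (UNIV :: 'k set)"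
  shows pbw_independent
  unfolding pbw_independent_def
proof (intro allI ballI impI)
  fix n y assume y: "y \<in> scomp n" "slift y \<in> JJ n"
  from iso obtain \<phi> where "graded_algebra_iso GR SG \<phi>" unfolding graded_algebra_isomorphic_def by blast
  then have \<phi>: "bij_betw (\<phi> n) (component GR n) (scomp n)"
    unfolding graded_algebra_iso_def SG_simps by blast
  let ?f = "\<lambda>y. \<phi> n (gcos n (slift y))"
  have "component GR n = (\<lambda>y. gcos n (slift y)) ` scomp n"
  proof (intro equalityI subsetI)
    fix X assume "X \<in> component GR n"
    then obtain t where t: "t \<in> fle n" "X = gcos n t" unfolding GR_component by blast
    then have "X = gcos n (slift (symb (htop n t)))" using reduction[OF t(1)] by (simp add: gcos_eq_iff)
    then show "X \<in> (\<lambda>y. gcos n (slift y)) ` scomp n" using symb_htop_mem by blast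
  qed (auto simp: GR_component slift_fle)
  then have surj: "?f ` scomp n = scomp n"
    using \<phi> unfolding bij_betw_def by (simp add: image_image)
  have "finite (scomp n)"
  proof -
    have "vec_nth ` scomp n \<subseteq> {f. \<forall>x. (x \<in> UNIV \<longrightarrow> f x \<in> {s. homog n s}) \<and> (x \<notin> UNIV \<longrightarrow> f x = 0)}"
      by (auto simp: scomp_def)
    then have "finite (vec_nth ` scomp n)"
      by (rule finite_subset) (rule finite_set_of_finite_funs[OF finite homog_finite[OF fin]])
    then show ?thesis by (rule finite_imageD) (simp add: inj_on_def vec_nth_inject)
  qed
  then have "inj_on ?f (scomp n)" by (rule eq_card_imp_inj_on) (simp add: surj)
  moreover have "?f y = ?f 0" using y(2) gcos_eq_iff[of n "slift y" "slift 0"] by (simp add: slift_additive)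
  ultimately show "y = 0" using y(1) scomp_zero by (rule inj_onD)
qed

end

section \<open>The group algebra of \<open>\<int>/p\<close> in characteristic \<open>p\<close>\<close>

text \<open>The additive group of the field with \<open>p\<close> elements is the cyclic group of order \<open>p\<close>. As exponents
  then live in the ground field, the derivation \<open>g\<^sup>j \<mapsto> j g\<^sup>j\<close> of the group algebra needs no coercion.\<close>

type_synonym 'p galg = "'p mod_ring \<Rightarrow>\<^sub>0 'p mod_ring"

abbreviation gpow :: "'p::prime_card mod_ring \<Rightarrow> 'p galg"
  where "gpow j \<equiv> single j 1"

abbreviation gconst :: "'p::prime_card mod_ring \<Rightarrow> 'p galg"
  where "gconst c \<equiv> single 0 c"

definition aug :: "'p::prime_card galg \<Rightarrow> 'p mod_ring"
  where "aug a = lin_ext (\<lambda>j c. c) a"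

definition gx :: "'p::prime_card galg"
  where "gx = gpow 1 - 1"

lemma aug_single: "aug (single j c) = c"
  unfolding aug_def by (rule lin_ext_single) simp

lemma aug_add: "aug (a + b) = aug a + aug b"
  unfolding aug_def by (rule lin_ext_add) simp_all

lemmas aug_additive = additive_facts[where f = aug, OF aug_add]

lemma gpow_of_nat: "gpow (of_nat n) = (gpow 1 :: 'p::prime_card galg) ^ n"
proof (induction n)
  case (Suc n)
  have "(gpow (of_nat (Suc n)) :: 'p galg) = gpow 1 * gpow (of_nat n)" by (simp add: mult_single)
  then show ?case by (simp only: Suc power_Suc)
qed simp

lemma CHAR_galg: "CHAR('p::prime_card galg) = CARD('p)"
proof (rule CHAR_eqI)
  have "(of_nat n :: 'p galg) = gconst (of_nat n)" for n
    by (simp only: single_of_nat)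
  then have iff: "(of_nat n :: 'p galg) = 0 \<longleftrightarrow> CARD('p) dvd n" for n
    using of_nat_eq_0_iff_char_dvd[of n, where 'a = "'p mod_ring"]
    by (metis lookup_single_eq lookup_zero semiring_char_mod_ring single_zero)
  show "of_nat CARD('p) = (0 :: 'p galg)" "of_nat n = (0 :: 'p galg) \<Longrightarrow> CARD('p) dvd n" for n
    using iff by simp_all
qed

text \<open>Freshman's dream, since \<open>g\<^sup>p = 1\<close>.\<close>

lemma gx_power_CARD: "(gx :: 'p::prime_card galg) ^ CARD('p) = 0"
proof -
  have "(gx + 1 :: 'p galg) ^ CARD('p) = gx ^ CARD('p) + 1 ^ CARD('p)"
    by (rule freshmans_dream) (simp_all add: CHAR_galg prime_card)
  moreover have "(gx + 1 :: 'p galg) ^ CARD('p) = gpow (of_nat CARD('p))"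
    unfolding gpow_of_nat by (simp add: gx_def)
  ultimately show ?thesis by simp
qed

text \<open>The augmentation ideal is generated by \<open>g - 1\<close>, because \<open>g - 1\<close> divides \<open>g\<^sup>n - 1\<close>.\<close>

lemma gx_dvd_aug: "gx dvd a - gconst (aug a)"
proof (induction a rule: poly_mapping_single_induct)
  case (single j c)
  obtain n where n: "j = of_nat n" using surj_of_nat_mod_ring[of j] by blast
  have "gx dvd gpow j - 1"
    unfolding gx_def n gpow_of_nat power_diff_1_eq by (rule dvd_triv_left)
  then have "gx dvd gconst c * (gpow j - 1)" by (rule dvd_mult)
  then show ?case by (simp add: right_diff_distrib mult_single aug_single)
next
  case (add s t)
  have "s + t - gconst (aug (s + t)) = (s - gconst (aug s)) + (t - gconst (aug t))"
    unfolding aug_add single_add by simp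
  with dvd_add[OF add] show ?case by (simp only:)
qed

text \<open>By the freshman's dream the \<open>p\<close>-th power of \<open>u\<close> is the \<open>p\<close>-th power of its augmentation, a
  nonzero scalar.\<close>

lemma aug_nonzero_unit:
  fixes u :: "'p::prime_card galg"
  assumes "aug u \<noteq> 0"
  shows "\<exists>w. u * w = 1"
proof -
  obtain a where a: "u - gconst (aug u) = gx * a" using gx_dvd_aug[of u] by (auto simp: dvd_def)
  have "(gx * a + gconst (aug u)) ^ CARD('p) = (gx * a) ^ CARD('p) + gconst (aug u) ^ CARD('p)"
    by (rule freshmans_dream) (simp_all add: CHAR_galg prime_card)
  moreover have "gx * a + gconst (aug u) = u" using a by (simp add: algebra_simps)
  ultimately have "u ^ CARD('p) = gconst (aug u) ^ CARD('p)"
    by (simp add: power_mult_distrib gx_power_CARD)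
  then have "u * (u ^ (CARD('p) - 1) * gconst (inverse (aug u)) ^ CARD('p)) =
      (gconst (aug u) * gconst (inverse (aug u))) ^ CARD('p)"
    by (simp add: power_mult_distrib mult.assoc[symmetric] flip: power_Suc)
  then show ?thesis using assms by (auto simp: mult_single)
qed

text \<open>The coefficient of \<open>g\<^sup>p\<^sup>-\<^sup>1\<close> in the binomial expansion is 1.\<close>

lemma gx_power_nonzero: "(gx :: 'p::prime_card galg) ^ (CARD('p) - 1) \<noteq> 0"
proof -
  define n where "n = CARD('p) - 1"
  have n: "n < CARD('p)" by (simp add: n_def)
  have "(gx :: 'p galg) ^ n = (\<Sum>i\<le>n. of_nat (n choose i) * gpow 1 ^ i * (- 1) ^ (n - i))"
    unfolding gx_def using binomial_ring[of "gpow 1" "- 1" n] by simp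
  also have "\<dots> = (\<Sum>i\<le>n. single (of_nat i) (of_nat (n choose i) * (- 1) ^ (n - i)))"
  proof (intro sum.cong refl)
    fix i
    have "(- 1 :: 'p galg) ^ j = gconst ((- 1) ^ j)" for j
      by (induction j) (simp_all add: single_uminus)
    then show "(of_nat (n choose i) * gpow 1 ^ i * (- 1) ^ (n - i) :: 'p galg) =
        single (of_nat i) (of_nat (n choose i) * (- 1) ^ (n - i))"
      by (simp only: gpow_of_nat[symmetric] single_of_nat[symmetric] mult_single) simp
  qed
  finally have "lookup ((gx :: 'p galg) ^ n) (of_nat n) =
      (\<Sum>i\<le>n. if i = n then 1 else 0)"
  proof (simp only: lookup_sum, intro sum.cong refl)
    fix i assume "i \<in> {..n}"
    then have "(of_nat i = (of_nat n :: 'p mod_ring)) = (i = n)"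
      using n by (auto simp: of_nat_eq_iff_cong_CHAR intro: cong_less_modulus_unique_nat)
    then show "lookup (single (of_nat i) (of_nat (n choose i) * (- 1) ^ (n - i)))
        (of_nat n :: 'p mod_ring) = (if i = n then 1 else 0)"
      by (simp add: lookup_single when_def)
  qed
  then have "lookup ((gx :: 'p galg) ^ n) (of_nat n) \<noteq> 0" by simp
  then show ?thesis unfolding n_def by (metis lookup_zero)
qed

lemma card_galg: "card (UNIV :: 'p::prime_card galg set) = CARD('p) ^ CARD('p)"
  and finite_galg: "finite (UNIV :: 'p::prime_card galg set)"
proof -
  have "bij_betw lookup (UNIV :: 'p galg set) UNIV"
    by (rule bij_betwI[where g = Abs_poly_mapping])
      (simp_all add: lookup_inverse Abs_poly_mapping_inverse)
  then show "card (UNIV :: 'p galg set) = CARD('p) ^ CARD('p)" "finite (UNIV :: 'p galg set)"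
    using bij_betw_same_card[of lookup "UNIV :: 'p galg set" UNIV]
      bij_betw_finite[of lookup "UNIV :: 'p galg set" UNIV]
    by (simp_all add: card_fun)
qed

subsection \<open>The order of an element in the augmentation filtration\<close>

definition gorder :: "'p::prime_card galg \<Rightarrow> nat \<Rightarrow> bool"
  where "gorder b k \<longleftrightarrow> k \<le> CARD('p) \<and> (\<exists>u. b = gx ^ k * u \<and> aug u \<noteq> 0)"

text \<open>As long as the cofactor has augmentation zero, another factor \<open>g - 1\<close> can be split off; if this
  never stops before \<open>p\<close> factors, then \<open>b = 0\<close>, and \<open>k = p\<close> works with cofactor 1.\<close>

lemma gorder_exists: "\<exists>k. gorder (b :: 'p::prime_card galg) k"
proof -
  have "\<exists>k. gorder b k" if "n \<le> CARD('p)" "gx ^ (CARD('p) - n) dvd b" for n and b :: "'p galg"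
    using that
  proof (induction n)
    case 0
    then have "b = gx ^ CARD('p) * 1" by (auto simp: gx_power_CARD)
    then show ?case unfolding gorder_def by (metis aug_single le_refl single_one zero_neq_one)
  next
    case (Suc n)
    then obtain u where u: "b = gx ^ (CARD('p) - Suc n) * u" by (auto simp: dvd_def)
    show ?case
    proof (cases "aug u = 0")
      case True
      with gx_dvd_aug[of u] have "gx dvd u" by simp
      then have "gx ^ Suc (CARD('p) - Suc n) dvd b" by (simp add: u mult_dvd_mono mult.commute)
      with Suc show ?thesis by (simp add: Suc_diff_Suc)
    next
      case False
      with u show ?thesis unfolding gorder_def by (intro exI[of _ "CARD('p) - Suc n"]) auto
    qed
  qed
  from this[of "CARD('p)"] show ?thesis by simp
qed

lemma gorder_dvd_iff:
  assumes "gorder b k" "i \<le> CARD('p)"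
  shows "gx ^ i dvd (b :: 'p::prime_card galg) \<longleftrightarrow> i \<le> k"
proof
  from assms obtain u where u: "b = gx ^ k * u" "aug u \<noteq> 0" and k: "k \<le> CARD('p)"
    by (auto simp: gorder_def)
  show "i \<le> k" if "gx ^ i dvd b"
  proof (rule ccontr)
    assume "\<not> i \<le> k"
    with assms have le: "k + (CARD('p) - i) \<le> CARD('p) - 1" by simp
    obtain w where w: "u * w = 1" using aug_nonzero_unit[OF u(2)] by blast
    have "gx ^ i * gx ^ (CARD('p) - i) dvd b * gx ^ (CARD('p) - i)"
      using that by (intro mult_dvd_mono) auto
    then have "b * gx ^ (CARD('p) - i) = 0"
      using assms(2) by (simp add: gx_power_CARD flip: power_add)
    then have "gx ^ (k + (CARD('p) - i)) * u = 0"
      by (simp add: u power_add mult_ac)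
    then have "gx ^ (k + (CARD('p) - i)) * (u * w) = 0" by (simp add: mult.assoc[symmetric])
    then have "(gx :: 'p galg) ^ (k + (CARD('p) - i)) = 0" by (simp add: w)
    moreover have "(gx :: 'p galg) ^ (k + (CARD('p) - i)) dvd gx ^ (CARD('p) - 1)"
      by (rule le_imp_power_dvd[OF le])
    ultimately show False using gx_power_nonzero[where 'p = 'p] by simp
  qed
  show "gx ^ i dvd b" if "i \<le> k"
    unfolding u by (rule dvd_mult2) (rule le_imp_power_dvd[OF that])
qed

lemma gorder_unique: "gorder b k \<Longrightarrow> gorder b l \<Longrightarrow> k = l"
  using gorder_dvd_iff[of b k k] gorder_dvd_iff[of b l k] gorder_dvd_iff[of b k l] gorder_dvd_iff[of b l l]
  by (auto simp: gorder_def)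

text \<open>Up to units both factors are powers of \<open>g - 1\<close>, and such a power vanishes only from the
  exponent \<open>p\<close> on.\<close>

lemma gorder_annihilator:
  fixes b z :: "'p::prime_card galg"
  assumes b: "gorder b k"
  shows "b * z = 0 \<longleftrightarrow> gx ^ (CARD('p) - k) dvd z"
proof
  from b obtain u where u: "b = gx ^ k * u" "aug u \<noteq> 0" and k: "k \<le> CARD('p)"
    by (auto simp: gorder_def)
  obtain w where w: "u * w = 1" using aug_nonzero_unit[OF u(2)] by blast
  show "b * z = 0" if "gx ^ (CARD('p) - k) dvd z"
  proof -
    have "gx ^ k * gx ^ (CARD('p) - k) dvd b * z"
      using that by (intro mult_dvd_mono) (auto simp: u)
    then show ?thesis using k by (simp add: gx_power_CARD flip: power_add)
  qed
  show "gx ^ (CARD('p) - k) dvd z" if "b * z = 0"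
  proof -
    obtain l where l: "gorder z l" using gorder_exists by blast
    then obtain v where v: "z = gx ^ l * v" "aug v \<noteq> 0" by (auto simp: gorder_def)
    obtain v' where v': "v * v' = 1" using aug_nonzero_unit[OF v(2)] by blast
    have "gx ^ (k + l) * ((u * w) * (v * v')) = b * z * (w * v')"
      by (simp add: u v power_add mult_ac)
    then have "(gx :: 'p galg) ^ (k + l) = 0" by (simp add: that w v')
    then have "CARD('p) \<le> k + l"
      using gx_power_nonzero[where 'p = 'p] le_imp_power_dvd[of "k + l" "CARD('p) - 1" "gx :: 'p galg"]
      by (metis Suc_pred' dvd_0_left_iff less_Suc_eq_le linorder_not_le zero_less_card_finite)
    with l show ?thesis by (subst gorder_dvd_iff[OF l]) auto
  qed
qed

subsection \<open>A basis of the annihilators\<close>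

text \<open>The element \<open>1 - g\<^sup>-\<^sup>1\<close> is associated to \<open>g - 1\<close>. Its powers have the coefficients that
  appear in \<open>\<mu>\<close>.\<close>

definition gy :: "'p::prime_card galg"
  where "gy = 1 - gpow (- 1)"

lemma gy_gx: "gy = gpow (- 1) * gx" "gx = gpow 1 * gy"
  by (simp_all add: gx_def gy_def algebra_simps mult_single)

lemma gy_power_dvd_iff: "gy ^ n dvd z \<longleftrightarrow> gx ^ n dvd z"
proof -
  have "gy ^ n dvd gx ^ n"
    unfolding gy_gx(2) power_mult_distrib by (rule dvd_triv_right)
  moreover have "gx ^ n dvd gy ^ n"
    unfolding gy_gx(1) power_mult_distrib by (rule dvd_triv_right)
  ultimately show ?thesis by (blast intro: dvd_trans)
qed

lemma gy_power_nonzero: "(gy :: 'p::prime_card galg) ^ (CARD('p) - 1) \<noteq> 0"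
  using gx_power_nonzero[where 'p = 'p] gy_power_dvd_iff[of "CARD('p) - 1" "gx ^ (CARD('p) - 1) :: 'p galg"]
  by auto

lemma gy_power_CARD: "(gy :: 'p::prime_card galg) ^ CARD('p) = 0"
  unfolding gy_gx(1) by (simp add: power_mult_distrib gx_power_CARD)

definition ann_comb :: "'p::prime_card mod_ring list \<Rightarrow> 'p galg"
  where "ann_comb d = (\<Sum>m = 1..length d. gconst ((-1) ^ (m + 1) * d ! (m - 1)) * gy ^ (CARD('p) - m))"

lemma ann_comb_snoc:
  "ann_comb (d @ [e]) = ann_comb d +
    gconst ((-1) ^ length d * e) * (gy :: 'p::prime_card galg) ^ (CARD('p) - Suc (length d))"
proof -
  have "(\<Sum>m = 1..length d. gconst ((-1) ^ (m + 1) * (d @ [e]) ! (m - 1)) * gy ^ (CARD('p) - m)) = ann_comb d"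
    unfolding ann_comb_def by (intro sum.cong refl) (auto simp: nth_append)
  then show ?thesis unfolding ann_comb_def by (simp add: nth_append)
qed

text \<open>Modulo the next higher power of \<open>1 - g\<^sup>-\<^sup>1\<close> a cofactor can be replaced by its augmentation,
  which is the coordinate \<open>d\<^sub>k\<close> up to sign.\<close>

lemma ann_comb_range:
  fixes z :: "'p::prime_card galg"
  assumes "k \<le> CARD('p)"
  shows "gx ^ (CARD('p) - k) dvd z \<longleftrightarrow> (\<exists>d. length d = k \<and> ann_comb d = z)"
  using assms
proof (induction k arbitrary: z)
  case 0
  then show ?case by (auto simp: gx_power_CARD ann_comb_def)
next
  case (Suc k)
  let ?n = "CARD('p) - Suc k"
  have n: "CARD('p) - k = Suc ?n" using Suc.prems by simp
  show ?case
  proof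
    assume "gx ^ ?n dvd z"
    then obtain a where a: "z = gy ^ ?n * a" unfolding gy_power_dvd_iff[symmetric] by (rule dvdE)
    have "gy ^ 1 dvd a - gconst (aug a)" unfolding gy_power_dvd_iff using gx_dvd_aug[of a] by simp
    then have "gy ^ ?n * gy ^ 1 dvd gy ^ ?n * (a - gconst (aug a))" by (intro mult_dvd_mono) auto
    then have "gx ^ (CARD('p) - k) dvd z - gconst (aug a) * gy ^ ?n"
      unfolding n gy_power_dvd_iff[symmetric] by (simp add: a left_diff_distrib mult.commute)
    then obtain d where d: "length d = k" "ann_comb d = z - gconst (aug a) * gy ^ ?n"
      using Suc.IH[THEN iffD1] Suc.prems by (meson Suc_leD)
    have "ann_comb (d @ [(-1) ^ k * aug a]) = z"
      using d by (cases "even k") (simp_all add: ann_comb_snoc)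
    with d show "\<exists>d. length d = Suc k \<and> ann_comb d = z"
      by (intro exI[of _ "d @ [(-1) ^ k * aug a]"]) simp
  next
    assume "\<exists>d. length d = Suc k \<and> ann_comb d = z"
    then obtain c where c: "length c = Suc k" "ann_comb c = z" by blast
    then obtain e d where "c = d @ [e]" "length d = k" unfolding length_Suc_conv_rev by blast
    with c have d: "length d = k" "ann_comb (d @ [e]) = z" by simp_all
    have "gx ^ (CARD('p) - k) dvd ann_comb d"
      using Suc.prems d(1) by (intro Suc.IH[THEN iffD2]) auto
    then have "gy ^ ?n dvd ann_comb d"
      unfolding n gy_power_dvd_iff by (auto elim: dvd_trans[rotated])
    then have "gy ^ ?n dvd z"
      unfolding d(2)[symmetric] ann_comb_snoc d(1) by (intro dvd_add dvd_triv_right)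
    then show "gx ^ ?n dvd z" by (simp add: gy_power_dvd_iff)
  qed
qed

text \<open>Multiplication by the \<open>(k - 1)\<close>-st power of \<open>1 - g\<^sup>-\<^sup>1\<close> kills all terms but the last one.\<close>

lemma ann_comb_inj:
  assumes "length d = length d'" "length d \<le> CARD('p)" "ann_comb d = (ann_comb d' :: 'p::prime_card galg)"
  shows "d = d'"
  using assms
proof (induction d arbitrary: d' rule: rev_induct)
  case (snoc e d)
  then obtain d2 e2 where d': "d' = d2 @ [e2]" and l: "length d2 = length d"
    by (metis length_Suc_conv_rev length_append_singleton nat.inject)
  let ?k = "length d"
  let ?n = "CARD('p) - Suc ?k"
  have k: "Suc ?k \<le> CARD('p)" using snoc.prems by simp
  have kill: "ann_comb c * gy ^ ?k = 0" if c: "length c = ?k" for c :: "'p mod_ring list"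
  proof -
    have "gy ^ (CARD('p) - ?k) dvd ann_comb c"
      unfolding gy_power_dvd_iff using ann_comb_range[of ?k "ann_comb c"] k c by auto
    then have "gy ^ (CARD('p) - ?k) * gy ^ ?k dvd ann_comb c * gy ^ ?k" by (intro mult_dvd_mono) auto
    then show ?thesis using k by (simp add: gy_power_CARD flip: power_add)
  qed
  have "ann_comb (d @ [e]) * gy ^ ?k = ann_comb (d2 @ [e2]) * gy ^ ?k"
    using snoc.prems d' by simp
  then have "gconst ((-1) ^ ?k * e) * gy ^ (?n + ?k) = gconst ((-1) ^ ?k * e2) * gy ^ (?n + ?k)"
    by (simp add: ann_comb_snoc distrib_right kill l mult.assoc power_add)
  moreover have "?n + ?k = CARD('p) - 1" using k by simp
  ultimately have "gconst ((-1) ^ ?k * (e - e2)) * gy ^ (CARD('p) - 1) = 0"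
    by (simp add: right_diff_distrib single_diff left_diff_distrib)
  then have "gconst (inverse ((-1) ^ ?k * (e - e2))) * gconst ((-1) ^ ?k * (e - e2)) * gy ^ (CARD('p) - 1) = 0"
    by (simp only: mult.assoc mult_zero_right)
  then have "e = e2"
    using gy_power_nonzero[where 'p = 'p] by (cases "e = e2") (simp_all add: mult_single del: inverse_mult_distrib)
  moreover from this have "d = d2"
    using snoc.prems d' l by (intro snoc.IH) (simp_all add: ann_comb_snoc)
  ultimately show ?case by (simp add: d')
qed simp

lemma card_gx_power_dvd:
  assumes "k \<le> CARD('p)"
  shows "card {z :: 'p::prime_card galg. gx ^ (CARD('p) - k) dvd z} = CARD('p) ^ k"
proof -
  have "{z :: 'p galg. gx ^ (CARD('p) - k) dvd z} = ann_comb ` {d. length d = k}"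
    using ann_comb_range[OF assms] by auto
  moreover have "inj_on ann_comb {d :: 'p mod_ring list. length d = k}"
    using assms by (auto simp: inj_on_def intro: ann_comb_inj)
  moreover have "card {d :: 'p mod_ring list. length d = k} = CARD('p) ^ k"
    using card_lists_length_eq[of "UNIV :: 'p mod_ring set" k] by simp
  ultimately show ?thesis by (simp add: card_image)
qed

text \<open>The inverse powers wrap around: \<open>g\<^sup>-\<^sup>i\<close> contributes to the coefficient of \<open>g\<^sup>j\<close> for \<open>j > 0\<close> iff
  \<open>i = p - j\<close>, and no binomial term with \<open>i = p\<close> interferes at \<open>j = 0\<close> as \<open>n < p\<close>.\<close>

lemma lookup_gy_power:
  assumes "n < CARD('p)" "j < CARD('p)"
  shows "lookup ((gy :: 'p::prime_card galg) ^ n) (of_nat j) =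
    (if j = 0 then 1 else (-1) ^ (CARD('p) - j) * of_nat (n choose (CARD('p) - j)))"
proof -
  define r where "r = (if j = 0 then 0 else CARD('p) - j)"
  have neg: "(- gpow (- 1) :: 'p galg) ^ i = single (- of_nat i) ((-1) ^ i)" for i
    by (induction i) (simp_all add: mult_single single_uminus)
  have "(gy :: 'p galg) ^ n = (\<Sum>i\<le>n. of_nat (n choose i) * (- gpow (- 1)) ^ i)"
    unfolding gy_def using binomial_ring[of "- gpow (- 1) :: 'p galg" 1 n] by simp
  also have "\<dots> = (\<Sum>i\<le>n. single (- of_nat i) ((-1) ^ i * of_nat (n choose i)))"
    by (intro sum.cong refl) (simp only: neg mult_single mult.commute add_0 flip: single_of_nat)
  finally have "lookup ((gy :: 'p galg) ^ n) (of_nat j) =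
      (\<Sum>i\<le>n. if i = r then (-1) ^ r * of_nat (n choose r) else 0)"
  proof (simp only: lookup_sum, intro sum.cong refl)
    fix i assume i: "i \<in> {..n}"
    have "(- of_nat i = (of_nat j :: 'p mod_ring)) = (of_nat (i + j) = (of_nat 0 :: 'p mod_ring))"
      using add_eq_0_iff[of "of_nat i :: 'p mod_ring" "of_nat j"] by (auto simp only: of_nat_add of_nat_0)
    also have "\<dots> = (CARD('p) dvd i + j)"
      by (simp only: of_nat_0 of_nat_eq_0_iff_char_dvd semiring_char_mod_ring)
    also have "\<dots> = (i = r)"
    proof
      assume "CARD('p) dvd i + j"
      then obtain q where "i + j = CARD('p) * q" by (auto simp: dvd_def)
      moreover have "i + j < CARD('p) * 2" using i assms by auto
      ultimately have "q = 0 \<or> q = 1" by (cases q) auto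
      with \<open>i + j = CARD('p) * q\<close> show "i = r" using i assms by (auto simp: r_def)
    qed (use assms in \<open>auto simp: r_def\<close>)
    finally show "lookup (single (- of_nat i) ((-1) ^ i * of_nat (n choose i)))
        (of_nat j :: 'p mod_ring) = (if i = r then (-1) ^ r * of_nat (n choose r) else 0)"
      by (simp add: lookup_single when_def)
  qed
  also have "\<dots> = (-1) ^ r * of_nat (n choose r)" by (simp add: binomial_eq_0)
  finally show ?thesis by (simp add: r_def)
qed

lemma lookup_gconst_mult: "lookup (gconst c * a) j = c * lookup a j"
  by (induction a rule: poly_mapping_single_induct)
    (simp_all add: mult_single distrib_left lookup_add lookup_single when_def)

text \<open>The constant coefficient is exceptional because the formula for \<open>\<mu>(d, 0)\<close> gives 0; it is the
  coefficient of \<open>v\<^sub>1\<close> in \<open>\<kappa>(v\<^sub>1, v\<^sub>2)\<close> that carries it.\<close>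

lemma lookup_ann_comb:
  fixes d :: "'p::prime_card mod_ring list"
  assumes "j < CARD('p)" "length d \<le> CARD('p)"
  shows "lookup (ann_comb d) (of_nat j) =
    (if j = 0 then \<Sum>m = 1..length d. (-1) ^ (m + 1) * d ! (m - 1) else mu d j)"
proof -
  have "lookup (ann_comb d) (of_nat j) =
      (\<Sum>m = 1..length d. ((-1) ^ (m + 1) * d ! (m - 1)) *
        (if j = 0 then 1 else (-1) ^ (CARD('p) - j) * of_nat ((CARD('p) - m) choose (CARD('p) - j))))"
    unfolding ann_comb_def lookup_sum lookup_gconst_mult using assms
    by (intro sum.cong refl) (simp add: lookup_gy_power)
  also have "\<dots> = (if j = 0 then \<Sum>m = 1..length d. (-1) ^ (m + 1) * d ! (m - 1) else mu d j)"
    by (simp add: mu_def sum_distrib_left mult_ac)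
  finally show ?thesis .
qed

subsection \<open>Counting pairs with product zero\<close>

text \<open>The annihilator of an element of order \<open>k\<close> has \<open>p\<^sup>k\<close> elements, and \<open>p\<^sup>p\<^sup>-\<^sup>i\<close> elements have order at
  least \<open>i\<close>. So each order \<open>i < p\<close> contributes \<open>p\<^sup>p - p\<^sup>p\<^sup>-\<^sup>1\<close> pairs, and the element 0, of order
  \<open>p\<close>, contributes \<open>p\<^sup>p\<close>.\<close>

lemma card_zero_products:
  "card {(b, z :: 'p::prime_card galg). b * z = 0} = CARD('p) ^ (CARD('p) + 1)"
proof -
  let ?p = "CARD('p)"
  define ord :: "'p galg \<Rightarrow> nat" where "ord b = (THE k. gorder b k)" for b
  have ord: "gorder b (ord b)" for b
    unfolding ord_def using gorder_exists gorder_unique by (metis theI)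
  have ord_le: "ord b \<le> ?p" for b using ord[of b] by (simp add: gorder_def)
  have card_le: "card {b. i \<le> ord b} = ?p ^ (?p - i)" if "i \<le> ?p" for i
  proof -
    have "{b. i \<le> ord b} = {b :: 'p galg. gx ^ (?p - (?p - i)) dvd b}"
      using gorder_dvd_iff[OF ord that] that by auto
    then show ?thesis using card_gx_power_dvd[of "?p - i", where 'p = 'p] by simp
  qed
  \<comment> \<open>In the reals, so that differences of cardinalities can be multiplied out.\<close>
  have card_ord: "real (card {b. ord b = i}) = real (?p ^ (?p - i)) - (if i < ?p then real (?p ^ (?p - Suc i)) else 0)"
    if "i \<le> ?p" for i
  proof (cases "i < ?p")
    case True
    have "{b. ord b = i} = {b. i \<le> ord b} - {b. Suc i \<le> ord b}" by auto
    then have "card {b. ord b = i} = card {b. i \<le> ord b} - card {b. Suc i \<le> ord b}"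
      by (simp add: card_Diff_subset finite_subset[OF _ finite_galg] subset_iff)
    moreover have "card {b. Suc i \<le> ord b} \<le> card {b. i \<le> ord b}"
      by (intro card_mono finite_subset[OF _ finite_galg]) auto
    ultimately show ?thesis using True card_le by (simp add: of_nat_diff)
  next
    case False
    with that ord_le have "{b. ord b = i} = {b. i \<le> ord b}" by (auto intro: antisym)
    with False that show ?thesis using card_le by simp
  qed
  have pp: "0 < ?p" by simp
  have "{(b, z :: 'p galg). b * z = 0} = (SIGMA b:UNIV. {z. b * z = 0})" by auto
  then have "card {(b, z :: 'p galg). b * z = 0} = (\<Sum>b\<in>UNIV. card {z :: 'p galg. b * z = 0})"
    by (simp add: card_SigmaI finite_galg finite_subset[OF _ finite_galg])
  also have "\<dots> = (\<Sum>b\<in>UNIV. ?p ^ ord (b :: 'p galg))"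
    using gorder_annihilator[OF ord] card_gx_power_dvd[OF ord_le] by simp
  also have "\<dots> = (\<Sum>i\<le>?p. \<Sum>b\<in>{b. ord b = i}. ?p ^ ord (b :: 'p galg))"
    using sum.group[of "UNIV :: 'p galg set" "{..?p}" ord "\<lambda>b. ?p ^ ord b"] finite_galg[where 'p = 'p] ord_le
    by (simp add: image_subset_iff)
  also have "\<dots> = (\<Sum>i\<le>?p. card {b :: 'p galg. ord b = i} * ?p ^ i)"
    by (intro sum.cong refl) simp
  finally have "real (card {(b, z :: 'p galg). b * z = 0}) =
      (\<Sum>i\<le>?p. real (card {b :: 'p galg. ord b = i}) * real ?p ^ i)" by simp
  also have "\<dots> = (\<Sum>i\<le>?p. if i < ?p then real ?p ^ ?p - real ?p ^ (?p - 1) else real ?p ^ ?p)"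
  proof (intro sum.cong refl)
    fix i assume "i \<in> {..?p}"
    then have i: "i \<le> ?p" by simp
    have "real ?p ^ (?p - i) * real ?p ^ i = real ?p ^ ?p" using i by (simp flip: power_add)
    moreover have "real ?p ^ (?p - Suc i) * real ?p ^ i = real ?p ^ (?p - 1)" if "i < ?p"
      using that by (simp flip: power_add)
    ultimately show "real (card {b :: 'p galg. ord b = i}) * real ?p ^ i =
        (if i < ?p then real ?p ^ ?p - real ?p ^ (?p - 1) else real ?p ^ ?p)"
      unfolding card_ord[OF i] by (simp add: left_diff_distrib)
  qed
  also have "\<dots> = real ?p * (real ?p ^ ?p - real ?p ^ (?p - 1)) + real ?p ^ ?p"
    by (simp add: lessThan_Suc_atMost[symmetric])
  also have "\<dots> = real ?p ^ (?p + 1)"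
    using pp by (simp add: right_diff_distrib flip: power_Suc)
  finally show ?thesis by (simp only: of_nat_eq_iff flip: of_nat_power)
qed

section \<open>A module that realises the relations\<close>

text \<open>On the group algebra, \<open>E\<close> below is the map \<open>g\<^sup>j \<mapsto> (j choose 2) g\<^sup>j\<close>. The same axioms hold after
  adjoining variables, so the computation with operators can be done in one abstract ring.\<close>

locale half_derivation =
  fixes D :: "'a::comm_ring_1 \<Rightarrow> 'a" and hf :: 'a
  assumes D_add: "D (x + y) = D x + D y"
    and D_mult: "D (x * y) = D x * y + x * D y"
    and half: "hf + hf = 1"
begin

definition E :: "'a \<Rightarrow> 'a"
  where "E x = hf * (D (D x) - D x)"

lemmas D_additive = additive_facts[where f = D, OF D_add]

lemma D_one: "D 1 = 0"
  using D_mult[of 1 1] by simp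

lemma D_half: "D hf = 0"
proof -
  have "D hf + D hf = 0" using D_add[of hf hf] by (simp add: half D_one)
  then have "hf * (D hf + D hf) = 0" by simp
  then have "(hf + hf) * D hf = 0" by (simp add: algebra_simps)
  then show ?thesis by (simp add: half)
qed

lemma E_add: "E (x + y) = E x + E y"
  by (simp add: E_def D_add algebra_simps)

lemma D_E: "D (E x) = E (D x)"
  by (simp add: E_def D_mult D_additive D_half)

lemma E_mult: "E (x * y) = E x * y + x * E y + D x * D y"
proof -
  have "E (x * y) = hf * (D (D x) - D x) * y + x * (hf * (D (D y) - D y)) + (hf + hf) * (D x * D y)"
    by (simp add: E_def D_add D_mult algebra_simps)
  then show ?thesis by (simp add: E_def half)
qed

lemma D_D: "D (D x) = E x + E x + D x"
proof -
  have "E x + E x = (hf + hf) * (D (D x) - D x)" by (simp add: E_def distrib_right)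
  then show ?thesis by (simp add: half)
qed

text \<open>The map \<open>X1\<close> is right multiplication by \<open>v = v\<^sub>1\<close> and \<open>X2\<close> is right multiplication by \<open>v\<^sub>2\<close>, on
  polynomials with the group algebra on the right. The map \<open>Th\<close> is the part of \<open>X2\<close>
  that is linear over the group algebra; its commutation rule with \<open>v\<close> is the commutator relation
  when applied to \<open>m\<close> with \<open>D m = 0\<close>. For general arguments the two sides differ by the
  left-hand side of \<open>cond\<close> times \<open>D m\<close>.\<close>

lemma commutator_relation:
  fixes Th :: "'a \<Rightarrow> 'a"
  assumes Th_add: "\<And>m n. Th (m + n) = Th m + Th n"
    and Th_b: "\<And>m. Th (b * m) = b * Th m"
    and Th_v: "\<And>m. Th (v * m) = (v + D b) * Th m + b * D (Th m) - b * Th (D m) + (k + v * a) * m"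
    and v: "D v = 0"
    and cond: "b * (a + D c - D b - E b) = 0"
  defines "X1 \<equiv> \<lambda>m. v * m + b * D m"
    and "X2 \<equiv> \<lambda>m. Th m + (v + c) * D m + b * E m"
  shows "X2 (X1 m) - X1 (X2 m) = k * m + a * X1 m + D b * X2 m"
proof -
  have "E v = 0" by (simp add: E_def v D_additive)
  have ThX1: "Th (v * m + b * D m) = (v + D b) * Th m + b * D (Th m) + (k + v * a) * m"
    by (simp add: Th_add Th_b Th_v)
  have DX1: "D (v * m + b * D m) = v * D m + D b * D m + b * D (D m)"
    by (simp add: D_add D_mult v)
  have EX1: "E (v * m + b * D m) = v * E m + E b * D m + b * E (D m) + D b * D (D m)"
    by (simp add: E_add E_mult v \<open>E v = 0\<close>)
  have DX2: "D (Th m + (v + c) * D m + b * E m) =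
      D (Th m) + D c * D m + (v + c) * D (D m) + D b * E m + b * E (D m)"
    by (simp add: D_add D_mult v D_E)
  have "X2 (X1 m) - X1 (X2 m) - (k * m + a * X1 m + D b * X2 m) = - (b * (a + D c - D b - E b) * D m)"
    unfolding X1_def X2_def ThX1 DX1 EX1 DX2 D_D by (simp add: algebra_simps)
  then show ?thesis by (simp add: cond)
qed

end

subsection \<open>Derivations extend to polynomials\<close>

lemma map_poly_derivation:
  fixes D :: "'a::comm_ring_1 \<Rightarrow> 'a"
  assumes add: "\<And>x y. D (x + y) = D x + D y" and mult: "\<And>x y. D (x * y) = D x * y + x * D y"
  shows "map_poly D (p + q) = map_poly D p + map_poly D q"
    and "map_poly D (p * q) = map_poly D p * q + p * map_poly D q"
proof -
  note D = additive_facts[where f = D, OF add]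
  show "map_poly D (p + q) = map_poly D p + map_poly D q"
    by (rule poly_eqI) (simp add: coeff_map_poly D add)
  show "map_poly D (p * q) = map_poly D p * q + p * map_poly D q"
    by (rule poly_eqI) (simp add: coeff_map_poly D coeff_mult mult sum.distrib)
qed

lemma map_poly_map_poly_derivation:
  assumes "half_derivation D hf"
  shows "half_derivation (map_poly D) [:hf:]"
proof -
  interpret half_derivation D hf by fact
  show ?thesis
    by standard (simp_all add: map_poly_derivation[of D] D_add D_mult half one_pCons)
qed

lemma poly_monom_induct [case_names monom add]:
  assumes "\<And>a i. P (Polynomial.monom a i)" "\<And>p q. P p \<Longrightarrow> P q \<Longrightarrow> P (p + q)"
  shows "P p"
proof -
  have "P (\<Sum>i\<le>n. Polynomial.monom (f i) i)" for n f
    by (induction n) (simp_all add: assms)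
  from this[of "poly.coeff p" "degree p"] show ?thesis by (simp add: poly_as_sum_of_monoms)
qed

subsection \<open>Total degree of polynomials in two variables\<close>

definition deg_less :: "nat \<Rightarrow> 'a::comm_ring_1 poly poly \<Rightarrow> bool"
  where "deg_less n Q \<longleftrightarrow> (\<forall>i j. n \<le> i + j \<longrightarrow> poly.coeff (poly.coeff Q i) j = 0)"

text \<open>Coefficients and the two variables, in the ring of polynomials in \<open>V1\<close> over the polynomials in
  \<open>V2\<close>.\<close>

definition cc :: "'a::comm_ring_1 \<Rightarrow> 'a poly poly" where "cc x = [:[:x:]:]"
definition V1 :: "'a::comm_ring_1 poly poly" where "V1 = [:0, 1:]"
definition V2 :: "'a::comm_ring_1 poly poly" where "V2 = [:[:0, 1:]:]"

lemma cc_hom: "comm_ring_hom cc"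
  by standard (simp_all add: cc_def one_pCons)

interpretation cc: comm_ring_hom cc by (rule cc_hom)

lemma cc_0: "cc 0 = 0" and cc_1: "cc 1 = 1" and cc_add: "cc (x + y) = cc x + cc y"
  and cc_mult: "cc (x * y) = cc x * cc y" and cc_diff: "cc (x - y) = cc x - cc y" and cc_minus: "cc (- x) = - cc x"
  by (simp_all add: cc_def one_pCons)

lemma deg_less_add: "deg_less n p \<Longrightarrow> deg_less n q \<Longrightarrow> deg_less n (p + q)"
  and deg_less_diff: "deg_less n p \<Longrightarrow> deg_less n q \<Longrightarrow> deg_less n (p - q)"
  and deg_less_mono: "deg_less m p \<Longrightarrow> m \<le> n \<Longrightarrow> deg_less n p"
  and deg_less_zero: "deg_less n 0"
  by (auto simp: deg_less_def)

lemma deg_less_sum: "(\<And>i. i \<in> I \<Longrightarrow> deg_less n (f i)) \<Longrightarrow> deg_less n (sum f I)"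
  by (induction I rule: infinite_finite_induct) (auto intro: deg_less_add deg_less_zero)

lemma deg_less_mult:
  assumes "deg_less (Suc m) p" "deg_less n q"
  shows "deg_less (m + n) (p * q)"
  unfolding deg_less_def
proof (intro allI impI)
  fix i j assume "m + n \<le> i + j"
  then have "poly.coeff (poly.coeff p i') j' * poly.coeff (poly.coeff q (i - i')) (j - j') = 0"
    if "i' \<le> i" "j' \<le> j" for i' j'
  proof (cases "Suc m \<le> i' + j'")
    case False
    then have "n \<le> i - i' + (j - j')" using that \<open>m + n \<le> i + j\<close> by linarith
    with assms(2) show ?thesis by (simp add: deg_less_def)
  qed (use assms(1) in \<open>simp add: deg_less_def\<close>)
  then show "poly.coeff (poly.coeff (p * q) i) j = 0"
    by (simp add: coeff_mult coeff_sum)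
qed

lemma deg_less_cc: "deg_less (Suc 0) (cc x)"
  and deg_less_V1: "deg_less (Suc 1) V1"
  and deg_less_V2: "deg_less (Suc 1) V2"
  by (auto simp: deg_less_def cc_def V1_def V2_def coeff_pCons split: nat.splits)

lemmas deg_less_cc_mult = deg_less_mult[OF deg_less_cc, simplified]
lemmas deg_less_V1_mult = deg_less_mult[OF deg_less_V1, simplified]
lemmas deg_less_V2_mult = deg_less_mult[OF deg_less_V2, simplified]

subsection \<open>The operators\<close>

text \<open>The variables \<open>V1\<close> and \<open>V2\<close> stand for \<open>v\<^sub>1\<close> and \<open>v\<^sub>2\<close>; a monomial \<open>V2\<^sup>j V1\<^sup>i x\<close> with \<open>x\<close> in the coefficient
  ring stands for the product in this order, so that right multiplication by \<open>v\<^sub>1\<close> only has to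
  pass the coefficient.\<close>

locale drinfeld_data = half_derivation D hf for D :: "'a::comm_ring_1 \<Rightarrow> 'a" and hf +
  fixes b c a k :: 'a
  assumes cond: "b * (a + D c - D b - E b) = 0"
begin

abbreviation DP :: "'a poly poly \<Rightarrow> 'a poly poly" where "DP \<equiv> map_poly (map_poly D)"

sublocale P: half_derivation DP "cc hf"
  unfolding cc_def by (intro map_poly_map_poly_derivation half_derivation_axioms)

lemma DP_const: "DP [:q:] = [:map_poly D q:]"
  and DP_cc: "DP (cc x) = cc (D x)"
  and DP_V1: "DP V1 = 0"
  and DP_V2: "DP V2 = 0"
  by (auto intro!: poly_eqI simp: cc_def V1_def V2_def coeff_map_poly coeff_pCons D_additive D_one
      split: nat.splits)

lemma EP_cc: "P.E (cc x) = cc (E x)"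
  by (simp add: P.E_def E_def DP_cc cc_mult cc_diff)

lemma deg_less_DP: "deg_less n Q \<Longrightarrow> deg_less n (DP Q)"
  by (simp add: deg_less_def coeff_map_poly D_additive)

text \<open>\<open>T i\<close> is the product \<open>v\<^sub>1\<^sup>i v\<^sub>2\<close> in normal order. The recursion replaces the last \<open>v\<^sub>1 v\<^sub>2\<close> by
  \<open>v\<^sub>2 v\<^sub>1 + k + v\<^sub>1 a + v\<^sub>2 (D b)\<close>.\<close>

fun T :: "nat \<Rightarrow> 'a poly poly" where
  "T 0 = V2"
| "T (Suc i) = (V1 + cc (D b)) * T i + cc b * DP (T i) + (cc k + V1 * cc a) * V1 ^ i"

lemma T_leading: "deg_less (Suc i) (T i - V2 * V1 ^ i)"
proof (induction i)
  case 0
  show ?case by (simp add: deg_less_zero)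
next
  case (Suc i)
  have V1_pow: "deg_less (Suc i) (V1 ^ i :: 'a poly poly)" for i
  proof (induction i)
    case 0
    show ?case using deg_less_cc[of "1::'a"] by (simp add: cc_1)
  next
    case (Suc i)
    then show ?case unfolding power_Suc by (rule deg_less_V1_mult)
  qed
  have T: "deg_less (Suc (Suc i)) (T i)"
  proof -
    have "T i = (T i - V2 * V1 ^ i) + V2 * V1 ^ i" by simp
    also have "deg_less (Suc (Suc i)) \<dots>"
      by (intro deg_less_add deg_less_V2_mult V1_pow deg_less_mono[OF Suc]) simp
    finally show ?thesis .
  qed
  have "T (Suc i) - V2 * V1 ^ Suc i = V1 * (T i - V2 * V1 ^ i) + cc (D b) * T i + cc b * DP (T i)
      + cc k * V1 ^ i + V1 * (cc a * V1 ^ i)"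
    by (simp add: algebra_simps)
  also have "deg_less (Suc (Suc i)) \<dots>"
    by (intro deg_less_add deg_less_V1_mult deg_less_cc_mult deg_less_DP T Suc V1_pow
        deg_less_mono[OF V1_pow[of i]]) simp
  finally show ?case .
qed

text \<open>The extension of \<open>T\<close> that is linear over the coefficients and over \<open>V2\<close>.\<close>

definition Th :: "'a poly poly \<Rightarrow> 'a poly poly"
  where "Th Q = (\<Sum>i\<le>degree Q. Polynomial.smult (poly.coeff Q i) (T i))"

lemma Th_bound: "degree Q \<le> n \<Longrightarrow> Th Q = (\<Sum>i\<le>n. Polynomial.smult (poly.coeff Q i) (T i))"
  unfolding Th_def by (intro sum.mono_neutral_left) (auto simp: coeff_eq_0)

lemma Th_add: "Th (p + q) = Th p + Th q"
proof -
  let ?n = "max (degree p) (degree q)"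
  have "degree (p + q) \<le> ?n" by (rule degree_add_le_max)
  then show ?thesis
    by (simp add: Th_bound[of _ ?n] smult_add_left sum.distrib)
qed

lemma Th_monom: "Th (Polynomial.monom q i) = [:q:] * T i"
proof -
  have "Th (Polynomial.monom q i) = (\<Sum>j\<le>i. Polynomial.smult (poly.coeff (Polynomial.monom q i) j) (T j))"
    by (rule Th_bound) (rule degree_monom_le)
  also have "\<dots> = (\<Sum>j\<le>i. if j = i then Polynomial.smult q (T i) else 0)"
    by (intro sum.cong) auto
  finally show ?thesis by simp
qed

lemma Th_cc_mult: "Th (cc x * m) = cc x * Th m"
  by (induction m rule: poly_monom_induct)
    (simp_all add: cc_def Th_add Th_monom smult_monom smult_add_right)

text \<open>On a monomial without coefficient this is the recursion for \<open>T\<close>; the term with \<open>Th (DP m)\<close>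
  corrects for the fact that \<open>DP\<close> also differentiates the coefficients of \<open>m\<close>.\<close>

lemma Th_V1_mult:
  "Th (V1 * m) = (V1 + DP (cc b)) * Th m + cc b * DP (Th m) - cc b * Th (DP m) + (cc k + V1 * cc a) * m"
proof (induction m rule: poly_monom_induct)
  case (monom q i)
  let ?Q = "[:q:]" and ?Q' = "[:map_poly D q:]"
  have monom: "Polynomial.monom r i = [:r:] * V1 ^ i" for r :: "'a poly" and i
    by (simp add: monom_altdef V1_def)
  have DP_monom: "DP (Polynomial.monom q i) = Polynomial.monom (map_poly D q) i"
    by (rule poly_eqI) (simp add: coeff_map_poly D_additive)
  have V1_monom: "V1 * Polynomial.monom q i = Polynomial.monom q (Suc i)"
    unfolding monom by (simp only: power_Suc mult.left_commute)
  have DP_Q: "DP (?Q * T i) = ?Q' * T i + ?Q * DP (T i)"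
    by (simp only: P.D_mult DP_const)
  have eq: "Q * ((v + d) * t + B * s + e * M) = (v + d) * (Q * t) + B * (Q' * t + Q * s) - B * (Q' * t) + e * (Q * M)"
    for Q Q' v d t B s e M :: "'a poly poly"
    by (simp add: algebra_simps)
  have "?Q * T (Suc i) = (V1 + cc (D b)) * (?Q * T i) + cc b * DP (?Q * T i) - cc b * (?Q' * T i)
      + (cc k + V1 * cc a) * (?Q * V1 ^ i)"
    unfolding T.simps DP_Q by (rule eq)
  then show ?case
    unfolding V1_monom DP_monom Th_monom DP_cc unfolding monom(1) .
next
  case (add p q)
  have eq: "(x1 * f + y1 * g - y1 * h + z1 * r) + (x1 * f' + y1 * g' - y1 * h' + z1 * r')
      = x1 * (f + f') + y1 * (g + g') - y1 * (h + h') + z1 * (r + r')"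
    for x1 y1 z1 f f' g g' h h' r r' :: "'a poly poly"
    by (simp add: algebra_simps)
  show ?case
    unfolding distrib_left[of V1] Th_add P.D_add add by (rule eq)
qed

lemma Th_leading: "deg_less n m \<Longrightarrow> deg_less n (Th m - V2 * m)"
proof -
  assume n: "deg_less n m"
  have "Th m - V2 * m = (\<Sum>i\<le>degree m. [:poly.coeff m i:] * (T i - V2 * V1 ^ i))"
  proof -
    have "(\<Sum>i\<le>degree m. [:poly.coeff m i:] * (T i - V2 * V1 ^ i)) =
        (\<Sum>i\<le>degree m. Polynomial.smult (poly.coeff m i) (T i)) - V2 * (\<Sum>i\<le>degree m. Polynomial.monom (poly.coeff m i) i)"
      by (simp add: right_diff_distrib sum_subtractf sum_distrib_left monom_altdef V1_def smult_diff_right mult_ac)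
    then show ?thesis by (simp add: Th_def poly_as_sum_of_monoms)
  qed
  also have "deg_less n \<dots>"
  proof (rule deg_less_sum)
    fix i
    show "deg_less n ([:poly.coeff m i:] * (T i - V2 * V1 ^ i))"
    proof (cases "i < n")
      case True
      then have "deg_less (Suc (n - Suc i)) [:poly.coeff m i:]"
        using n by (auto simp: deg_less_def coeff_pCons split: nat.splits)
      from deg_less_mult[OF this T_leading[of i]] True show ?thesis by simp
    next
      case False
      with n have "poly.coeff m i = 0" by (auto simp: deg_less_def poly_eq_iff)
      then show ?thesis by (simp add: deg_less_zero)
    qed
  qed
  finally show ?thesis .
qed

definition X1 :: "'a poly poly \<Rightarrow> 'a poly poly"
  where "X1 m = V1 * m + cc b * DP m"

definition X2 :: "'a poly poly \<Rightarrow> 'a poly poly"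
  where "X2 m = Th m + (V1 + cc c) * DP m + cc b * P.E m"

lemma X1_add: "X1 (m + n) = X1 m + X1 n"
  by (simp add: X1_def P.D_add distrib_left)

lemma X2_add: "X2 (m + n) = X2 m + X2 n"
  by (simp add: X2_def Th_add P.D_add P.E_add distrib_left)

lemma X_commutator: "X2 (X1 m) - X1 (X2 m) = cc k * m + cc a * X1 m + cc (D b) * X2 m"
proof -
  have "cc b * (cc a + DP (cc c) - DP (cc b) - P.E (cc b)) = cc (b * (a + D c - D b - E b))"
    by (simp add: DP_cc EP_cc cc_mult cc_add cc_diff)
  then have "cc b * (cc a + DP (cc c) - DP (cc b) - P.E (cc b)) = 0" by (simp add: cond cc_0)
  from P.commutator_relation[of Th "cc b" V1 "cc k" "cc a" "cc c", OF Th_add Th_cc_mult Th_V1_mult DP_V1 this]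
  show ?thesis by (simp add: X1_def X2_def DP_cc)
qed

text \<open>For \<open>e = g\<^sup>t\<close> these are the relations between group elements and vectors.\<close>

lemma X_eigenvector:
  assumes e: "D e = t * e" and t: "D t = 0"
  shows "X1 (cc e * m) = cc e * X1 m + cc (t * b * e) * m"
    and "X2 (cc e * m) = cc e * X2 m + cc (t * e) * X1 m + cc (t * c * e + hf * (t * t - t) * b * e) * m"
proof -
  have D: "DP (cc e * m) = cc (t * e) * m + cc e * DP m"
    by (simp add: P.D_mult DP_cc e)
  have Ee: "E e = hf * (t * t - t) * e"
    by (simp add: E_def e D_mult t algebra_simps)
  have E: "P.E (cc e * m) = cc (hf * (t * t - t) * e) * m + cc e * P.E m + cc (t * e) * DP m"
    unfolding P.E_mult EP_cc DP_cc e Ee ..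
  show "X1 (cc e * m) = cc e * X1 m + cc (t * b * e) * m"
    unfolding X1_def D by (simp add: algebra_simps cc_mult)
  show "X2 (cc e * m) = cc e * X2 m + cc (t * e) * X1 m + cc (t * c * e + hf * (t * t - t) * b * e) * m"
    unfolding X1_def X2_def D E Th_cc_mult by (simp add: algebra_simps cc_add cc_mult cc_diff)
qed

lemma X_constant_mult:
  assumes "D e = 0"
  shows "X1 (cc e * m) = cc e * X1 m" "X2 (cc e * m) = cc e * X2 m"
  using X_eigenvector[of e 0 m] assms by (simp_all add: D_additive cc_0)

lemma X_leading:
  assumes "deg_less n m"
  shows "deg_less n (X1 m - V1 * m)" "deg_less n (X2 m - (V2 * m + V1 * DP m))"
proof -
  show "deg_less n (X1 m - V1 * m)"
    using assms by (simp add: X1_def deg_less_cc_mult deg_less_DP)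
  have "X2 m - (V2 * m + V1 * DP m) = (Th m - V2 * m) + cc c * DP m + cc b * P.E m"
    by (simp add: X2_def distrib_right)
  also have "deg_less n \<dots>"
    unfolding P.E_def
    by (intro deg_less_add Th_leading deg_less_cc_mult deg_less_DP deg_less_diff assms)
  finally show "deg_less n (X2 m - (V2 * m + V1 * DP m))" .
qed

end

section \<open>The transvection group and its group algebra\<close>

text \<open>The entry in the upper right corner is the exponent with respect to the generator, already as an
  element of the field.\<close>

definition idx :: "'p::prime_card transvection_group \<Rightarrow> 'p mod_ring"
  where "idx h = matrix_of h $ 1 $ 2"

lemma idx_gen_power: "idx (gen ^ n) = of_nat n"
  by (simp add: idx_def matrix_of_gen_power)

lemma transvection_group_cases:
  fixes h :: "'p::prime_card transvection_group"
  obtains n where "n < CARD('p)" "h = gen ^ n"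
proof -
  have pow: "matrix_of (gen ^ n :: 'p transvection_group) = (((**) transvection) ^^ n) (mat 1)" for n
    by (induction n) (simp_all add: one_transvection_group.rep_eq times_transvection_group.rep_eq gen.rep_eq)
  obtain n where "matrix_of h = (((**) transvection) ^^ n) (mat 1)"
    using matrix_of[of h] by blast
  then have n: "h = gen ^ n" by (simp add: pow flip: matrix_of_inject)
  have "(gen :: 'p transvection_group) ^ n = gen ^ (CARD('p) * (n div CARD('p)) + n mod CARD('p))"
    by simp
  also have "\<dots> = gen ^ (n mod CARD('p))"
    by (simp only: power_add power_mult gen_power_CARD power_one mult_1_left)
  finally show thesis using n by (intro that[of "n mod CARD('p)"]) simp_all
qed

lemma matrix_of_idx: "matrix_of h = vector [vector [1, idx h], vector [0, 1]]"
  by (rule transvection_group_cases[of h]) (simp add: idx_gen_power matrix_of_gen_power)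

lemma idx_mult: "idx (h * h') = idx h + idx h'"
  by (rule transvection_group_cases[of h], rule transvection_group_cases[of h'])
    (simp add: idx_gen_power flip: power_add)

lemma idx_one: "idx 1 = 0"
  using idx_gen_power[of 0] by simp

lemma idx_inject: "idx h = idx h' \<longleftrightarrow> h = h'"
  by (metis matrix_of_idx matrix_of_inject)

lemma bij_idx: "bij (idx :: 'p::prime_card transvection_group \<Rightarrow> _)"
proof (rule bijI)
  show "surj (idx :: 'p transvection_group \<Rightarrow> _)"
  proof (rule surjI)
    fix j :: "'p mod_ring"
    have "\<exists>h :: 'p transvection_group. idx h = j"
      using surj_of_nat_mod_ring[of j] idx_gen_power by metis
    then show "idx (SOME h :: 'p transvection_group. idx h = j) = j" by (rule someI_ex)
  qed
qed (simp add: inj_def idx_inject)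

lemma matrix_of_hom: "matrix_of 1 = mat 1" "matrix_of (h * h') = matrix_of h ** matrix_of h'"
  by (simp_all add: one_transvection_group.rep_eq times_transvection_group.rep_eq)

lemma v1_axis: "v1 = axis 1 1" and v2_axis: "v2 = axis 2 1"
  by (simp_all add: vec_eq_iff forall_2 axis_def)

lemma vec2_expand: "v = v $ 1 *s v1 + v $ 2 *s (v2 :: 'k::field ^ 2)"
  by (simp add: vec_eq_iff forall_2)

lemma matrix_of_vec: "matrix_of h *v v = (v $ 1 + idx h * v $ 2) *s v1 + v $ 2 *s v2"
  by (simp add: matrix_of_idx vec_eq_iff forall_2 matrix_vector_mult_def sum_2)

text \<open>An isomorphism onto a type with ring operations, so that the group algebra can be treated as a commutative
  ring.\<close>

definition gal :: "'p::prime_card mod_ring ^ 'p transvection_group \<Rightarrow> 'p galg"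
  where "gal a = (\<Sum>h\<in>UNIV. single (idx h) (a $ h))"

definition ungal :: "'p::prime_card galg \<Rightarrow> 'p mod_ring ^ 'p transvection_group"
  where "ungal x = (\<chi> h. lookup x (idx h))"

lemma lookup_gal: "lookup (gal a) (idx h) = a $ h"
proof -
  have "lookup (gal a) (idx h) = (\<Sum>h'\<in>UNIV. if h' = h then a $ h else 0)"
    unfolding gal_def lookup_sum by (intro sum.cong refl) (auto simp: lookup_single when_def idx_inject)
  then show ?thesis by simp
qed

lemma ungal_gal: "ungal (gal a) = a"
  by (simp add: ungal_def vec_eq_iff lookup_gal)

lemma gal_ungal: "gal (ungal x) = (x :: 'p::prime_card galg)"
proof (rule poly_mapping_eqI)
  fix j :: "'p mod_ring"
  obtain h where "j = idx h" using bij_idx by (metis bij_pointE)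
  then show "lookup (gal (ungal x)) j = lookup x j"
    by (simp add: lookup_gal ungal_def)
qed

lemma gal_inject: "gal a = gal b \<longleftrightarrow> a = b"
  by (metis ungal_gal)

lemma gal_add: "gal (a + b) = gal a + gal b"
  by (simp add: gal_def single_add sum.distrib)

lemmas gal_additive = additive_facts[where f = gal, OF gal_add]

lemma gal_scale: "gal (c *s a) = gconst c * gal a"
  by (simp add: gal_def sum_distrib_left mult_single)

lemma gal_axis: "gal (axis h c) = single (idx h) c"
proof -
  have "gal (axis h c) = (\<Sum>h'\<in>UNIV. if h' = h then single (idx h) c else 0)"
    unfolding gal_def by (intro sum.cong refl) (auto simp: axis_def)
  then show ?thesis by simp
qed

interpretation group_algebra: skew_action "\<lambda>(h :: 'p::prime_card transvection_group) a. a :: 'p mod_ring"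
  by standard simp_all

lemma gal_mult: "gal (a \<otimes>\<^bsub>group_algebra\<^esub> b) = gal a * gal b"
proof -
  have "gal ((\<Sum>h\<in>UNIV. axis h (a $ h)) \<otimes>\<^bsub>group_algebra\<^esub> (\<Sum>h\<in>UNIV. axis h (b $ h))) =
      gal (\<Sum>h\<in>UNIV. axis h (a $ h)) * gal (\<Sum>h\<in>UNIV. axis h (b $ h))"
    unfolding group_algebra.skew_additive_left(4) group_algebra.skew_additive_right(4)
      group_algebra.skew_axis gal_additive(4) gal_axis
    by (subst sum.swap) (simp add: sum_product mult_single idx_mult)
  then show ?thesis by (simp only: vec_sum_axis)
qed

lemma gal_one: "gal (axis 1 1) = 1"
  by (simp add: gal_axis idx_one)

lemma gal_pow: "gal (a [^]\<^bsub>group_algebra\<^esub> (k::nat)) = gal a ^ k"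
proof (induction k)
  case 0
  show ?case by (simp add: nat_pow_def gal_one skew_group_algebra_def)
next
  case (Suc k)
  then show ?case by (simp add: nat_pow_def gal_mult mult.commute)
qed

lemma aug_gal: "aug (gal a) = (\<Sum>h\<in>UNIV. a $ h)"
  by (simp add: gal_def aug_additive aug_single)

lemma has_aug_order_iff:
  fixes b :: "'p::prime_card mod_ring ^ 'p transvection_group"
  shows "has_aug_order b k \<longleftrightarrow> gorder (gal b) k"
proof -
  have gx: "gal (axis gen 1 - axis 1 1 :: 'p mod_ring ^ 'p transvection_group) = gx"
    using idx_gen_power[of 1, where 'a = 'p] by (simp add: gal_additive gal_axis idx_one gx_def)
  have "(\<exists>b'. b = (axis gen 1 - axis 1 1) [^]\<^bsub>group_algebra\<^esub> k \<otimes>\<^bsub>group_algebra\<^esub> b' \<and> (\<Sum>h\<in>UNIV. b' $ h) \<noteq> 0) \<longleftrightarrow>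
      (\<exists>b'. gal b = gx ^ k * gal b' \<and> aug (gal b') \<noteq> 0)"
    unfolding aug_gal gal_mult[symmetric] gx[symmetric] gal_pow[symmetric] gal_inject ..
  also have "\<dots> \<longleftrightarrow> (\<exists>u. gal b = gx ^ k * u \<and> aug u \<noteq> 0)"
    by (metis gal_ungal)
  finally show ?thesis by (simp add: has_aug_order_def gorder_def)
qed

lemma ex1_aug_order: "\<exists>!k. has_aug_order b k"
  unfolding has_aug_order_iff using gorder_exists gorder_unique by blast

lemma gorder_aug_order: "gorder (gal b) (aug_order b)"
  using theI'[OF ex1_aug_order[of b]] by (simp add: aug_order_def has_aug_order_iff)

subsection \<open>The derivation of the group algebra\<close>

definition gD :: "'p::prime_card galg \<Rightarrow> 'p galg"
  where "gD a = lin_ext (\<lambda>j c. single j (j * c)) a"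

definition ghalf :: "'p::prime_card galg"
  where "ghalf = gconst (inverse 2)"

definition gE :: "'p::prime_card galg \<Rightarrow> 'p galg"
  where "gE a = ghalf * (gD (gD a) - gD a)"

lemma gD_single: "gD (single j c) = single j (j * c)"
  unfolding gD_def by (rule lin_ext_single) simp

lemma gD_add: "gD (a + b) = gD a + gD b"
  unfolding gD_def by (rule lin_ext_add) (simp_all add: distrib_left single_add)

lemma gD_mult: "gD (a * b) = gD a * b + a * gD b"
proof (induction a rule: poly_mapping_single_induct)
  case (single j c)
  show ?case
    by (induction b rule: poly_mapping_single_induct)
      (simp_all add: mult_single gD_single gD_add algebra_simps flip: single_add)
qed (simp add: distrib_right gD_add)

lemma two_nonzero: "odd CARD('p::prime_card) \<Longrightarrow> (2 :: 'p mod_ring) \<noteq> 0"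
proof -
  assume odd: "odd CARD('p)"
  have "\<not> CARD('p) dvd 2"
    using odd prime_card[where 'a = 'p] by (metis primes_dvd_imp_eq two_is_prime_nat dvd_refl)
  then have "(of_nat 2 :: 'p mod_ring) \<noteq> 0"
    by (simp only: of_nat_eq_0_iff_char_dvd semiring_char_mod_ring not_False_eq_True)
  then show ?thesis by simp
qed

lemma half_derivation_gD:
  assumes "odd CARD('p::prime_card)"
  shows "half_derivation (gD :: 'p galg \<Rightarrow> 'p galg) ghalf"
proof
  have "inverse 2 + inverse 2 = (1 :: 'p mod_ring)"
    using two_nonzero[OF assms] by (simp add: field_simps)
  then show "ghalf + ghalf = (1 :: 'p galg)"
    by (simp add: ghalf_def flip: single_add)
qed (simp_all add: gD_add gD_mult)

lemma half_derivation_E: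
  assumes "odd CARD('p::prime_card)"
  shows "half_derivation.E gD ghalf = (gE :: 'p galg \<Rightarrow> 'p galg)"
  by (simp add: fun_eq_iff gE_def half_derivation.E_def[OF half_derivation_gD[OF assms]])

lemma lookup_gD: "lookup (gD a) j = j * lookup a j"
  by (induction a rule: poly_mapping_single_induct)
    (simp_all add: gD_single gD_add lookup_add lookup_single when_def distrib_left)

lemma of_nat_choose_two:
  assumes "odd CARD('p::prime_card)"
  shows "(of_nat (i choose 2) :: 'p mod_ring) = inverse 2 * (of_nat i * of_nat i - of_nat i)"
proof -
  have "2 * (i choose 2) + i = i * i"
    by (induction i) (simp_all add: numeral_2_eq_2)
  then have "(of_nat (2 * (i choose 2) + i) :: 'p mod_ring) = of_nat (i * i)" by (rule arg_cong)
  then have "(2 * of_nat (i choose 2) :: 'p mod_ring) = of_nat i * of_nat i - of_nat i"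
    by (simp add: algebra_simps)
  then show ?thesis using two_nonzero[OF assms] by (simp add: field_simps)
qed

lemma lookup_gE:
  assumes "odd CARD('p::prime_card)"
  shows "lookup (gE a) (of_nat i :: 'p mod_ring) = of_nat (i choose 2) * lookup a (of_nat i)"
proof -
  have "lookup (gE a) j = inverse 2 * (j * (j * lookup a j) - j * lookup a j)"
    for j :: "'p mod_ring"
    by (simp only: gE_def ghalf_def lookup_gconst_mult lookup_minus lookup_gD)
  then show ?thesis
    unfolding of_nat_choose_two[OF assms] by (simp only: left_diff_distrib right_diff_distrib mult.assoc)
qed

section \<open>The classifying data give PBW deformations\<close>

text \<open>The bilinear map \<open>\<lambda>\<close> that is determined by \<open>b\<close> and \<open>c\<close>, without reference to exponents.\<close>

definition Lam :: "'p::prime_card galg \<Rightarrow> 'p galg \<Rightarrow> ('p mod_ring, 2, 'p transvection_group) lambda_map"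
  where "Lam b c = (\<lambda>x v. ungal (gconst (v $ 1) * (b * gD (gal x)) + gconst (v $ 2) * (c * gD (gal x) + b * gE (gal x))))"

definition Kap_value :: "'p::prime_card galg \<Rightarrow> 'p galg \<Rightarrow> 'p galg \<Rightarrow> ('p mod_ring, 2, 'p transvection_group) kappa_val"
  where "Kap_value k a w = (ungal k, \<chi> h. lookup a (idx h) *s v1 + lookup w (idx h) *s v2)"

definition Kap :: "'p::prime_card galg \<Rightarrow> 'p galg \<Rightarrow> 'p galg \<Rightarrow> ('p mod_ring, 2, 'p transvection_group) kappa_map"
  where "Kap k a w = (\<lambda>v v'. kappa_scale (v $ 1 * v' $ 2 - v $ 2 * v' $ 1) (Kap_value k a w))"

lemma sum_gpow_lookup:
  fixes x :: "'p::prime_card galg"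
  shows "(\<Sum>h\<in>UNIV. single (idx h) (lookup x (idx h))) = x"
  using gal_ungal[of x] by (simp add: gal_def ungal_def)

locale transvection_data =
  fixes b c a k :: "'p::prime_card galg"
  assumes odd: "odd CARD('p)" and jacobi: "b * (a + gD c - gD b - gE b) = 0"
begin

sublocale drinfeld_data gD ghalf b c a k
  by (intro drinfeld_data.intro drinfeld_data_axioms.intro half_derivation_gD odd)
    (simp add: half_derivation_E[OF odd] jacobi)

sublocale orbifold_presentation matrix_of "Lam b c" "Kap k a (gD b)"
  by standard (simp_all add: matrix_of_hom)

definition pscale :: "'p mod_ring \<Rightarrow> 'p galg poly poly \<Rightarrow> 'p galg poly poly"
  where "pscale \<alpha> m = cc (gconst \<alpha>) * m"

definition pstep :: "2 + 'p transvection_group \<Rightarrow> 'p galg poly poly \<Rightarrow> 'p galg poly poly"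
  where "pstep x m = (case x of Inl i \<Rightarrow> if i = 1 then X1 m else X2 m | Inr h \<Rightarrow> cc (gpow (idx h)) * m)"

lemma gD_gconst: "gD (gconst \<alpha>) = 0"
  by (simp add: gD_single)

lemma X_gconst: "X1 (cc (gconst \<alpha>) * m) = cc (gconst \<alpha>) * X1 m" "X2 (cc (gconst \<alpha>) * m) = cc (gconst \<alpha>) * X2 m"
  by (intro X_constant_mult gD_gconst)+

sublocale repr: free_right_module pscale pstep
proof
  fix \<alpha> \<beta> :: "'p mod_ring" and x y :: "'p galg poly poly" and l
  show "pscale \<alpha> (x + y) = pscale \<alpha> x + pscale \<alpha> y" "pscale (\<alpha> + \<beta>) x = pscale \<alpha> x + pscale \<beta> x"
    "pscale \<alpha> (pscale \<beta> x) = pscale (\<alpha> * \<beta>) x" "pscale 1 x = x"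
    by (simp_all add: pscale_def distrib_left single_add cc_add distrib_right mult.assoc[symmetric] cc_mult[symmetric] mult_single cc_1)
  show "pstep l (x + y) = pstep l x + pstep l y"
    by (simp add: pstep_def X1_add X2_add distrib_left split: sum.split)
  show "pstep l (pscale \<alpha> x) = pscale \<alpha> (pstep l x)"
    by (simp add: pstep_def pscale_def X_gconst mult.left_commute split: sum.split)
qed

abbreviation act where "act \<equiv> free_act pscale pstep"

definition Xv :: "'p mod_ring ^ 2 \<Rightarrow> 'p galg poly poly \<Rightarrow> 'p galg poly poly"
  where "Xv v m = cc (gconst (v $ 1)) * X1 m + cc (gconst (v $ 2)) * X2 m"

lemma act_vec: "act (free_vec v) m = Xv v m"
  by (simp add: free_vec_def UNIV_2 repr.free_act_add repr.free_act_single pstep_def Xv_def pscale_def)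

lemma act_grp: "act (free_grp h) m = cc (gpow (idx h)) * m"
  by (simp add: free_grp_def repr.free_act_single pstep_def pscale_def cc_1)

lemma act_group_algebra: "act (free_group_algebra x) m = cc (gal x) * m"
proof -
  have "act (free_group_algebra x) m = (\<Sum>h\<in>UNIV. cc (single (idx h) (x $ h)) * m)"
    by (simp add: free_group_algebra_def repr.free_act_additive repr.free_act_mult repr.free_act_const act_grp
        pscale_def mult.assoc[symmetric] cc_mult[symmetric] mult_single)
  then show ?thesis by (simp add: gal_def cc.hom_sum sum_distrib_right)
qed

lemma act_kappa_value:
  "act (free_kappa_value (kappa_scale s (Kap_value k a w))) m = cc (gconst s) * (cc k * m + cc a * X1 m + cc w * X2 m)"
proof -
  have "cc (gpow (idx h)) * Xv (s *s (x *s v1 + y *s v2)) m =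
      cc (gconst s) * (cc (single (idx h) x) * X1 m + cc (single (idx h) y) * X2 m)" for h x y
    by (simp add: Xv_def distrib_left mult.assoc[symmetric] cc_mult[symmetric] mult_single)
  then have "act (\<Sum>h\<in>UNIV. free_vec (snd (kappa_scale s (Kap_value k a w)) $ h) * free_grp h) m =
      cc (gconst s) * (cc (\<Sum>h\<in>UNIV. single (idx h) (lookup a (idx h))) * X1 m +
        cc (\<Sum>h\<in>UNIV. single (idx h) (lookup w (idx h))) * X2 m)"
    by (simp add: repr.free_act_additive repr.free_act_mult act_vec act_grp kappa_scale_def Kap_value_def
        cc.hom_sum sum_distrib_right sum_distrib_left sum.distrib distrib_left)
  moreover have "act (free_group_algebra (fst (kappa_scale s (Kap_value k a w)))) m = cc (gconst s) * (cc k * m)"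
    by (simp add: act_group_algebra kappa_scale_def Kap_value_def gal_scale gal_ungal cc_mult mult.assoc)
  ultimately show ?thesis
    by (simp add: free_kappa_value_def repr.free_act_add sum_gpow_lookup distrib_left add.assoc)
qed

lemma act_relator: "r \<in> H_relators matrix_of (Lam b c) (Kap k a (gD b)) \<Longrightarrow> act r m = 0"
  unfolding H_relators_def
proof (elim UnE CollectE exE conjE)
  fix h h' :: "'p transvection_group" assume "r = free_grp h * free_grp h' - free_grp (h * h')"
  then show "act r m = 0"
    by (simp add: repr.free_act_additive repr.free_act_mult act_grp mult.assoc[symmetric] cc_mult[symmetric]
        mult_single idx_mult add.commute)
next
  assume "r \<in> {free_grp 1 - 1}"
  then show "act r m = 0"
    by (simp add: repr.free_act_additive repr.free_act_one act_grp idx_one cc_1)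
next
  fix h :: "'p transvection_group" and v :: "'p mod_ring ^ 2"
  let ?e = "gpow (idx h)" and ?t = "gconst (idx h)"
  assume r: "r = free_grp h * free_vec v - free_vec (matrix_of h *v v) * free_grp h - free_group_algebra (Lam b c (axis h 1) v)"
  have D: "gD ?e = ?t * ?e" by (simp add: gD_single mult_single)
  have E: "gE ?e = ghalf * (?t * ?t - ?t) * ?e"
    by (simp add: gE_def D gD_mult gD_gconst algebra_simps)
  have "act (free_group_algebra (Lam b c (axis h 1) v)) m =
      cc (gconst (v $ 1)) * (cc (?t * b * ?e) * m) + cc (gconst (v $ 2)) * (cc (?t * c * ?e + ghalf * (?t * ?t - ?t) * b * ?e) * m)"
    unfolding act_group_algebra Lam_def gal_ungal gal_axis D E by (simp add: cc_add cc_diff cc_mult algebra_simps)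
  moreover have "act (free_grp h * free_vec v) m =
      cc (gconst (v $ 1)) * X1 (cc ?e * m) + cc (gconst (v $ 2)) * X2 (cc ?e * m)"
    by (simp add: repr.free_act_mult act_grp act_vec Xv_def)
  moreover have "act (free_vec (matrix_of h *v v) * free_grp h) m =
      cc (gconst (v $ 1)) * (cc ?e * X1 m) + cc (gconst (v $ 2)) * (cc ?e * X2 m + cc (?t * ?e) * X1 m)"
    by (simp add: repr.free_act_mult act_grp act_vec Xv_def matrix_of_vec single_add cc_add)
      (simp add: algebra_simps cc_mult[symmetric] mult.assoc[symmetric] mult_single)
  ultimately show "act r m = 0"
    unfolding r repr.free_act_additive X_eigenvector[OF D gD_gconst] by (simp add: algebra_simps)
next
  fix v w :: "'p mod_ring ^ 2" assume r: "r = free_vec v * free_vec w - free_vec w * free_vec v - free_kappa_value (Kap k a (gD b) v w)"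
  let ?v1 = "cc (gconst (v $ 1))" and ?v2 = "cc (gconst (v $ 2))" and ?w1 = "cc (gconst (w $ 1))" and ?w2 = "cc (gconst (w $ 2))"
  have s: "cc (gconst (v $ 1 * w $ 2 - v $ 2 * w $ 1)) = ?v1 * ?w2 - ?v2 * ?w1"
    by (simp add: single_diff cc_diff mult_single flip: cc_mult)
  have "act (free_vec v * free_vec w) m =
      ?w1 * (?v1 * X1 (X1 m) + ?v2 * X1 (X2 m)) + ?w2 * (?v1 * X2 (X1 m) + ?v2 * X2 (X2 m))"
    and "act (free_vec w * free_vec v) m =
      ?v1 * (?w1 * X1 (X1 m) + ?w2 * X1 (X2 m)) + ?v2 * (?w1 * X2 (X1 m) + ?w2 * X2 (X2 m))"
    by (simp_all add: repr.free_act_mult act_vec Xv_def X1_add X2_add X_gconst)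
  then have "act r m = (?v1 * ?w2 - ?v2 * ?w1) * (X2 (X1 m) - X1 (X2 m)) - act (free_kappa_value (Kap k a (gD b) v w)) m"
    unfolding r repr.free_act_additive by (simp add: algebra_simps)
  then show "act r m = 0"
    unfolding Kap_def act_kappa_value s X_commutator by simp
qed

text \<open>The elements that act as zero form an ideal, which contains all relators.\<close>

lemma act_II: "t \<in> II \<Longrightarrow> act t m = 0"
proof -
  have "ideal {t. \<forall>m. act t m = 0} type_ring"
  proof (rule type_ring_idealI)
    have act_zero: "act t 0 = 0" for t
      using repr.free_act_scale[of t 0 0] by (simp add: pscale_def cc_0)
    show "\<And>x y. x \<in> {t. \<forall>m. act t m = 0} \<Longrightarrow> x * y \<in> {t. \<forall>m. act t m = 0}"
      by (simp add: repr.free_act_mult act_zero)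
  qed (simp_all add: repr.free_act_additive repr.free_act_add repr.free_act_mult)
  moreover have "H_relators matrix_of (Lam b c) (Kap k a (gD b)) \<subseteq> {t. \<forall>m. act t m = 0}"
    using act_relator by blast
  ultimately show "t \<in> II \<Longrightarrow> act t m = 0" using II_minimal by blast
qed

subsection \<open>Leading terms\<close>

lemma deg_less_step: "deg_less n m \<Longrightarrow> deg_less (Suc n) (X1 m)" "deg_less n m \<Longrightarrow> deg_less (Suc n) (X2 m)"
proof -
  assume m: "deg_less n m"
  have "X1 m = (X1 m - V1 * m) + V1 * m" by simp
  also have "deg_less (Suc n) \<dots>"
    by (intro deg_less_add deg_less_V1_mult m deg_less_mono[OF X_leading(1)[OF m]]) simp
  finally show "deg_less (Suc n) (X1 m)" .
  have "X2 m = (X2 m - (V2 * m + V1 * DP m)) + (V2 * m + V1 * DP m)" by simp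
  also have "deg_less (Suc n) \<dots>"
    by (intro deg_less_add deg_less_V1_mult deg_less_V2_mult deg_less_DP m deg_less_mono[OF X_leading(2)[OF m]]) simp
  finally show "deg_less (Suc n) (X2 m)" .
qed

lemma act_fless: "t \<in> fless n \<Longrightarrow> deg_less n (act t 1)"
proof -
  assume t: "t \<in> fless n"
  have word: "deg_less (d + Suc (length (filter isl w))) (fold pstep w m)" if "deg_less (Suc d) m" for w d m
    using that
  proof (induction w arbitrary: d m)
    case (Cons x w)
    show ?case
    proof (cases x)
      case (Inl i)
      then have "deg_less (Suc (Suc d)) (pstep x m)"
        using deg_less_step[OF Cons.prems] by (simp add: pstep_def)
      from Cons.IH[OF this] Inl show ?thesis by simp
    next
      case (Inr h)
      then have "deg_less (Suc d) (pstep x m)"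
        using deg_less_cc_mult[OF Cons.prems] by (simp add: pstep_def)
      from Cons.IH[OF this] Inr show ?thesis by simp
    qed
  qed simp
  have "deg_less (Suc 0) (1 :: 'p galg poly poly)" using deg_less_cc[of "1 :: 'p galg"] by (simp add: cc_1)
  from word[OF this] have "deg_less n (pscale c (fold pstep (letters u) 1))" if "u \<in> keys t" for u c
    unfolding pscale_def
    by (rule deg_less_cc_mult[OF deg_less_mono]) (use t that in \<open>simp add: fless_def mon_degree_def Suc_le_eq\<close>)
  then have "deg_less n (\<Sum>u\<in>keys t. act (single u (lookup t u)) 1)"
    by (intro deg_less_sum) (simp add: repr.free_act_single)
  then show "deg_less n (act t 1)"
    by (simp only: repr.free_act_additive(4)[symmetric] sum_single_lookup)
qed

text \<open>The leading monomials have constant coefficients, so the term \<open>V1 * DP m\<close> in \<open>X_leading\<close> does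
  not contribute.\<close>

lemma act_smono_leading:
  "deg_less (lookup m 1 + lookup m 2)
    (act (smono m) 1 - V1 ^ lookup m 1 * V2 ^ lookup m 2)"
proof -
  have pow: "act (fvar i ^ n) x = (pstep (Inl i) ^^ n) x" for i n x
  proof (induction n arbitrary: x)
    case 0
    show ?case by (simp add: repr.free_act_one)
  next
    case (Suc n)
    then show ?case
      by (simp add: repr.free_act_mult repr.free_act_single funpow_swap1)
  qed
  have DP_pow: "DP (V1 ^ p * V2 ^ q) = 0" for p q
  proof -
    have "DP (V1 ^ p) = 0"
      by (induction p) (simp_all add: P.D_one P.D_mult DP_V1)
    moreover have "DP (V2 ^ q) = 0"
      by (induction q) (simp_all add: P.D_one P.D_mult DP_V2)
    ultimately show ?thesis by (simp add: P.D_mult)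
  qed
  have lead1: "deg_less p ((X1 ^^ p) 1 - V1 ^ p)" "deg_less (Suc p) ((X1 ^^ p) 1)" for p
  proof (induction p)
    case 0
    show "deg_less 0 ((X1 ^^ 0) 1 - V1 ^ 0)" "deg_less (Suc 0) ((X1 ^^ 0) 1)"
      using deg_less_cc[of "1 :: 'p galg"] by (simp_all add: deg_less_zero cc_1)
  next
    case (Suc p)
    let ?m = "(X1 ^^ p) 1"
    have "(X1 ^^ Suc p) 1 - V1 ^ Suc p = (X1 ?m - V1 * ?m) + V1 * (?m - V1 ^ p)"
      by (simp add: algebra_simps)
    also have "deg_less (Suc p) \<dots>"
      by (intro deg_less_add deg_less_V1_mult Suc X_leading)
    finally show "deg_less (Suc p) ((X1 ^^ Suc p) 1 - V1 ^ Suc p)" .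
    show "deg_less (Suc (Suc p)) ((X1 ^^ Suc p) 1)" using deg_less_step(1)[OF Suc(2)] by simp
  qed
  have lead2: "deg_less (p + q) ((X2 ^^ q) ((X1 ^^ p) 1) - V1 ^ p * V2 ^ q)"
    "deg_less (Suc (p + q)) ((X2 ^^ q) ((X1 ^^ p) 1))" for p q
  proof (induction q)
    case 0
    show "deg_less (p + 0) ((X2 ^^ 0) ((X1 ^^ p) 1) - V1 ^ p * V2 ^ 0)" "deg_less (Suc (p + 0)) ((X2 ^^ 0) ((X1 ^^ p) 1))"
      using lead1 by simp_all
  next
    case (Suc q)
    let ?m = "(X2 ^^ q) ((X1 ^^ p) 1)"
    have "(X2 ^^ Suc q) ((X1 ^^ p) 1) - V1 ^ p * V2 ^ Suc q =
        (X2 ?m - (V2 * ?m + V1 * DP ?m)) + V2 * (?m - V1 ^ p * V2 ^ q) + V1 * DP (?m - V1 ^ p * V2 ^ q)"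
      by (simp add: algebra_simps P.D_additive DP_pow)
    also have "deg_less (Suc (p + q)) \<dots>"
      by (intro deg_less_add deg_less_V1_mult deg_less_V2_mult deg_less_DP Suc X_leading)
    finally show "deg_less (p + Suc q) ((X2 ^^ Suc q) ((X1 ^^ p) 1) - V1 ^ p * V2 ^ Suc q)" by simp
    show "deg_less (Suc (p + Suc q)) ((X2 ^^ Suc q) ((X1 ^^ p) 1))" using deg_less_step(2)[OF Suc(2)] by simp
  qed
  have "pstep (Inl 1) = X1" "pstep (Inl 2) = X2" by (simp_all add: pstep_def fun_eq_iff)
  then show ?thesis by (simp add: smono_def repr.free_act_mult pow lead2)
qed

definition lead :: "(('p mod_ring, 2) sym_alg, 'p transvection_group) vec \<Rightarrow> 'p galg poly poly"
  where "lead y = (\<Sum>h\<in>UNIV. lin_ext (\<lambda>m c. cc (single (idx h) c) *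
    (V1 ^ lookup m 1 * V2 ^ lookup m 2)) (y $ h))"

lemma lead_part_add:
  fixes s t :: "('p mod_ring, 2) sym_alg"
  defines "L h \<equiv> lin_ext (\<lambda>m c. cc (single (idx h) c) *
    (V1 ^ lookup m 1 * V2 ^ lookup m 2))"
  shows "L h (s + t) = L h s + L h t"
  unfolding L_def by (rule lin_ext_add) (simp_all add: cc_0 single_add cc_add distrib_right)

lemma lead_add: "lead (x + y) = lead x + lead y"
  by (simp add: lead_def lead_part_add sum.distrib)

lemma lead_axis:
  fixes \<alpha> :: "'p mod_ring"
  shows "lead (axis h (single m \<alpha>)) =
    cc (single (idx h) \<alpha>) * (V1 ^ lookup m 1 * V2 ^ lookup m 2)"
proof -
  let ?L = "\<lambda>h :: 'p transvection_group. lin_ext (\<lambda>m (c :: 'p mod_ring). cc (single (idx h) c) * (V1 ^ lookup m 1 * V2 ^ lookup m 2))"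
  have "lead (axis h (single m \<alpha>)) = (\<Sum>k\<in>UNIV. if k = h then ?L h (single m \<alpha>) else 0)"
    unfolding lead_def by (intro sum.cong) (auto simp: axis_def lin_ext_def)
  then show ?thesis by (simp add: lin_ext_single cc_0)
qed

lemma act_slift_leading: "y \<in> scomp n \<Longrightarrow> deg_less n (act (slift y) 1 - lead y)"
proof (induction rule: scomp_induct)
  case (axis h m c)
  let ?M = "V1 ^ lookup m 1 * V2 ^ lookup m 2 :: 'p galg poly poly"
  have "act (slift (axis h (single m c))) 1 = cc (single (idx h) c) * act (smono m) 1"
  proof -
    have "act (slift (axis h (single m c))) 1 = cc (gpow (idx h)) * pscale c (act (smono m) 1)"
      by (simp add: slift_axis repr.free_act_mult act_grp repr.free_act_const repr.free_act_scale)
        (simp add: pscale_def mult.left_commute)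
    then show ?thesis by (simp add: pscale_def mult.assoc[symmetric] cc_mult[symmetric] mult_single)
  qed
  then have "act (slift (axis h (single m c))) 1 - lead (axis h (single m c)) =
      cc (single (idx h) c) * (act (smono m) 1 - ?M)"
    by (simp add: lead_axis right_diff_distrib)
  moreover have "deg_less n (act (smono m) 1 - ?M)"
    using act_smono_leading[of m] axis by (simp add: sum_lookup_2)
  ultimately show ?case by (simp only: deg_less_cc_mult)
next
  case (add x y)
  from deg_less_add[OF add] show ?case
    by (simp add: slift_add repr.free_act_add lead_add algebra_simps)
next
  case zero
  have "lead 0 = 0" by (simp add: lead_def lin_ext_def)
  then show ?case by (simp add: slift_additive repr.free_act_additive deg_less_zero)
qed

lemma coeff_lead:
  "poly.coeff (poly.coeff (lead y) (lookup m 1)) (lookup m 2) =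
    gal (\<chi> h. lookup (y $ h) m)"
proof -
  let ?L = "\<lambda>h :: 'p transvection_group. lin_ext (\<lambda>m (c :: 'p mod_ring). cc (single (idx h) c) * (V1 ^ lookup m 1 * V2 ^ lookup m 2))"
  have monom: "cc x * (V1 ^ p * V2 ^ q) = Polynomial.monom (Polynomial.monom x q) p" for x :: "'p galg" and p q
  proof -
    have "V1 ^ p = (Polynomial.monom 1 p :: 'p galg poly poly)" by (simp add: V1_def monom_altdef)
    moreover have "V2 ^ q = [:Polynomial.monom 1 q :: 'p galg poly:]"
      by (simp add: V2_def monom_altdef poly_const_pow)
    ultimately show ?thesis by (simp add: cc_def smult_monom mult.commute)
  qed
  have m: "m' = m \<longleftrightarrow> lookup m' 1 = lookup m 1 \<and> lookup m' 2 = lookup m 2"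
    for m' :: "2 \<Rightarrow>\<^sub>0 nat"
    by (simp add: poly_mapping_eq_iff fun_eq_iff forall_2 del: poly_mapping.lookup_inject)
  have "poly.coeff (poly.coeff (?L h s) (lookup m 1)) (lookup m 2) =
      single (idx h) (lookup s m)" for h and s :: "('p mod_ring, 2) sym_alg"
  proof (induction s rule: poly_mapping_single_induct)
    case (single m' d)
    have "?L h (single m' d) = Polynomial.monom (Polynomial.monom (single (idx h) d) (lookup m' 2)) (lookup m' 1)"
      by (subst lin_ext_single) (simp_all add: cc_0 monom)
    then show ?case by (auto simp: lookup_single when_def m)
  next
    case (add s t)
    then show ?case by (simp add: lead_part_add lookup_add single_add)
  qed
  then show ?thesis by (simp add: lead_def gal_def coeff_sum)
qed

text \<open>If a normally ordered element of degree \<open>n\<close> is congruent to one of lower degree, both send 1 to the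
  same polynomial, which therefore has degree less than \<open>n\<close>. Its coefficients in degree \<open>n\<close> are
  those of the given element.\<close>

theorem pbw_independent: pbw_independent
  unfolding pbw_independent_def
proof (intro allI ballI impI)
  fix n y assume y: "y \<in> scomp n" "slift y \<in> JJ n"
  from y(2) obtain i r where "i \<in> II" "r \<in> fless n" "slift y = i + r" by (elim JJ_E)
  then have "deg_less n (act (slift y) 1)"
    by (simp add: repr.free_act_add act_II act_fless)
  from deg_less_diff[OF this act_slift_leading[OF y(1)]] have lead: "deg_less n (lead y)" by simp
  have "lookup (y $ h) m = 0" for h m
  proof (cases "m \<in> keys (y $ h)")
    case True
    with y(1) have "lookup m 1 + lookup m 2 = n"
      unfolding scomp_def homog_def by (force simp: UNIV_2)
    then have "gal (\<chi> h. lookup (y $ h) m) = 0"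
      using lead unfolding coeff_lead[symmetric] deg_less_def by simp
    then show ?thesis using lookup_gal[of "\<chi> h. lookup (y $ h) m" h] by simp
  qed (simp add: in_keys_iff)
  then show "y = 0" by (simp add: vec_eq_iff poly_mapping_eqI)
qed

end

section \<open>PBW deformations come from the classifying data\<close>

lemma bilinear_mapD:
  assumes "bilinear_map sa sb sc B"
  shows "B x (y + y') = B x y + B x y'" "B x (sb r y) = sc r (B x y)"
    "B (x + x') y = B x y + B x' y" "B (sa r x) y = sc r (B x y)"
  using assms by (simp_all add: bilinear_map_def Vector_Spaces.linear_iff)

lemma axis_scale: "axis h (c :: 'k::field) = c *s axis h 1"
  by (simp add: vec_eq_iff axis_def)

lemma gE_add: "gE (x + y) = gE x + gE y"
  by (simp add: gE_def gD_add algebra_simps)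

lemma gD_const: "gD (gconst r * x) = gconst r * gD x"
  by (simp add: gD_mult gD_single)

lemma gE_const: "gE (gconst r * x) = gconst r * gE x"
  unfolding gE_def gD_const by (simp add: right_diff_distrib mult.left_commute)

lemma vector_space_kappa_scale: "vector_space kappa_scale"
  by standard (simp_all add: kappa_scale_def prod_eq_iff vec_eq_iff algebra_simps)

lemma gal_Lam: "gal (Lam b c x v) = gconst (v $ 1) * (b * gD (gal x)) + gconst (v $ 2) * (c * gD (gal x) + b * gE (gal x))"
  by (simp add: Lam_def gal_ungal)

lemma bilinear_Lam:
  fixes b c :: "'p::prime_card galg"
  shows "bilinear_map (*s) (*s) (*s) (Lam b c)"
proof -
  have gc: "gconst (r * s) = gconst r * gconst s" for r s :: "'p mod_ring"
    by (simp add: mult_single)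
  have "Lam b c x (v + w) = Lam b c x v + Lam b c x w" "Lam b c x (r *s v) = r *s Lam b c x v"
    "Lam b c (x + y) v = Lam b c x v + Lam b c y v" "Lam b c (r *s x) v = r *s Lam b c x v" for x y v w r
    by (simp_all only: gal_inject[symmetric] gal_Lam gal_add gal_scale gD_add gE_add gD_const gE_const
        vector_add_component vector_smult_component single_add gc) (simp_all only: algebra_simps)
  then show ?thesis
    unfolding bilinear_map_def Vector_Spaces.linear_iff by (simp add: vec.vector_space_axioms)
qed

lemma parameter_pair_Lam_Kap: "parameter_pair (Lam b c) (Kap k a w)"
proof -
  interpret vector_space kappa_scale by (rule vector_space_kappa_scale)
  have "Kap k a w x (y + z) = Kap k a w x y + Kap k a w x z" "Kap k a w x (r *s y) = kappa_scale r (Kap k a w x y)"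
    "Kap k a w (y + z) x = Kap k a w y x + Kap k a w z x" "Kap k a w (r *s y) x = kappa_scale r (Kap k a w y x)"
    "Kap k a w x x = 0" for x y z r
    by (simp_all add: Kap_def algebra_simps flip: scale_left_distrib)
  then show ?thesis
    unfolding parameter_pair_def bilinear_map_def[of _ _ kappa_scale] Vector_Spaces.linear_iff
    by (simp add: vec.vector_space_axioms vector_space_kappa_scale bilinear_Lam)
qed

lemma bilinear_lam_eqI:
  fixes lam lam' :: "('p::prime_card mod_ring, 2, 'p transvection_group) lambda_map"
  assumes lam: "bilinear_map (*s) (*s) (*s) lam" and lam': "bilinear_map (*s) (*s) (*s) lam'"
    and eq: "\<And>h. lam (axis h 1) v1 = lam' (axis h 1) v1" "\<And>h. lam (axis h 1) v2 = lam' (axis h 1) v2"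
  shows "lam = lam'"
proof (intro ext)
  fix x :: "'p mod_ring ^ 'p transvection_group" and v :: "'p mod_ring ^ 2"
  have expand: "B x v = (\<Sum>h\<in>UNIV. x $ h *s (v $ 1 *s B (axis h 1) v1 + v $ 2 *s B (axis h 1) v2))"
    if B: "bilinear_map (*s) (*s) (*s) B" for B :: "('p mod_ring, 2, 'p transvection_group) lambda_map"
  proof -
    have "B (\<Sum>h\<in>A. x $ h *s axis h 1) v = (\<Sum>h\<in>A. x $ h *s B (axis h 1) v)" for A
      using bilinear_mapD(4)[OF B, of 0 0 v]
      by (induction A rule: infinite_finite_induct) (simp_all add: bilinear_mapD(3,4)[OF B])
    from this[of UNIV] have "B x v = (\<Sum>h\<in>UNIV. x $ h *s B (axis h 1) v)"
      by (simp only: axis_scale[symmetric] vec_sum_axis)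
    moreover have "B (axis h 1) v = v $ 1 *s B (axis h 1) v1 + v $ 2 *s B (axis h 1) v2" for h
      by (subst vec2_expand[of v]) (simp only: bilinear_mapD[OF B])
    ultimately show ?thesis by simp
  qed
  show "lam x v = lam' x v" unfolding expand[OF lam] expand[OF lam'] eq ..
qed

lemma alternating_expand:
  fixes \<kappa> :: "('p::prime_card mod_ring, 2, 'p transvection_group) kappa_map"
  assumes kappa: "bilinear_map (*s) (*s) kappa_scale \<kappa>" and alt: "\<And>v. \<kappa> v v = 0"
  shows "\<kappa> v w = kappa_scale (v $ 1 * w $ 2 - v $ 2 * w $ 1) (\<kappa> v1 v2)"
proof -
  interpret vector_space kappa_scale by (rule vector_space_kappa_scale)
  note K = bilinear_mapD[OF kappa]
  have anti: "\<kappa> y x = - \<kappa> x y" for x y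
  proof -
    have "\<kappa> (x + y) (x + y) = \<kappa> x x + \<kappa> y y + (\<kappa> y x + \<kappa> x y)"
      by (simp only: K(1,3) add_ac)
    then have "\<kappa> y x + \<kappa> x y = 0" by (simp only: alt add_0)
    then show ?thesis by (rule eq_neg_iff_add_eq_0[THEN iffD2])
  qed
  have "\<kappa> v w = \<kappa> (v $ 1 *s v1 + v $ 2 *s v2) (w $ 1 *s v1 + w $ 2 *s v2)"
    by (simp only: vec2_expand[symmetric])
  also have "\<dots> = kappa_scale (v $ 1 * w $ 2 - v $ 2 * w $ 1) (\<kappa> v1 v2)"
    unfolding K alt anti[of v2 v1] by (simp add: scale_left_diff_distrib mult.commute)
  finally show ?thesis .
qed

lemma kappa_eq_Kap_iff:
  assumes "bilinear_map (*s) (*s) kappa_scale \<kappa>" and "\<And>v. \<kappa> v v = 0"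
  shows "\<kappa> = Kap k a w \<longleftrightarrow> \<kappa> v1 v2 = Kap_value k a w"
proof
  interpret vector_space kappa_scale by (rule vector_space_kappa_scale)
  show "\<kappa> v1 v2 = Kap_value k a w" if "\<kappa> = Kap k a w" using that by (simp add: Kap_def)
  show "\<kappa> = Kap k a w" if "\<kappa> v1 v2 = Kap_value k a w"
    using alternating_expand[OF assms] that by (simp add: Kap_def fun_eq_iff)
qed

locale transvection_pbw = orbifold_presentation matrix_of lam \<kappa>
  for lam :: "('p::prime_card mod_ring, 2, 'p transvection_group) lambda_map"
    and \<kappa> :: "('p mod_ring, 2, 'p transvection_group) kappa_map" +
  assumes odd: "odd CARD('p)" and param: "parameter_pair lam \<kappa>" and independent: pbw_independent
begin

interpretation half_derivation gD "ghalf :: 'p galg" by (rule half_derivation_gD[OF odd])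

definition fg :: "'p galg \<Rightarrow> ('p mod_ring, 2, 'p transvection_group) free_alg"
  where "fg x = free_group_algebra (ungal x)"

lemma fg_expand: "fg x = (\<Sum>h\<in>UNIV. single 0 (lookup x (idx h)) * free_grp h)"
  by (simp add: fg_def free_group_algebra_def ungal_def)

lemma fg_add: "fg (x + y) = fg x + fg y"
  by (simp add: fg_expand lookup_add single_add distrib_right sum.distrib)

lemmas fg_additive = additive_facts[where f = fg, OF fg_add]

lemma fg_single: "fg (single (idx h) c) = single 0 c * free_grp h"
proof -
  have "fg (single (idx h) c) = (\<Sum>h'\<in>UNIV. if h' = h then single 0 c * free_grp h else 0)"
    unfolding fg_expand by (intro sum.cong refl) (auto simp: lookup_single when_def idx_inject)
  then show ?thesis by simp
qed

lemma fg_gpow: "fg (gpow (idx h)) = free_grp h"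
  by (simp add: fg_single)

lemma fg_const: "single 0 c * fg x = fg (gconst c * x)"
  by (simp add: fg_expand sum_distrib_left lookup_gconst_mult mult_single flip: mult.assoc)

lemma galg_idx_induct [case_names single add]:
  assumes "\<And>h c. P (single (idx h) c)" "\<And>x y. P x \<Longrightarrow> P y \<Longrightarrow> P (x + y)"
  shows "P (x :: 'p galg)"
proof (induction x rule: poly_mapping_single_induct)
  case (single j c)
  obtain h where "idx h = j" using bij_idx by (metis bij_pointE)
  with assms(1)[of h c] show ?case by simp
qed (rule assms(2))

definition fdeg1 :: "'p galg \<Rightarrow> 'p galg \<Rightarrow> 'p galg \<Rightarrow> ('p mod_ring, 2, 'p transvection_group) free_alg"
  where "fdeg1 x y w = fg x + fvar 1 * fg y + fvar 2 * fg w"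

text \<open>Independence in degree 1 kills the coefficients of the variables, and independence in degree 0 the
  remaining element of the group algebra. All conditions on the parameters are read off from here.\<close>

lemma fdeg1_independent:
  assumes "fdeg1 x y w \<in> II"
  shows "x = 0" "y = 0" "w = 0"
proof -
  define Y :: "(('p mod_ring, 2) sym_alg, 'p transvection_group) vec"
    where "Y = (\<Sum>h\<in>UNIV. axis h (single (single 1 1) (lookup y (idx h))))
      + (\<Sum>h\<in>UNIV. axis h (single (single 2 1) (lookup w (idx h))))"
  have "fvar i * fg z = (\<Sum>h\<in>UNIV. single 0 (lookup z (idx h)) * fvar i * free_grp h)" for i z
    by (simp add: fg_expand sum_distrib_left const_commute[of _ "fvar i"] mult.assoc[symmetric])
  then have "slift Y = fvar 1 * fg y + fvar 2 * fg w"
    by (simp add: Y_def slift_add slift_additive slift_axis smono_def lookup_single)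
  then have "slift Y = fdeg1 x y w - fg x" by (simp add: fdeg1_def)
  moreover have "fg x \<in> fless 1" unfolding fg_def One_nat_def fless_Suc by (rule fle_group_algebra)
  ultimately have "slift Y \<in> JJ 1" using assms by (simp only: JJ_diff II_JJ fless_JJ)
  moreover have "Y \<in> scomp 1"
    unfolding Y_def by (intro scomp_add scomp_sum scomp_axis) (auto simp: homog_def lookup_single when_def)
  ultimately have "Y = 0" using independent unfolding pbw_independent_def by blast
  have "lookup (Y $ h) (single 1 1) = lookup y (idx h)"
    "lookup (Y $ h) (single 2 1) = lookup w (idx h)" for h
  proof -
    have ne: "single (1::2) (1::nat) \<noteq> single 2 1"
    proof
      assume "single (1::2) (1::nat) = single 2 1"
      from arg_cong[OF this, of "\<lambda>m. lookup m 1"] show False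
        by (simp add: lookup_single when_def)
    qed
    have "Y $ h = single (single 1 1) (lookup y (idx h))
        + single (single 2 1) (lookup w (idx h))"
      by (simp add: Y_def axis_def)
    with ne show "lookup (Y $ h) (single 1 1) = lookup y (idx h)"
      "lookup (Y $ h) (single 2 1) = lookup w (idx h)"
      by (simp_all add: lookup_add lookup_single when_def)
  qed
  then have "ungal y = 0" "ungal w = 0" using \<open>Y = 0\<close> by (simp_all add: vec_eq_iff ungal_def)
  then show y: "y = 0" and w: "w = 0"
    by (metis gal_ungal gal_additive(1))+
  define X :: "(('p mod_ring, 2) sym_alg, 'p transvection_group) vec"
    where "X = (\<Sum>h\<in>UNIV. axis h (single 0 (lookup x (idx h))))"
  have "slift X = fg x"
    by (simp add: X_def slift_additive slift_axis smono_def fg_expand)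
  then have "slift X \<in> JJ 0" using assms by (simp add: fdeg1_def y w fg_additive II_JJ)
  moreover have "X \<in> scomp 0"
    unfolding X_def by (intro scomp_sum scomp_axis) (auto simp: homog_def)
  ultimately have "X = 0" using independent unfolding pbw_independent_def by blast
  moreover have "X $ h = single 0 (lookup x (idx h))" for h
    by (simp add: X_def axis_def)
  ultimately have "lookup x (idx h) = 0" for h
    by (metis lookup_single_eq lookup_zero zero_index)
  then have "ungal x = 0" by (simp add: vec_eq_iff ungal_def)
  then show "x = 0" by (metis gal_ungal gal_additive(1))
qed

lemma fg_injective: "fg x - fg y \<in> II \<Longrightarrow> x = y"
  using fdeg1_independent(1)[of "x - y" 0 0] by (simp add: fdeg1_def fg_additive)

definition eqv (infix \<open>\<doteq>\<close> 50) where "s \<doteq> t \<longleftrightarrow> s - t \<in> II"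

lemma eqv_refl: "s \<doteq> s"
  by (simp add: eqv_def II_zero)

lemma eqv_sym: "s \<doteq> t \<Longrightarrow> t \<doteq> s"
  using II_minus[of "s - t"] by (simp add: eqv_def)

lemma eqv_trans [trans]: "s \<doteq> t \<Longrightarrow> t \<doteq> u \<Longrightarrow> s \<doteq> u"
  using II_add[of "s - t" "t - u"] by (simp add: eqv_def)

lemma eqv_add: "s \<doteq> t \<Longrightarrow> s' \<doteq> t' \<Longrightarrow> s + s' \<doteq> t + t'"
  using II_add[of "s - t" "s' - t'"] by (simp add: eqv_def algebra_simps)

lemma eqv_diff: "s \<doteq> t \<Longrightarrow> s' \<doteq> t' \<Longrightarrow> s - s' \<doteq> t - t'"
  using II_diff[of "s - t" "s' - t'"] by (simp add: eqv_def algebra_simps)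

lemma eqv_mult_left: "s \<doteq> t \<Longrightarrow> u * s \<doteq> u * t"
  using II_mult(1)[of "s - t" u] by (simp add: eqv_def right_diff_distrib)

lemma eqv_mult_right: "s \<doteq> t \<Longrightarrow> s * u \<doteq> t * u"
  using II_mult(2)[of "s - t" u] by (simp add: eqv_def left_diff_distrib)

lemma grp_mult_eqv: "free_grp h * free_grp h' \<doteq> free_grp (h * h')"
  unfolding eqv_def by (rule relators)

lemma fg_mult_eqv: "fg x * fg y \<doteq> fg (x * y)"
proof (induction x rule: galg_idx_induct)
  case (single h c)
  show ?case
  proof (induction y rule: galg_idx_induct)
    case (single h' d)
    have "fg (single (idx h) c) * fg (single (idx h') d) =
        single 0 (c * d) * (free_grp h * free_grp h')"
    proof -
      have "C * H * (K * H') = (C * K) * (H * H')" if "H * K = K * H"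
        for C H K H' :: "('p mod_ring, 2, 'p transvection_group) free_alg"
        using that by (metis mult.assoc)
      from this[OF const_commute[symmetric]] show ?thesis by (simp only: fg_single mult_single add_0)
    qed
    also have "\<dots> \<doteq> single 0 (c * d) * free_grp (h * h')"
      by (intro eqv_mult_left grp_mult_eqv)
    finally show ?case by (simp add: mult_single fg_single flip: idx_mult)
  next
    case (add y y')
    from eqv_add[OF add] show ?case by (simp add: distrib_left fg_add)
  qed
next
  case (add x x')
  from eqv_add[OF add] show ?case by (simp add: distrib_right fg_add)
qed

subsection \<open>The cocycle condition\<close>

definition LL :: "'p transvection_group \<Rightarrow> 'p mod_ring ^ 2 \<Rightarrow> 'p galg"
  where "LL h v = gal (lam (axis h 1) v)"

lemma lam_bilinear: "bilinear_map (*s) (*s) (*s) lam" and kappa_bilinear: "bilinear_map (*s) (*s) kappa_scale \<kappa>"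
  and kappa_alternating: "\<kappa> v v = 0"
  using param by (auto simp: parameter_pair_def)

lemma LL_linear: "LL h (v + w) = LL h v + LL h w" "LL h (r *s v) = gconst r * LL h v"
  by (simp_all add: LL_def bilinear_mapD[OF lam_bilinear] gal_add gal_scale)

lemma grp_vec_eqv: "free_grp h * free_vec v \<doteq> free_vec (matrix_of h *v v) * free_grp h + fg (LL h v)"
  using relators(3)[of h v] by (simp add: eqv_def fg_def LL_def ungal_gal diff_diff_eq)

text \<open>Two ways to move a vector past a product of two group elements.\<close>

lemma LL_cocycle: "LL (h * h') v = LL h (matrix_of h' *v v) * gpow (idx h') + gpow (idx h) * LL h' v"
proof -
  let ?w = "matrix_of h' *v v" and ?u = "free_vec (matrix_of (h * h') *v v)"
  have "free_grp h * (free_grp h' * free_vec v) \<doteq> free_grp h * (free_vec ?w * free_grp h' + fg (LL h' v))"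
    by (intro eqv_mult_left grp_vec_eqv)
  also have "\<dots> = (free_grp h * free_vec ?w) * free_grp h' + fg (gpow (idx h)) * fg (LL h' v)"
    by (simp only: fg_gpow distrib_left mult.assoc)
  also have "\<dots> \<doteq> (?u * free_grp h + fg (LL h ?w)) * free_grp h' + fg (gpow (idx h) * LL h' v)"
    using grp_vec_eqv[of h ?w] by (intro eqv_add eqv_mult_right fg_mult_eqv) (simp add: matrix_vector_mul_assoc matrix_of_hom)
  also have "\<dots> = ?u * (free_grp h * free_grp h') + fg (LL h ?w) * fg (gpow (idx h')) + fg (gpow (idx h) * LL h' v)"
    by (simp only: fg_gpow distrib_right mult.assoc)
  also have "\<dots> \<doteq> ?u * free_grp (h * h') + fg (LL h ?w * gpow (idx h')) + fg (gpow (idx h) * LL h' v)"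
    by (intro eqv_add eqv_mult_left fg_mult_eqv grp_mult_eqv eqv_refl)
  finally have 1: "free_grp h * (free_grp h' * free_vec v) \<doteq>
      ?u * free_grp (h * h') + fg (LL h ?w * gpow (idx h')) + fg (gpow (idx h) * LL h' v)" .
  have "free_grp h * (free_grp h' * free_vec v) = (free_grp h * free_grp h') * free_vec v"
    by (simp only: mult.assoc)
  also have "\<dots> \<doteq> free_grp (h * h') * free_vec v"
    by (intro eqv_mult_right grp_mult_eqv)
  also have "\<dots> \<doteq> ?u * free_grp (h * h') + fg (LL (h * h') v)"
    by (rule grp_vec_eqv)
  finally have "?u * free_grp (h * h') + fg (LL (h * h') v) \<doteq>
      ?u * free_grp (h * h') + fg (LL h ?w * gpow (idx h')) + fg (gpow (idx h) * LL h' v)"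
    using 1 eqv_sym eqv_trans by blast
  then have "fg (LL (h * h') v) - fg (LL h ?w * gpow (idx h') + gpow (idx h) * LL h' v) \<in> II"
    unfolding eqv_def by (simp add: fg_add algebra_simps)
  then show ?thesis by (rule fg_injective)
qed

text \<open>With these elements conjugation by \<open>g\<close> sends \<open>v\<^sub>1\<close> to \<open>v\<^sub>1 + bb\<close> and \<open>v\<^sub>2\<close> to
  \<open>v\<^sub>1 + v\<^sub>2 + c0\<close>.\<close>

definition bb :: "'p galg" where "bb = LL gen v1 * gpow (- 1)"
definition c0 :: "'p galg" where "c0 = LL gen v2 * gpow (- 1)"

lemma LL_gen: "LL gen v1 = bb * gpow 1" "LL gen v2 = c0 * gpow 1"
  by (simp_all add: bb_def c0_def mult.assoc mult_single)

lemma LL_one: "LL 1 v = 0"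
  using LL_cocycle[of 1 1 v] by (simp add: matrix_of_hom idx_one)

lemma LL_gen_power:
  "LL (gen ^ i) v1 = of_nat i * bb * gpow (of_nat i)"
  "LL (gen ^ i) v2 = (of_nat i * c0 + of_nat (i choose 2) * bb) * gpow (of_nat i)"
proof (induction i)
  case 0
  show "LL (gen ^ 0) v1 = of_nat 0 * bb * gpow (of_nat 0)"
    "LL (gen ^ 0) v2 = (of_nat 0 * c0 + of_nat (0 choose 2) * bb) * gpow (of_nat 0)"
    by (simp_all add: LL_one numeral_2_eq_2)
next
  case (Suc i)
  have gen: "idx (gen :: 'p transvection_group) = 1" using idx_gen_power[of 1, where 'a = 'p] by simp
  have "LL (gen ^ Suc i) v = LL gen (matrix_of (gen ^ i) *v v) * gpow (of_nat i) + gpow 1 * LL (gen ^ i) v" for v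
    using LL_cocycle[of gen "gen ^ i" v] by (simp add: idx_gen_power gen)
  moreover have "gpow (of_nat (Suc i)) = gpow 1 * (gpow (of_nat i) :: 'p galg)"
    by (simp add: mult_single)
  moreover have "matrix_of (gen ^ i :: 'p transvection_group) *v v1 = v1"
    "matrix_of (gen ^ i :: 'p transvection_group) *v v2 = of_nat i *s v1 + v2"
    by (simp_all add: matrix_of_vec idx_gen_power)
  ultimately show "LL (gen ^ Suc i) v1 = of_nat (Suc i) * bb * gpow (of_nat (Suc i))"
    "LL (gen ^ Suc i) v2 = (of_nat (Suc i) * c0 + of_nat (Suc i choose 2) * bb) * gpow (of_nat (Suc i))"
    by (simp_all only: Suc LL_linear LL_gen single_of_nat) (simp_all add: numeral_2_eq_2 algebra_simps)
qed

lemma gD_gE_gpow: "gD (gpow (of_nat i)) = of_nat i * (gpow (of_nat i) :: 'p galg)"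
  "gE (gpow (of_nat i)) = of_nat (i choose 2) * (gpow (of_nat i) :: 'p galg)"
proof -
  have const: "(of_nat n :: 'p galg) = gconst (of_nat n)" for n by (simp only: single_of_nat)
  show "gD (gpow (of_nat i)) = of_nat i * (gpow (of_nat i) :: 'p galg)"
    unfolding const by (simp add: gD_single mult_single del: single_of_nat)
  show "gE (gpow (of_nat i)) = of_nat (i choose 2) * (gpow (of_nat i) :: 'p galg)"
    unfolding const of_nat_choose_two[OF odd]
    by (simp add: gE_def ghalf_def gD_single mult_single right_diff_distrib left_diff_distrib single_diff mult.assoc
        del: single_of_nat)
qed

lemma LL_eq: "LL h v1 = bb * gD (gpow (idx h))" "LL h v2 = c0 * gD (gpow (idx h)) + bb * gE (gpow (idx h))"
  by (rule transvection_group_cases[of h], simp add: LL_gen_power idx_gen_power gD_gE_gpow algebra_simps)+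

lemma lam_eq: "lam = Lam bb c0"
  by (rule bilinear_lam_eqI[OF lam_bilinear bilinear_Lam])
    (simp_all add: gal_Lam gal_axis LL_eq[unfolded LL_def] flip: gal_inject)

subsection \<open>The Jacobi condition\<close>

lemma fg_var_eqv:
  "fg x * fvar 1 \<doteq> fvar 1 * fg x + fg (bb * gD x)"
  "fg x * fvar 2 \<doteq> fvar 2 * fg x + fvar 1 * fg (gD x) + fg (c0 * gD x + bb * gE x)"
proof (induction x rule: galg_idx_induct)
  case (single h c)
  let ?C = "single 0 c :: ('p mod_ring, 2, 'p transvection_group) free_alg"
  let ?e = "gpow (idx h) :: 'p galg"
  have e: "single (idx h) c = gconst c * ?e" by (simp add: mult_single)
  have C: "t * (?C * u) = ?C * (t * u)" for t u
    by (metis const_commute mult.assoc)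
  have v: "free_vec v1 = fvar 1" "free_vec v2 = fvar 2" by (simp_all only: v1_axis v2_axis fvar_vec)
  have "?C * (free_grp h * fvar 1) \<doteq> ?C * (fvar 1 * free_grp h + fg (LL h v1))"
    using grp_vec_eqv[of h v1] by (intro eqv_mult_left) (simp add: matrix_of_vec v)
  then show "fg (single (idx h) c) * fvar 1 \<doteq>
      fvar 1 * fg (single (idx h) c) + fg (bb * gD (single (idx h) c))"
    by (simp only: fg_single distrib_left C mult.assoc fg_const LL_eq)
      (simp only: e gD_const mult.left_commute)
  have vec: "free_vec (idx h *s v1 + v2) = single 0 (idx h) * fvar 1 + (fvar 2 :: ('p mod_ring, 2, 'p transvection_group) free_alg)"
    by (simp add: free_vec_def UNIV_2 mult_single)
  have "free_grp h * fvar 2 \<doteq> (single 0 (idx h) * fvar 1 + fvar 2) * free_grp h + fg (LL h v2)"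
    using grp_vec_eqv[of h v2] by (simp add: matrix_of_vec v vec)
  moreover have "(single 0 (idx h) * fvar 1 + fvar 2) * free_grp h = fvar 2 * free_grp h + fvar 1 * fg (gD ?e)"
  proof -
    have "fg (gD ?e) = single 0 (idx h) * free_grp h"
      by (simp add: gD_single fg_single)
    then show ?thesis
      by (simp only: distrib_right add.commute mult.assoc[symmetric] const_commute[of _ "fvar 1"])
  qed
  ultimately have "?C * (free_grp h * fvar 2) \<doteq> ?C * (fvar 2 * free_grp h + fvar 1 * fg (gD ?e) + fg (LL h v2))"
    by (intro eqv_mult_left) simp
  then show "fg (single (idx h) c) * fvar 2 \<doteq>
      fvar 2 * fg (single (idx h) c) + fvar 1 * fg (gD (single (idx h) c)) +
      fg (c0 * gD (single (idx h) c) + bb * gE (single (idx h) c))"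
    by (simp only: fg_single distrib_left C[symmetric] mult.assoc fg_const LL_eq)
      (simp only: e gD_const gE_const mult.left_commute distrib_left)
next
  case (add x y)
  from eqv_add[OF add(1) add(3)] show "fg (x + y) * fvar 1 \<doteq> fvar 1 * fg (x + y) + fg (bb * gD (x + y))"
    by (simp add: fg_add gD_add algebra_simps)
  from eqv_add[OF add(2) add(4)] show "fg (x + y) * fvar 2 \<doteq>
      fvar 2 * fg (x + y) + fvar 1 * fg (gD (x + y)) + fg (c0 * gD (x + y) + bb * gE (x + y))"
    by (simp add: fg_add gD_add gE_add algebra_simps)
qed

text \<open>The coefficients of \<open>\<kappa>(v\<^sub>1, v\<^sub>2) = kk + v\<^sub>1 aa + v\<^sub>2 ww\<close>.\<close>

definition kk :: "'p galg" where "kk = gal (fst (\<kappa> v1 v2))"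
definition aa :: "'p galg" where "aa = gal (\<chi> h. snd (\<kappa> v1 v2) $ h $ 1)"
definition ww :: "'p galg" where "ww = gal (\<chi> h. snd (\<kappa> v1 v2) $ h $ 2)"

lemma kappa_value_eq: "\<kappa> v1 v2 = Kap_value kk aa ww"
proof (rule prod_eqI)
  show "fst (\<kappa> v1 v2) = fst (Kap_value kk aa ww)" by (simp add: Kap_value_def kk_def ungal_gal)
  show "snd (\<kappa> v1 v2) = snd (Kap_value kk aa ww)"
    by (simp add: Kap_value_def aa_def ww_def lookup_gal vec_eq_iff forall_2)
qed

lemma kappa_eq: "\<kappa> = Kap kk aa ww"
  using kappa_value_eq kappa_eq_Kap_iff[OF kappa_bilinear kappa_alternating] by blast

lemma commutator_eqv: "fvar 1 * fvar 2 - fvar 2 * fvar 1 \<doteq> fdeg1 kk aa ww"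
proof -
  have "free_kappa_value (Kap_value kk aa ww) = fdeg1 kk aa ww"
  proof -
    have C: "t * (single 0 c * u) = single 0 c * (t * u)"
      for t u :: "('p mod_ring, 2, 'p transvection_group) free_alg" and c
      by (metis const_commute mult.assoc)
    have "free_vec (x *s v1 + y *s v2) = single 0 x * fvar 1 + (single 0 y * fvar 2 :: ('p mod_ring, 2, 'p transvection_group) free_alg)" for x y
      by (simp add: free_vec_def UNIV_2 mult_single)
    then show ?thesis
      by (simp only: free_kappa_value_def Kap_value_def fst_conv snd_conv vec_lambda_beta fdeg1_def fg_def[symmetric]
          fg_expand[of aa] fg_expand[of ww] sum_distrib_left distrib_right sum.distrib C mult.assoc add.assoc)
  qed
  moreover have v: "free_vec v1 = fvar 1" "free_vec v2 = fvar 2" by (simp_all only: v1_axis v2_axis fvar_vec)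
  ultimately show ?thesis
    using relators(4)[of v1 v2] by (simp add: eqv_def kappa_value_eq)
qed

text \<open>Multiply the commutator relation by \<open>g\<close> from the left, and move \<open>g\<close> to the right in both sides.
  Comparing the coefficients of \<open>v\<^sub>1\<close> yields the first equation, comparing the constants the second.\<close>

lemma jacobi_conditions: "ww = gD bb" "bb * (aa + gD c0 - gD bb - gE bb) = 0"
proof -
  let ?e = "gpow 1 :: 'p galg"
  let ?G = "fg ?e" and ?V = "fvar 1 :: ('p mod_ring, 2, 'p transvection_group) free_alg"
    and ?W = "fvar 2 :: ('p mod_ring, 2, 'p transvection_group) free_alg"
  let ?B = "fg (bb * ?e)" and ?C = "fg (c0 * ?e)"
  let ?B1 = "fg (gD (bb * ?e))" and ?B2 = "fg (c0 * gD (bb * ?e) + bb * gE (bb * ?e))" and ?C1 = "fg (bb * gD (c0 * ?e))"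
  have De: "gD ?e = ?e" by (simp add: gD_single)
  have Ee: "gE ?e = 0" by (simp add: gE_def De)
  \<comment> \<open>The relators that are used to move \<open>g\<close>, and then \<open>b g\<close> and \<open>c g\<close>, past the vectors.\<close>
  define r1 r2 r3 r4 rk
    where "r1 = ?G * ?V - (?V * ?G + ?B)" and "r2 = ?G * ?W - (?W * ?G + ?V * ?G + ?C)"
      and "r3 = ?B * ?W - (?W * ?B + ?V * ?B1 + ?B2)" and "r4 = ?C * ?V - (?V * ?C + ?C1)"
      and "rk = ?V * ?W - ?W * ?V - fdeg1 kk aa ww"
  note r_defs = r1_def r2_def r3_def r4_def rk_def
  have r: "r1 \<in> II" "r2 \<in> II" "r3 \<in> II" "r4 \<in> II" "rk \<in> II"
    using fg_var_eqv(1)[of ?e] fg_var_eqv(2)[of ?e] fg_var_eqv(2)[of "bb * ?e"] fg_var_eqv(1)[of "c0 * ?e"] commutator_eqv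
    unfolding eqv_def r_defs De Ee by simp_all
  \<comment> \<open>The two ways to expand \<open>g\<close> times the commutator; the terms \<open>v\<^sub>1 v\<^sub>1 g\<close>, \<open>v\<^sub>1 c g\<close> and \<open>v\<^sub>2 b g\<close>
    occur both in \<open>g v\<^sub>1 v\<^sub>2\<close> and in \<open>g v\<^sub>2 v\<^sub>1\<close> and cancel.\<close>
  have "(fg kk * ?G + ?V * (fg aa * ?G) + ?W * (fg ww * ?G)) + ?V * (?B1 - ?B) + (?B2 - ?C1)
      - (?G * fg kk + ?V * (?G * fg aa) + ?B * fg aa + ?W * (?G * fg ww) + ?V * (?G * fg ww) + ?C * fg ww) =
      ?G * rk - r1 * ?W - ?V * r2 - r3 + r2 * ?V + ?W * r1 + ?V * r1 + r4 - rk * ?G + r1 * fg aa + r2 * fg ww"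
    (is "?lhs = ?rhs")
    unfolding r_defs fdeg1_def by (simp add: algebra_simps)
  also have "?rhs \<in> II"
    by (intro II_add II_diff II_mult r)
  finally have "?lhs \<in> II" .
  then have lhs: "0 \<doteq> ?lhs" unfolding eqv_def diff_0 by (rule II_minus)
  note lhs
  also have "?lhs \<doteq> (fg (kk * ?e) + ?V * fg (aa * ?e) + ?W * fg (ww * ?e)) + ?V * (?B1 - ?B) + (?B2 - ?C1)
      - (fg (?e * kk) + ?V * fg (?e * aa) + fg (bb * ?e * aa) + ?W * fg (?e * ww) + ?V * fg (?e * ww) + fg (c0 * ?e * ww))"
    by (intro eqv_add eqv_diff eqv_mult_left fg_mult_eqv eqv_refl)
  also have "\<dots> = fdeg1 (c0 * gD (bb * ?e) + bb * gE (bb * ?e) - bb * gD (c0 * ?e) - bb * ?e * aa - c0 * ?e * ww)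
      (gD (bb * ?e) - bb * ?e - ?e * ww) 0"
  proof -
    have eq: "(K + v * A + w * Q) + v * (B1 - B) + (B2 - C1) - (K + v * A + P + w * Q + v * R + S) =
        (B2 - C1 - P - S) + v * (B1 - B - R) + w * 0"
      for K v A w Q B1 B B2 C1 P R S :: "('p mod_ring, 2, 'p transvection_group) free_alg"
      by (simp add: algebra_simps)
    have comm: "kk * ?e = ?e * kk" "aa * ?e = ?e * aa" "ww * ?e = ?e * ww" by (simp_all only: mult.commute)
    show ?thesis unfolding fdeg1_def fg_additive(1,3) comm by (rule eq)
  qed
  finally have "fdeg1 (c0 * gD (bb * ?e) + bb * gE (bb * ?e) - bb * gD (c0 * ?e) - bb * ?e * aa - c0 * ?e * ww)
      (gD (bb * ?e) - bb * ?e - ?e * ww) 0 \<in> II"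
    using eqv_sym[of 0] unfolding eqv_def diff_0_right by blast
  from fdeg1_independent(1,2)[OF this]
  have const: "c0 * gD (bb * ?e) + bb * gE (bb * ?e) - bb * gD (c0 * ?e) - bb * ?e * aa - c0 * ?e * ww = 0"
    and lin: "gD (bb * ?e) - bb * ?e - ?e * ww = 0" by blast+
  have unit: "x = 0" if "x * ?e = 0" for x :: "'p galg"
  proof -
    have "x * ?e * gpow (- 1) = 0" using that by simp
    then show ?thesis by (simp add: mult.assoc mult_single)
  qed
  have Dmul: "gD (x * ?e) = (gD x + x) * ?e" for x :: "'p galg"
    by (simp add: gD_mult De distrib_right)
  have "gE (bb * ?e) = gE bb * ?e + gD bb * ?e"
    using E_mult[of bb ?e] by (simp add: half_derivation_E[OF odd] De Ee)
  then have Emul: "gE (bb * ?e) = (gE bb + gD bb) * ?e" by (simp add: distrib_right)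
  have "(gD bb - ww) * ?e = 0" using lin unfolding Dmul by (simp add: algebra_simps)
  then show ww: "ww = gD bb" using unit by fastforce
  have "(bb * (aa + gD c0 - gD bb - gE bb)) * ?e = 0"
    using const unfolding Dmul Emul ww by (simp add: algebra_simps)
  then show "bb * (aa + gD c0 - gD bb - gE bb) = 0" by (rule unit)
qed

theorem classifying_data:
  "\<exists>b c a k. b * (a + gD c - gD b - gE b) = 0 \<and> lam = Lam b c \<and> \<kappa> = Kap k a (gD b)"
  using jacobi_conditions lam_eq kappa_eq by metis

end

section \<open>The classification\<close>

theorem drinfeld_orbifold_algebra_iff:
  fixes lam :: "('p::prime_card mod_ring, 2, 'p transvection_group) lambda_map"
  assumes odd: "odd CARD('p)"
  shows "drinfeld_orbifold_algebra matrix_of lam \<kappa> \<longleftrightarrow>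
    (\<exists>b c a k. b * (a + gD c - gD b - gE b) = 0 \<and> lam = Lam b c \<and> \<kappa> = Kap k a (gD b))"
proof
  assume doa: "drinfeld_orbifold_algebra matrix_of lam \<kappa>"
  interpret orbifold_presentation matrix_of lam \<kappa>
    by standard (simp_all add: matrix_of_hom)
  from doa have param: "parameter_pair lam \<kappa>" and iso: "graded_algebra_isomorphic GR SG"
    unfolding drinfeld_orbifold_algebra_def by blast+
  interpret transvection_pbw lam \<kappa>
    by standard (use odd param graded_iso_imp_pbw_independent[OF iso finite] in auto)
  show "\<exists>b c a k. b * (a + gD c - gD b - gE b) = 0 \<and> lam = Lam b c \<and> \<kappa> = Kap k a (gD b)"
    by (rule classifying_data)
next
  assume "\<exists>b c a k. b * (a + gD c - gD b - gE b) = 0 \<and> lam = Lam b c \<and> \<kappa> = Kap k a (gD b)"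
  then obtain b c a k where data: "b * (a + gD c - gD b - gE b) = 0" "lam = Lam b c" "\<kappa> = Kap k a (gD b)" by blast
  interpret transvection_data b c a k by standard (use odd data in auto)
  show "drinfeld_orbifold_algebra matrix_of lam \<kappa>"
    unfolding drinfeld_orbifold_algebra_def data(2,3)
    using parameter_pair_Lam_Kap pbw_independent_imp_graded_iso[OF pbw_independent] by blast
qed

subsection \<open>The parametrisation by the tuple \<open>d\<close>\<close>

text \<open>The element \<open>c\<close> of the formula for \<open>\<lambda>\<close>. For \<open>j \<noteq> 0\<close> the factor \<open>j\<^sup>p\<^sup>-\<^sup>2\<close> is the inverse of \<open>j\<close>, so
  the sum inverts the derivation as far as possible, and \<open>y\<close> stands for \<open>f(v\<^sub>1)\<close>.\<close>

definition lam_part :: "'p::prime_card galg \<Rightarrow> 'p mod_ring list \<Rightarrow> 'p galg \<Rightarrow> 'p galg"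
  where "lam_part b d y = (\<Sum>j<CARD('p). single (of_nat j)
    (of_nat j ^ (CARD('p) - 2) * (of_nat ((j + 1) choose 2) * lookup b (of_nat j) + mu d j))) - y"

text \<open>The coefficient of \<open>v\<^sub>1\<close> in the formula for \<open>\<kappa>(v\<^sub>1, v\<^sub>2)\<close>.\<close>

definition kap_part :: "'p::prime_card mod_ring list \<Rightarrow> 'p galg \<Rightarrow> 'p galg"
  where "kap_part d y = gconst (\<Sum>m = 1..length d. (-1) ^ (m + 1) * d ! (m - 1)) + gD y"

lemma of_nat_eq_iff_less:
  assumes "i < CARD('p)" "j < CARD('p::prime_card)"
  shows "(of_nat i = (of_nat j :: 'p mod_ring)) \<longleftrightarrow> i = j"
  using assms by (auto simp: of_nat_eq_iff_cong_CHAR intro: cong_less_modulus_unique_nat)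

lemma lookup_sum_of_nat:
  assumes "i < CARD('p)"
  shows "lookup (\<Sum>j<CARD('p). single (of_nat j) (F j)) (of_nat i :: 'p::prime_card mod_ring) = (F i :: 'p mod_ring)"
proof -
  have "lookup (\<Sum>j<CARD('p). single (of_nat j) (F j)) (of_nat i :: 'p mod_ring) =
      (\<Sum>j<CARD('p). if j = i then F i else 0)"
    unfolding lookup_sum using assms
    by (intro sum.cong refl) (auto simp: lookup_single when_def of_nat_eq_iff_less)
  then show ?thesis using assms by simp
qed

lemma galg_eqI:
  fixes x y :: "'p::prime_card galg"
  assumes "\<And>i. i < CARD('p) \<Longrightarrow> lookup x (of_nat i) = lookup y (of_nat i)"
  shows "x = y"
  by (rule poly_mapping_eqI) (metis assms surj_of_nat_mod_ring)

lemma galg_sum_of_nat: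
  "(\<Sum>j<CARD('p). single (of_nat j) (lookup x (of_nat j))) = (x :: 'p::prime_card galg)"
  by (rule galg_eqI) (simp add: lookup_sum_of_nat)

lemma mod_ring_inverse_power:
  fixes x :: "'p::prime_card mod_ring"
  assumes "x \<noteq> 0" "odd CARD('p)"
  shows "x * x ^ (CARD('p) - 2) = 1"
proof -
  have "CARD('p) \<noteq> 2" using assms(2) by auto
  then have "inverse x = x ^ (CARD('p) - 2)" using assms(1) by (simp add: inverse_mod_ring_def nat_diff_distrib)
  then show ?thesis using assms(1) by (metis right_inverse)
qed

text \<open>The formulas of the theorem are made so that this element runs through the annihilator of \<open>b\<close>:
  the terms with \<open>y\<close> cancel, and the remaining ones match by \<open>(j + 1 choose 2) = (j choose 2) + j\<close>.\<close>

lemma jacobi_remainder: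
  fixes b y :: "'p::prime_card galg"
  assumes odd: "odd CARD('p)" and d: "length d \<le> CARD('p)"
  shows "kap_part d y + gD (lam_part b d y) - gD b - gE b = ann_comb d"
proof (rule galg_eqI)
  fix j assume j: "j < CARD('p)"
  show "lookup (kap_part d y + gD (lam_part b d y) - gD b - gE b) (of_nat j) =
      lookup (ann_comb d) (of_nat j)"
  proof (cases "j = 0")
    case True
    then show ?thesis
      using lookup_ann_comb[OF j d]
      by (simp add: kap_part_def lookup_add lookup_minus lookup_gD gE_def ghalf_def lookup_gconst_mult)
  next
    case False
    let ?j = "of_nat j :: 'p mod_ring"
    have nz: "?j \<noteq> 0" using of_nat_eq_iff_less[of j 0] j False by simp
    have choose: "of_nat (Suc j choose 2) = of_nat (j choose 2) + ?j"
      by (simp add: numeral_2_eq_2)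
    have inv: "?j * (?j ^ (CARD('p) - 2) * t) = t" for t
      using mod_ring_inverse_power[OF nz odd] by (simp flip: mult.assoc)
    show ?thesis
      using lookup_ann_comb[OF j d] nz False
      by (simp add: kap_part_def lam_part_def lookup_add lookup_minus lookup_gD lookup_gE[OF odd]
          lookup_sum_of_nat[OF j] right_diff_distrib inv choose lookup_single when_def distrib_right)
  qed
qed

text \<open>Bilinear maps agree if they agree on group elements and basis vectors, and an alternating map is
  determined by its value on \<open>(v\<^sub>1, v\<^sub>2)\<close>.\<close>

lemma given_by_data_iff:
  fixes bv \<kappa>C :: "'p::prime_card mod_ring ^ 'p transvection_group"
  assumes odd: "odd CARD('p)" and param: "parameter_pair lam \<kappa>"
  shows "given_by_data bv d f \<kappa>C lam \<kappa> \<longleftrightarrow>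
    lam = Lam (gal bv) (lam_part (gal bv) d (gal (f v1))) \<and>
    \<kappa> = Kap (gal \<kappa>C) (kap_part d (gal (f v1))) (gD (gal bv))"
proof -
  let ?b = "gal bv" and ?y = "gal (f v1)"
  let ?c = "lam_part ?b d ?y" and ?a = "kap_part d ?y"
  have bil: "bilinear_map (*s) (*s) (*s) lam" "bilinear_map (*s) (*s) kappa_scale \<kappa>" "\<And>v. \<kappa> v v = 0"
    using param by (auto simp: parameter_pair_def)
  have lookup_gen: "a $ (gen ^ j) = lookup (gal a) (of_nat j)" for a :: "'p mod_ring ^ 'p transvection_group" and j
    using lookup_gal[of a "gen ^ j"] by (simp add: idx_gen_power)
  have gal_term: "gal (r *s axis (gen ^ n) 1) = single (of_nat n) r" for r n
    by (simp add: gal_scale gal_axis idx_gen_power mult_single)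
  have shift: "single (of_nat (i + j)) r = single (of_nat j) r * (gpow (of_nat i) :: 'p galg)" for i j r
    by (simp add: mult_single add.commute)
  have gD_gE: "gD (gpow (of_nat i)) = gconst (of_nat i) * (gpow (of_nat i) :: 'p galg)"
    "gE (gpow (of_nat i)) = gconst (of_nat (i choose 2)) * (gpow (of_nat i) :: 'p galg)" for i
    by (simp_all only: gD_single gE_def ghalf_def of_nat_choose_two[OF odd] mult_single right_diff_distrib
        single_diff[symmetric]) (simp_all add: mult_single mult.assoc right_diff_distrib del: single_of_nat flip: single_diff)
  have lam1: "lam (axis (gen ^ i) 1) v1 = of_nat i *s (bv \<otimes>\<^bsub>group_algebra\<^esub> axis (gen ^ i) 1) \<longleftrightarrow>
      lam (axis (gen ^ i) 1) v1 = Lam ?b ?c (axis (gen ^ i) 1) v1" for i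
  proof -
    have "of_nat i *s (bv \<otimes>\<^bsub>group_algebra\<^esub> axis (gen ^ i) 1) = Lam ?b ?c (axis (gen ^ i) 1) v1"
      unfolding gal_inject[symmetric] gal_Lam gal_scale gal_mult gal_axis idx_gen_power gD_gE
      by (simp add: mult.left_commute del: single_of_nat)
    then show ?thesis by simp
  qed
  define rhs :: "nat \<Rightarrow> 'p mod_ring ^ 'p transvection_group" where "rhs i =
      (\<Sum>j<CARD('p). ((of_nat (i choose 2) + of_nat i * of_nat j ^ (CARD('p) - 2) * of_nat ((j + 1) choose 2))
            * bv $ (gen ^ j)) *s axis (gen ^ (i + j)) 1)
        + of_nat i *s (\<Sum>j<CARD('p). (of_nat j ^ (CARD('p) - 2) * mu d j) *s axis (gen ^ (i + j)) 1)
        - of_nat i *s ((\<Sum>j<CARD('p). (f v1 $ (gen ^ j)) *s axis (gen ^ j) 1)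
            \<otimes>\<^bsub>group_algebra\<^esub> axis (gen ^ i) 1)" for i
  have lam2: "rhs i = Lam ?b ?c (axis (gen ^ i) 1) v2" for i
  proof -
    define S where "S F = (\<Sum>j<CARD('p). single (of_nat j :: 'p mod_ring) (F j :: 'p mod_ring))" for F
    have S_add: "S (\<lambda>j. F j + F' j) = S F + S F'" for F F'
      by (simp add: S_def single_add sum.distrib)
    have S_mult: "S (\<lambda>j. r * F j) = gconst r * S F" for r F
      by (simp add: S_def sum_distrib_left mult_single)
    have "gal (rhs i) = S (\<lambda>j. (of_nat (i choose 2) + of_nat i * of_nat j ^ (CARD('p) - 2) * of_nat ((j + 1) choose 2))
            * lookup ?b (of_nat j)) * gpow (of_nat i)
        + gconst (of_nat i) * (S (\<lambda>j. of_nat j ^ (CARD('p) - 2) * mu d j) * gpow (of_nat i))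
        - gconst (of_nat i) * (S (\<lambda>j. lookup ?y (of_nat j)) * gpow (of_nat i))"
      unfolding rhs_def gal_additive gal_add gal_scale[of "of_nat i"] gal_mult gal_term gal_axis idx_gen_power
      by (simp only: lookup_gen shift S_def sum_distrib_right)
    also have "\<dots> = (gconst (of_nat i) * ?c + gconst (of_nat (i choose 2)) * ?b) * gpow (of_nat i)"
    proof -
      have S_lookup: "S (\<lambda>j. lookup x (of_nat j)) = x" for x
        by (simp add: S_def galg_sum_of_nat)
      have split: "(of_nat (i choose 2) + of_nat i * of_nat j ^ (CARD('p) - 2) * of_nat ((j + 1) choose 2))
            * lookup ?b (of_nat j) = of_nat (i choose 2) * lookup ?b (of_nat j) +
            of_nat i * (of_nat j ^ (CARD('p) - 2) * (of_nat ((j + 1) choose 2) * lookup ?b (of_nat j)))" for j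
        by (simp only: distrib_right mult.assoc)
      have c: "?c = S (\<lambda>j. of_nat j ^ (CARD('p) - 2) * (of_nat ((j + 1) choose 2) * lookup ?b (of_nat j)))
          + S (\<lambda>j. of_nat j ^ (CARD('p) - 2) * mu d j) - ?y"
        unfolding lam_part_def S_add[symmetric] by (simp only: S_def distrib_left)
      show ?thesis
        unfolding split S_add S_mult S_lookup c by (simp only: algebra_simps)
    qed
    also have "\<dots> = gal (Lam ?b ?c (axis (gen ^ i) 1) v2)"
      unfolding gal_Lam gal_axis idx_gen_power gD_gE by (simp add: algebra_simps del: single_of_nat)
    finally show ?thesis by (simp add: gal_inject)
  qed
  have lam: "(\<forall>i<CARD('p). lam (axis (gen ^ i) 1) v1 = Lam ?b ?c (axis (gen ^ i) 1) v1 \<and>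
      lam (axis (gen ^ i) 1) v2 = Lam ?b ?c (axis (gen ^ i) 1) v2) \<longleftrightarrow> lam = Lam ?b ?c"
  proof
    assume eq: "\<forall>i<CARD('p). lam (axis (gen ^ i) 1) v1 = Lam ?b ?c (axis (gen ^ i) 1) v1 \<and>
      lam (axis (gen ^ i) 1) v2 = Lam ?b ?c (axis (gen ^ i) 1) v2"
    show "lam = Lam ?b ?c"
    proof (rule bilinear_lam_eqI[OF bil(1) bilinear_Lam])
      fix h :: "'p transvection_group"
      obtain i where "i < CARD('p)" "h = gen ^ i" by (rule transvection_group_cases)
      with eq show "lam (axis h 1) v1 = Lam ?b ?c (axis h 1) v1" "lam (axis h 1) v2 = Lam ?b ?c (axis h 1) v2"
        by simp_all
    qed
  qed simp
  have kappa: "(\<kappa>C, vec_tensor ((\<Sum>m = 1..length d. (-1) ^ (m + 1) * d ! (m - 1)) *s v1) 1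
       + (\<Sum>j<CARD('p). vec_tensor ((of_nat j * bv $ (gen ^ j)) *s v2) (gen ^ j))
       + (\<Sum>j<CARD('p). vec_tensor ((of_nat j * f v1 $ (gen ^ j)) *s v1) (gen ^ j))) = Kap_value (gal \<kappa>C) ?a (gD ?b)"
    (is "(\<kappa>C, ?K) = _")
  proof (rule prod_eqI)
    show "snd (\<kappa>C, ?K) = snd (Kap_value (gal \<kappa>C) ?a (gD ?b))"
    proof (rule vec_eq_iff[THEN iffD2, OF allI])
      fix h :: "'p transvection_group"
      obtain i where i: "i < CARD('p)" and h: "h = gen ^ i" by (rule transvection_group_cases)
      have sum: "(\<Sum>j<CARD('p). vec_tensor (F j) (gen ^ j) $ h) = (F i :: 'p mod_ring ^ 2)" for F
      proof -
        have gen_eq: "gen ^ i = (gen ^ j :: 'p transvection_group) \<longleftrightarrow> j = i" if "j < CARD('p)" for j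
          using idx_inject[of "gen ^ i" "gen ^ j :: 'p transvection_group"] of_nat_eq_iff_less[OF i that]
          by (auto simp: idx_gen_power)
        have "(\<Sum>j<CARD('p). vec_tensor (F j) (gen ^ j) $ h) = (\<Sum>j<CARD('p). if j = i then F i else 0)"
          by (intro sum.cong refl) (auto simp: vec_tensor_def h gen_eq)
        then show ?thesis using i by simp
      qed
      have one: "h = 1 \<longleftrightarrow> of_nat i = (0 :: 'p mod_ring)"
        using idx_inject[of h 1] by (simp add: h idx_gen_power idx_one)
      have tensor_one: "vec_tensor v 1 $ h = (if h = 1 then v else (0 :: 'p mod_ring ^ 2))" for v
        by (simp add: vec_tensor_def)
      have "snd (\<kappa>C, ?K) $ h = (if h = 1 then (\<Sum>m = 1..length d. (-1) ^ (m + 1) * d ! (m - 1)) *s v1 else 0)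
          + (of_nat i * bv $ (gen ^ i)) *s v2 + (of_nat i * f v1 $ (gen ^ i)) *s v1"
        by (simp only: snd_conv vector_add_component sum_component sum tensor_one)
      also have "\<dots> = snd (Kap_value (gal \<kappa>C) ?a (gD ?b)) $ h"
        unfolding one by (simp add: Kap_value_def kap_part_def lookup_add lookup_gD lookup_gen lookup_single
            when_def h idx_gen_power vec_eq_iff forall_2 eq_commute[of 0])
      finally show "snd (\<kappa>C, ?K) $ h = snd (Kap_value (gal \<kappa>C) ?a (gD ?b)) $ h" .
    qed
  qed (simp add: Kap_value_def ungal_gal)
  show ?thesis
    unfolding given_by_data_def lam1 rhs_def[symmetric] lam2 lam kappa kappa_eq_Kap_iff[OF bil(2,3)] ..
qed

theorem drinfeld_orbifold_algebra_given_by_data: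
  fixes lam :: "('p::prime_card mod_ring, 2, 'p transvection_group) lambda_map"
  assumes odd: "odd CARD('p)"
  shows "drinfeld_orbifold_algebra matrix_of lam \<kappa> \<longleftrightarrow> parameter_pair lam \<kappa> \<and>
    (\<exists>b d f \<kappa>C. length d = aug_order b \<and> Vector_Spaces.linear (*s) (*s) f \<and> given_by_data b d f \<kappa>C lam \<kappa>)"
proof
  assume doa: "drinfeld_orbifold_algebra matrix_of lam \<kappa>"
  then have param: "parameter_pair lam \<kappa>" by (simp add: drinfeld_orbifold_algebra_def)
  from doa obtain b c a k where jacobi: "b * (a + gD c - gD b - gE b) = 0"
    and eq: "lam = Lam b c" "\<kappa> = Kap k a (gD b)"
    unfolding drinfeld_orbifold_algebra_iff[OF odd] by blast
  let ?k = "aug_order (ungal b)"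
  have order: "gorder b ?k" using gorder_aug_order[of "ungal b"] by (simp add: gal_ungal)
  then have k: "?k \<le> CARD('p)" by (simp add: gorder_def)
  from jacobi have "gx ^ (CARD('p) - ?k) dvd a + gD c - gD b - gE b"
    by (simp add: gorder_annihilator[OF order])
  then obtain d where d: "length d = ?k" "ann_comb d = a + gD c - gD b - gE b"
    unfolding ann_comb_range[OF k] by blast
  \<comment> \<open>Subtracting a suitable \<open>f(v\<^sub>1)\<close> yields the given \<open>c\<close>. The given \<open>a\<close> results as well,
    because \<open>b\<close>, \<open>c\<close> and the annihilating element determine it.\<close>
  define y where "y = lam_part b d 0 - c"
  define f :: "'p mod_ring ^ 2 \<Rightarrow> 'p mod_ring ^ 'p transvection_group" where "f v = v $ 1 *s ungal y" for v
  have f: "Vector_Spaces.linear (*s) (*s) f"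
    unfolding Vector_Spaces.linear_iff
    by (simp add: vec.vector_space_axioms f_def vec.scale_left_distrib)
  have y: "gal (f v1) = y" by (simp add: f_def gal_ungal)
  have c: "lam_part b d y = c" by (simp add: y_def lam_part_def)
  have "kap_part d y + gD c - gD b - gE b = a + gD c - gD b - gE b"
    using jacobi_remainder[OF odd, of d y b] d k c by simp
  then have a: "kap_part d y = a" by simp
  have "given_by_data (ungal b) d f (ungal k) lam \<kappa>"
    unfolding given_by_data_iff[OF odd param] gal_ungal y c a using eq by blast
  with param d f show "parameter_pair lam \<kappa> \<and>
    (\<exists>b d f \<kappa>C. length d = aug_order b \<and> Vector_Spaces.linear (*s) (*s) f \<and> given_by_data b d f \<kappa>C lam \<kappa>)"
    by blast
next
  assume "parameter_pair lam \<kappa> \<and>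
    (\<exists>b d f \<kappa>C. length d = aug_order b \<and> Vector_Spaces.linear (*s) (*s) f \<and> given_by_data b d f \<kappa>C lam \<kappa>)"
  then obtain b d f \<kappa>C where param: "parameter_pair lam \<kappa>" and d: "length d = aug_order b"
    and data: "given_by_data b d f \<kappa>C lam \<kappa>" by blast
  have k: "aug_order b \<le> CARD('p)" using gorder_aug_order[of b] by (simp add: gorder_def)
  have "gx ^ (CARD('p) - aug_order b) dvd ann_comb d"
    using ann_comb_range[OF k] d by blast
  then have "gal b * ann_comb d = 0" by (simp add: gorder_annihilator[OF gorder_aug_order])
  then have "gal b * (kap_part d (gal (f v1)) + gD (lam_part (gal b) d (gal (f v1))) - gD (gal b) - gE (gal b)) = 0"
    using jacobi_remainder[OF odd, of d] d k by simp
  with data show "drinfeld_orbifold_algebra matrix_of lam \<kappa>"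
    unfolding given_by_data_iff[OF odd param] drinfeld_orbifold_algebra_iff[OF odd] by blast
qed

subsection \<open>The number of Drinfeld orbifold algebras\<close>

lemma Lam_inject:
  assumes "Lam b c = Lam b' c'"
  shows "b = b'" "c = c'"
proof -
  have "gD (gal (axis gen 1 :: 'a mod_ring ^ 'a transvection_group)) = gpow 1"
    "gE (gal (axis gen 1 :: 'a mod_ring ^ 'a transvection_group)) = 0"
    using idx_gen_power[of 1, where 'a = 'a] by (simp_all add: gal_axis gE_def gD_single)
  then have "gconst (v $ 1) * (b * gpow 1) + gconst (v $ 2) * (c * gpow 1) =
      gconst (v $ 1) * (b' * gpow 1) + gconst (v $ 2) * (c' * gpow 1)" for v :: "'a mod_ring ^ 2"
    using gal_Lam[of b c "axis gen 1" v] gal_Lam[of b' c' "axis gen 1" v] by (simp add: assms)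
  from this[of v1] this[of v2] have "b * gpow 1 = b' * gpow 1" "c * gpow 1 = c' * gpow 1"
    by simp_all
  then have "b * gpow 1 * gpow (- 1) = b' * gpow 1 * gpow (- 1)" "c * gpow 1 * gpow (- 1) = c' * gpow 1 * gpow (- 1)"
    by simp_all
  then show "b = b'" "c = c'" by (simp_all add: mult.assoc mult_single)
qed

lemma Kap_inject:
  assumes "Kap k a w = Kap k' a' w'"
  shows "k = k'" "a = a'"
proof -
  have "Kap_value k a w = Kap_value k' a' w'"
    using fun_cong[OF fun_cong[OF assms, of v1], of v2] by (simp add: Kap_def kappa_scale_def prod_eq_iff vec_eq_iff)
  then have "ungal k = ungal k'" "ungal a = ungal a'"
    by (auto simp: Kap_value_def ungal_def vec_eq_iff forall_2)
  then show "k = k'" "a = a'" by (metis gal_ungal)+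
qed

text \<open>The parameters are \<open>b\<close>, \<open>c\<close>, \<open>k\<close> and, instead of \<open>a\<close>, the annihilating element
  \<open>z = a + D c - D b - E b\<close>.\<close>

theorem card_drinfeld_orbifold_algebras:
  assumes odd: "odd CARD('p::prime_card)"
  shows "card {(lam, \<kappa>). drinfeld_orbifold_algebra (matrix_of :: 'p transvection_group \<Rightarrow> _) lam \<kappa>} =
    CARD('p) ^ (3 * CARD('p) + 1)"
proof -
  define zero_products where "zero_products = {(b, z :: 'p galg). b * z = 0}"
  define mk where "mk = (\<lambda>((b, z), c, k :: 'p galg). (Lam b c, Kap k (z - gD c + gD b + gE b) (gD b)))"
  have "{(lam, \<kappa>). drinfeld_orbifold_algebra (matrix_of :: 'p transvection_group \<Rightarrow> _) lam \<kappa>} =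
      mk ` (zero_products \<times> UNIV)"
  proof (intro equalityI subsetI)
    fix x assume "x \<in> {(lam, \<kappa>). drinfeld_orbifold_algebra (matrix_of :: 'p transvection_group \<Rightarrow> _) lam \<kappa>}"
    then obtain b c a k where "b * (a + gD c - gD b - gE b) = 0" "x = (Lam b c, Kap k a (gD b))"
      by (auto simp: drinfeld_orbifold_algebra_iff[OF odd])
    then show "x \<in> mk ` (zero_products \<times> UNIV)"
      by (intro image_eqI[of _ _ "((b, a + gD c - gD b - gE b), c, k)"]) (simp_all add: mk_def zero_products_def)
  next
    fix x assume "x \<in> mk ` (zero_products \<times> UNIV)"
    then obtain b z c k where "b * z = 0" "x = (Lam b c, Kap k (z - gD c + gD b + gE b) (gD b))"
      by (auto simp: mk_def zero_products_def)
    moreover have "z = (z - gD c + gD b + gE b) + gD c - gD b - gE b" by simp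
    ultimately show "x \<in> {(lam, \<kappa>). drinfeld_orbifold_algebra (matrix_of :: 'p transvection_group \<Rightarrow> _) lam \<kappa>}"
      unfolding drinfeld_orbifold_algebra_iff[OF odd] by (simp, metis)
  qed
  moreover have "inj_on mk (zero_products \<times> UNIV)"
  proof (rule inj_onI)
    fix x x' assume eq: "mk x = mk x'"
    obtain b z c k b' z' c' k' where x: "x = ((b, z), c, k)" "x' = ((b', z'), c', k')"
      by (metis prod.exhaust)
    from eq have Lam: "Lam b c = Lam b' c'"
      and Kap: "Kap k (z - gD c + gD b + gE b) (gD b) = Kap k' (z' - gD c' + gD b' + gE b') (gD b')"
      by (simp_all add: mk_def x)
    from Lam_inject[OF Lam] Kap_inject[OF Kap] show "x = x'" by (simp add: x)
  qed
  ultimately have "card {(lam, \<kappa>). drinfeld_orbifold_algebra (matrix_of :: 'p transvection_group \<Rightarrow> _) lam \<kappa>} =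
      card zero_products * card (UNIV :: ('p galg \<times> 'p galg) set)"
    by (simp add: card_image card_cartesian_product)
  also have "\<dots> = CARD('p) ^ (CARD('p) + 1) * (CARD('p) ^ CARD('p) * CARD('p) ^ CARD('p))"
    unfolding UNIV_Times_UNIV[symmetric] card_cartesian_product
    by (simp add: zero_products_def card_zero_products card_galg)
  also have "\<dots> = CARD('p) ^ (3 * CARD('p) + 1)"
    unfolding power_add[symmetric] by (rule arg_cong[of _ _ "\<lambda>n. CARD('p) ^ n"]) simp
  finally show ?thesis .
qed

theorem corollary8p3:
  assumes "odd CARD('p::prime_card)"
  shows "(\<forall>b :: 'p mod_ring ^ 'p transvection_group. \<exists>!k. has_aug_order b k) \<and>
    {(lam, \<kappa>). drinfeld_orbifold_algebra (matrix_of :: 'p transvection_group \<Rightarrow> _) lam \<kappa>} =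
    {(lam, \<kappa>). parameter_pair lam \<kappa> \<and>
      (\<exists>b d f \<kappa>C. length d = aug_order b \<and> Vector_Spaces.linear (*s) (*s) f \<and>
        given_by_data b d f \<kappa>C lam \<kappa>)} \<and>
    card {(lam, \<kappa>). drinfeld_orbifold_algebra (matrix_of :: 'p transvection_group \<Rightarrow> _) lam \<kappa>} =
      CARD('p) ^ (3 * CARD('p) + 1)"
  unfolding drinfeld_orbifold_algebra_given_by_data[OF assms, symmetric]
  using ex1_aug_order card_drinfeld_orbifold_algebras[OF assms] by blast

end
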